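(* Let $T_1,\ldots,T_n\in \mathcal{B}(\mathcal{H})$ be commuting contractions on a complex Hilbert space $\mathcal H$ and let $T=\prod_{i=1}^n T_i$. (a) If $\mathcal{K}$ is the minimal isometric dilation space of $T$, then $(T_1,\ldots ,T_n)$ possesses an isometric dilation $(V_1,\ldots,V_{n})$ on $\mathcal{K}$ with $V=\prod_{i=1}^nV_i$ being the minimal isometric dilation of $T$ if and only if there are unique orthogonal projections $P_1,\ldots ,P_n$ and unique commuting unitaries $U_1,\ldots ,U_n$ in $\mathcal{B}(\mathcal{D}_T)$ with $\prod_{i=1}^n U_i=I_{\mathcal{D}_{T}}$ such that the following conditions are satisfied for all $i,j\in\{1, \dots, n\}$: (1) $D_TT_i=P_i^{\perp}U_i^*D_T+P_iU_i^*D_TT$, (2) $P_i^{\perp}U_i^*P_j^{\perp}U_j^*=P_j^{\perp}U_j^*P_i^{\perp}U_i^*$, (3) $U_iP_iU_jP_j=U_jP_jU_iP_i$, (4) $D_TU_iP_iU_i^*D_T=D_{T_i}^2$, (5) $P_1+U_1^*P_2U_1+U_1^*U_2^*P_3U_2U_1+\ldots +U_1^*U_2^*\ldots U_{n-1}^*P_nU_{n-1}\ldots U_2U_1 =I_{\mathcal{D}_T}$. (b) Such an isometric dilation is minimal, and it is unique in the sense that if $(W_1, \dots , W_n)$ on $\mathcal K_1$ and $(Y_1, \dots , Y_n)$ on $\mathcal K_2$ are two isometric dilations of $(T_1, \dots , T_n)$ such that $W=\prod_{i=1}^nW_i$ and $Y=\prod_{i=1}^nY_i$ are minimal isometric dilations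 of $T$ on $\mathcal K_1$ and $\mathcal K_2$ respectively, then there is a unitary $\widetilde{U}:\mathcal K_1 \rightarrow \mathcal K_2$ such that $(W_1, \dots , W_n)=(\widetilde{U}^*Y_1\widetilde{U}, \dots , \widetilde{U}^*Y_n\widetilde{U})$.
   Context: All operators are bounded operators on complex Hilbert spaces. A contraction is an operator of norm at most $1$. For a contraction $T$ on $\mathcal H$, $D_T=(I-T^*T)^{1/2}$ is the defect operator and $\mathcal D_T=\overline{\mathrm{Ran}}\,D_T$. For an orthogonal projection $P$, $P^\perp=I-P$. A commuting tuple of isometries $(V_1,\dots,V_n)$ on a Hilbert space $\mathcal K$ is an isometric dilation of a commuting tuple of contractions $(T_1,\dots,T_n)$ on $\mathcal H$ if $\mathcal H$ is (identified with) a closed subspace of $\mathcal K$ and $T_1^{k_1}\cdots T_n^{k_n}=P_{\mathcal H}(V_1^{k_1}\cdots V_n^{k_n})|_{\mathcal H}$ for all non-negative integers $k_1,\dots,k_n$, where $P_{\mathcal H}:\mathcal K\to\mathcal H$ is the orthogonal projection. It is minimal if $\mathcal K=\overline{\mathrm{Span}}\{V_1^{k_1}\cdots V_n^{k_n}h: h\in\mathcal H,\ k_1,\dots,k_n\in\mathbb N\cup\{0\}\}$. For a single contraction $T$ (the case $n=1$) a minimal isometric dilation is unique up to a unitary equivalence; the space on which it acts is called the minimal isometric dilation space of $T$. *)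

theory Defs
  imports "HOL-Analysis.Analysis"
begin

text \<open>
  A complex Hilbert space is a complete real inner product space with a compatible complex
  scalar multiplication and a complex inner product whose real part is the real inner product.
  The norm, the topology and completeness are thus those of the library; positive definiteness
  of \<open>cinner\<close> is inherited from \<open>inner\<close>.  The complex inner product is linear in its first argument.
\<close>

class complex_hilbert = real_inner + banach +
  fixes scaleC :: "complex \<Rightarrow> 'a \<Rightarrow> 'a" (infixr "*\<^sub>C" 75)
    and cinner :: "'a \<Rightarrow> 'a \<Rightarrow> complex"
  assumes scaleC_add_right: "a *\<^sub>C (x + y) = a *\<^sub>C x + a *\<^sub>C y"
    and scaleC_add_left: "(a + b) *\<^sub>C x = a *\<^sub>C x + b *\<^sub>C x"
    and scaleC_scaleC: "a *\<^sub>C b *\<^sub>C x = (a * b) *\<^sub>C x"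
    and scaleC_of_real: "complex_of_real r *\<^sub>C x = r *\<^sub>R x"
    and cinner_add_left: "cinner (x + y) z = cinner x z + cinner y z"
    and cinner_scaleC_left: "cinner (a *\<^sub>C x) y = a * cinner x y"
    and cinner_commute: "cinner x y = cnj (cinner y x)"
    and Re_cinner: "Re (cinner x y) = inner x y"

interpretation complex_vector: vector_space "scaleC :: complex \<Rightarrow> 'a \<Rightarrow> 'a::complex_hilbert"
proof
  fix x :: 'a
  show "1 *\<^sub>C x = x"
    using scaleC_of_real[of 1 x] by simp
qed (simp_all add: scaleC_add_right scaleC_add_left scaleC_scaleC)

instantiation complex :: complex_hilbert
begin

definition "scaleC_complex = (\<lambda>a x :: complex. a * x)"
definition "cinner_complex = (\<lambda>x y :: complex. x * cnj y)"

instance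
  by standard
    (simp_all add: scaleC_complex_def cinner_complex_def inner_complex_def algebra_simps scaleR_conv_of_real)

end


subsection \<open>Bounded operators between closed subspaces\<close>

text \<open>
  To speak about operators on a closed subspace such as \<open>\<D>\<^sub>T\<close>, an operator from
  \<open>S\<close> to \<open>R\<close> is a total function of which only the values on \<open>S\<close> matter, so
  two such operators are equal when they agree on \<open>S\<close>.  A whole Hilbert space is the carrier \<open>UNIV\<close>.
\<close>

definition bounded_op :: "'a::complex_hilbert set \<Rightarrow> 'b::complex_hilbert set \<Rightarrow> ('a \<Rightarrow> 'b) \<Rightarrow> bool" where
  "bounded_op S R f \<longleftrightarrow>
     (\<forall>x\<in>S. f x \<in> R) \<and>
     (\<forall>x\<in>S. \<forall>y\<in>S. f (x + y) = f x + f y) \<and>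
     (\<forall>c. \<forall>x\<in>S. f (c *\<^sub>C x) = c *\<^sub>C f x) \<and>
     (\<exists>C. \<forall>x\<in>S. norm (f x) \<le> C * norm x)"

definition adj_on :: "'a::complex_hilbert set \<Rightarrow> ('a \<Rightarrow> 'b::complex_hilbert) \<Rightarrow> 'b \<Rightarrow> 'a" where
  "adj_on S f y = (THE z. z \<in> S \<and> (\<forall>x\<in>S. cinner (f x) y = cinner x z))"

definition unitary_op :: "'a::complex_hilbert set \<Rightarrow> 'b::complex_hilbert set \<Rightarrow> ('a \<Rightarrow> 'b) \<Rightarrow> bool" where
  "unitary_op S R U \<longleftrightarrow> bounded_op S R U \<and>
     (\<forall>x\<in>S. adj_on S U (U x) = x) \<and> (\<forall>y\<in>R. U (adj_on S U y) = y)"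

definition orth_projection :: "'a::complex_hilbert set \<Rightarrow> ('a \<Rightarrow> 'a) \<Rightarrow> bool" where
  "orth_projection S P \<longleftrightarrow> bounded_op S S P \<and>
     (\<forall>x\<in>S. P (P x) = P x) \<and> (\<forall>x\<in>S. adj_on S P x = P x)"

definition perp :: "('a::complex_hilbert \<Rightarrow> 'a) \<Rightarrow> 'a \<Rightarrow> 'a" where
  "perp P x = x - P x"

definition proj_onto :: "'a::complex_hilbert set \<Rightarrow> 'a \<Rightarrow> 'a" where
  "proj_onto M x = (THE y. y \<in> M \<and> (\<forall>z\<in>M. cinner (x - y) z = 0))"

definition isometry_op :: "('a::complex_hilbert \<Rightarrow> 'b::complex_hilbert) \<Rightarrow> bool" where
  "isometry_op V \<longleftrightarrow> bounded_op UNIV UNIV V \<and> (\<forall>x. norm (V x) = norm x)"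

definition contraction_op :: "('a::complex_hilbert \<Rightarrow> 'a) \<Rightarrow> bool" where
  "contraction_op T \<longleftrightarrow> bounded_op UNIV UNIV T \<and> onorm T \<le> 1"

definition commuting_on :: "'a set \<Rightarrow> nat \<Rightarrow> (nat \<Rightarrow> 'a \<Rightarrow> 'a) \<Rightarrow> bool" where
  "commuting_on S n A \<longleftrightarrow> (\<forall>i\<in>{1..n}. \<forall>j\<in>{1..n}. \<forall>x\<in>S. A i (A j x) = A j (A i x))"


subsection \<open>Defect operators\<close>

definition positive_op :: "('a::complex_hilbert \<Rightarrow> 'a) \<Rightarrow> bool" where
  "positive_op A \<longleftrightarrow> bounded_op UNIV UNIV A \<and> (\<forall>x. cinner (A x) x \<in> \<real>\<^sub>\<ge>\<^sub>0)"

definition sqrt_op :: "('a::complex_hilbert \<Rightarrow> 'a) \<Rightarrow> 'a \<Rightarrow> 'a" where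
  "sqrt_op A = (THE B. positive_op B \<and> (\<forall>x. B (B x) = A x))"

definition defect :: "('a::complex_hilbert \<Rightarrow> 'a) \<Rightarrow> 'a \<Rightarrow> 'a" where
  "defect T = sqrt_op (\<lambda>x. x - adj_on UNIV T (T x))"

definition defect_space :: "('a::complex_hilbert \<Rightarrow> 'a) \<Rightarrow> 'a set" where
  "defect_space T = closure (range (defect T))"


subsection \<open>Isometric dilations\<close>

text \<open>Tuples are functions on the indices \<open>1, \<dots>, n\<close>; \<open>op_prod n A\<close> is \<open>A\<^sub>1 \<cdots> A\<^sub>n\<close>.\<close>

definition op_prod :: "nat \<Rightarrow> (nat \<Rightarrow> 'a \<Rightarrow> 'a) \<Rightarrow> 'a \<Rightarrow> 'a" where
  "op_prod n A = foldr A [1..<Suc n]"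

definition op_monomial :: "nat \<Rightarrow> (nat \<Rightarrow> 'a \<Rightarrow> 'a) \<Rightarrow> (nat \<Rightarrow> nat) \<Rightarrow> 'a \<Rightarrow> 'a" where
  "op_monomial n A k = op_prod n (\<lambda>i. A i ^^ k i)"

text \<open>
  The isometry \<open>J\<close> identifies \<open>\<H>\<close> with the closed subspace \<open>range J\<close> of \<open>\<K>\<close>.
\<close>

definition isometric_dilation ::
  "nat \<Rightarrow> ('h::complex_hilbert \<Rightarrow> 'k::complex_hilbert) \<Rightarrow> (nat \<Rightarrow> 'h \<Rightarrow> 'h) \<Rightarrow> (nat \<Rightarrow> 'k \<Rightarrow> 'k) \<Rightarrow> bool" where
  "isometric_dilation n J T V \<longleftrightarrow>
     isometry_op J \<and> (\<forall>i\<in>{1..n}. isometry_op (V i)) \<and> commuting_on UNIV n V \<and>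
     (\<forall>k h. J (op_monomial n T k h) = proj_onto (range J) (op_monomial n V k (J h)))"

definition minimal_isometric_dilation ::
  "nat \<Rightarrow> ('h::complex_hilbert \<Rightarrow> 'k::complex_hilbert) \<Rightarrow> (nat \<Rightarrow> 'h \<Rightarrow> 'h) \<Rightarrow> (nat \<Rightarrow> 'k \<Rightarrow> 'k) \<Rightarrow> bool" where
  "minimal_isometric_dilation n J T V \<longleftrightarrow> isometric_dilation n J T V \<and>
     closure (complex_vector.span {op_monomial n V k (J h) | k h. True}) = UNIV"

abbreviation minimal_isometric_dilation1 ::
  "('h::complex_hilbert \<Rightarrow> 'k::complex_hilbert) \<Rightarrow> ('h \<Rightarrow> 'h) \<Rightarrow> ('k \<Rightarrow> 'k) \<Rightarrow> bool" where
  "minimal_isometric_dilation1 J T V \<equiv> minimal_isometric_dilation 1 J (\<lambda>_. T) (\<lambda>_. V)"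

text \<open>
  The requirements on projections \<open>P\<^sub>i\<close> and commuting unitaries \<open>U\<^sub>i\<close> in \<open>\<B>(\<D>\<^sub>T)\<close>, where \<open>T = T\<^sub>1 \<cdots> T\<^sub>n\<close>.
  In the last condition \<open>foldr Ua [1..<k]\<close> is \<open>U\<^sub>1\<^sup>* \<cdots> U\<^sub>k\<^sub>-\<^sub>1\<^sup>*\<close>, while
  \<open>fold U [1..<k]\<close> is \<open>U\<^sub>k\<^sub>-\<^sub>1 \<cdots> U\<^sub>1\<close>.
\<close>

definition dilation_data ::
  "nat \<Rightarrow> (nat \<Rightarrow> 'h::complex_hilbert \<Rightarrow> 'h) \<Rightarrow> (nat \<Rightarrow> 'h \<Rightarrow> 'h) \<Rightarrow> (nat \<Rightarrow> 'h \<Rightarrow> 'h) \<Rightarrow> bool" where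
  "dilation_data n T P U \<longleftrightarrow>
    (let Tp = op_prod n T; D = defect Tp; S = defect_space Tp; Ua = (\<lambda>i. adj_on S (U i)) in
      (\<forall>i\<in>{1..n}. orth_projection S (P i)) \<and>
      (\<forall>i\<in>{1..n}. unitary_op S S (U i)) \<and>
      commuting_on S n U \<and>
      (\<forall>x\<in>S. op_prod n U x = x) \<and>
      (\<forall>i\<in>{1..n}. \<forall>h. D (T i h) = perp (P i) (Ua i (D h)) + P i (Ua i (D (Tp h)))) \<and>
      (\<forall>i\<in>{1..n}. \<forall>j\<in>{1..n}. \<forall>x\<in>S.
         perp (P i) (Ua i (perp (P j) (Ua j x))) = perp (P j) (Ua j (perp (P i) (Ua i x)))) \<and>
      (\<forall>i\<in>{1..n}. \<forall>j\<in>{1..n}. \<forall>x\<in>S.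
         U i (P i (U j (P j x))) = U j (P j (U i (P i x)))) \<and>
      (\<forall>i\<in>{1..n}. \<forall>h. D (U i (P i (Ua i (D h)))) = defect (T i) (defect (T i) h)) \<and>
      (\<forall>x\<in>S. (\<Sum>k = 1..n. foldr Ua [1..<k] (P k (fold U [1..<k] x))) = x))"

end

theory Submission
  imports Defs
begin

text \<open>
  Let \<open>V\<close>, acting on \<open>\<K>\<close>, be the minimal isometric dilation of \<open>T = T\<^sub>1 \<cdots> T\<^sub>n\<close>, with \<open>\<H>\<close> embedded by \<open>J\<close>.  As
  \<open>J\<^sup>* V = T J\<^sup>*\<close>, the map \<open>D\<^sub>T h \<mapsto> V J h - J T h\<close> extends to an isometry \<open>E\<close> of \<open>\<D>\<^sub>T\<close> onto a wandering subspace of \<open>V\<close>,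
  and \<open>\<K> = J \<H> \<oplus> \<Oplus> V\<^sup>m E \<D>\<^sub>T\<close>.  On the second summand \<open>V\<close> is a shift, and operators commuting with it have
  symbols with coefficients in \<open>\<B>(\<D>\<^sub>T)\<close>.

  Suppose that \<open>V\<close> is the product of commuting isometries \<open>V\<^sub>i\<close> that dilate the \<open>T\<^sub>i\<close>, and let \<open>V\<^sub>i'\<close> be the product of the
  others.  Because \<open>V\<^sub>i\<^sup>* V = V\<^sub>i'\<close>, the symbol of \<open>V\<^sub>i\<close> is a linear polynomial \<open>a\<^sub>i + z b\<^sub>i\<close> (\<open>X_E\<close>), and comparison of
  coefficients in \<open>V\<^sub>i V\<^sub>i' = V\<^sub>i' V\<^sub>i = V\<close> (\<open>relations\<close>) shows that it has the Berger-Coburn-Lebow form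
  \<open>(P\<^sub>i\<^sup>\<bottom> + z P\<^sub>i) U\<^sub>i\<^sup>*\<close> with a projection \<open>P\<^sub>i\<close> and a unitary \<open>U\<^sub>i\<close>.  All required conditions are again comparisons of
  coefficients: in \<open>V\<^sub>i V\<^sub>j = V\<^sub>j V\<^sub>i\<close> for the commutation relations, in the action of \<open>V\<^sub>i\<close> on \<open>J \<H>\<close> for the relations with the
  defect operators (\<open>defect_intertwine\<close>, \<open>defect_factor\<close>), and in \<open>V\<^sub>1 \<cdots> V\<^sub>n = V\<close> for the last one (\<open>exists_data\<close>).

  Conversely, \<open>P\<^sub>i\<close> and \<open>U\<^sub>i\<close> prescribe \<open>V\<^sub>i J h = J T\<^sub>i h + E P\<^sub>i U\<^sub>i\<^sup>* D\<^sub>T h\<close>, and \<open>V\<^sub>i V\<^sup>m J h = V\<^sup>m V\<^sub>i J h\<close> on the total set of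
  all \<open>V\<^sup>m J h\<close>.  The relations with the defect operators say that inner products are preserved (\<open>inner_Vpow_X\<close>), so that
  \<open>V\<^sub>i\<close> exists as an isometry; the commutation relations give \<open>V\<^sub>i V\<^sub>j = V\<^sub>j V\<^sub>i\<close> (\<open>W_commute\<close>).  The last condition says that the
  rotated projections \<open>Q\<^sub>k = U\<^sub>1\<^sup>* \<cdots> U\<^sub>k\<^sub>-\<^sub>1\<^sup>* P\<^sub>k U\<^sub>k\<^sub>-\<^sub>1 \<cdots> U\<^sub>1\<close> sum to \<open>I\<close>, hence are orthogonal, and the product of the symbols
  collapses to \<open>z\<close> (\<open>prod_W\<close>).

  Uniqueness does not go through symbols.  The inner products of \<open>V\<^sub>i V\<^sup>m J h\<close> and \<open>V\<^sup>l J g\<close> can be expressed by the \<open>T\<^sub>i\<close>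
  (\<open>inner_factor_power\<close>), so the product \<open>V\<close> determines its factors.  This yields the unitary equivalence of two dilations, and
  also the uniqueness of \<open>P\<^sub>i\<close> and \<open>U\<^sub>i\<close>, since these can be read off from the \<open>V\<^sub>i\<close> they produce (\<open>data_determined\<close>).

  The operator theory underneath is built first: Riesz representation on closed subspaces, which gives adjoints; positive
  square roots by a fixed-point iteration; and the extension of isometries from spanning sets.
\<close>

section \<open>Complex Hilbert spaces as real inner product spaces\<close>

text \<open>
  The imaginary part of \<open>cinner\<close> is again a value of \<open>inner\<close>.  Orthogonality and adjoint relations of
  complex-linear operators can therefore be tested with the real inner product, which is symmetric and
  bilinear; all later computations use it.
\<close>

lemma cinner_via_inner: "cinner x y = Complex (inner x y) (inner x (\<i> *\<^sub>C y))"
proof -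
  have "cinner x (\<i> *\<^sub>C y) = cnj (\<i> * cinner y x)"
    by (metis cinner_commute cinner_scaleC_left)
  also have "\<dots> = - \<i> * cinner x y"
    by (subst cinner_commute[of x y]) simp
  finally have "inner x (\<i> *\<^sub>C y) = Im (cinner x y)"
    by (simp flip: Re_cinner)
  then show ?thesis
    by (simp add: complex_eq_iff Re_cinner)
qed

lemma inner_scaleC_left: "inner (c *\<^sub>C x) y = inner x (cnj c *\<^sub>C y)"
proof -
  have "cinner x (cnj c *\<^sub>C y) = cnj (cnj c * cinner y x)"
    by (metis cinner_commute cinner_scaleC_left)
  also have "\<dots> = cinner (c *\<^sub>C x) y"
    by (subst cinner_commute[of y x]) (simp add: cinner_scaleC_left)
  finally show ?thesis
    by (simp flip: Re_cinner)
qed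

lemma scaleC_zero_right: "c *\<^sub>C 0 = (0::'a::complex_hilbert)"
  by (rule complex_vector.scale_zero_right)

lemma scaleC_diff_right: "c *\<^sub>C (x - y) = c *\<^sub>C x - c *\<^sub>C (y::'a::complex_hilbert)"
  by (rule complex_vector.scale_right_diff_distrib)

lemma scaleC_scaleR_commute: "c *\<^sub>C (r *\<^sub>R x) = r *\<^sub>R (c *\<^sub>C x)"
  by (simp flip: scaleC_of_real add: scaleC_scaleC mult.commute)

lemma norm_scaleC: "norm (c *\<^sub>C x) = cmod c * norm x"
proof -
  have "inner (c *\<^sub>C x) (c *\<^sub>C x) = inner x (complex_of_real ((cmod c)\<^sup>2) *\<^sub>C x)"
    by (metis inner_scaleC_left scaleC_scaleC complex_norm_square mult.commute)
  also have "\<dots> = (cmod c * norm x)\<^sup>2"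
    by (simp only: scaleC_of_real) (simp add: power_mult_distrib power2_norm_eq_inner)
  finally have "(norm (c *\<^sub>C x))\<^sup>2 = (cmod c * norm x)\<^sup>2"
    by (simp add: power2_norm_eq_inner)
  then show ?thesis
    by (simp add: power2_eq_iff_nonneg)
qed

lemma bounded_linear_scaleC: "bounded_linear (\<lambda>x. c *\<^sub>C x)"
  by (rule bounded_linear_intro[of _ "cmod c"])
     (auto simp: scaleC_add_right scaleC_scaleR_commute norm_scaleC mult.commute)

lemma csubspace_imp_subspace: "complex_vector.subspace S \<Longrightarrow> subspace S"
  by (simp add: complex_vector.subspace_def subspace_def flip: scaleC_of_real)

lemma subspace_closure:
  fixes S :: "'a::real_normed_vector set"
  assumes "subspace S" shows "subspace (closure S)"
  unfolding subspace_def
proof (intro conjI ballI allI)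
  show "0 \<in> closure S"
    using assms closure_subset subspace_0 by blast
next
  fix x y assume "x \<in> closure S" "y \<in> closure S"
  then obtain f g where "\<forall>n. f n \<in> S" "f \<longlonglongrightarrow> x" "\<forall>n. g n \<in> S" "g \<longlonglongrightarrow> y"
    by (auto simp: closure_sequential)
  then show "x + y \<in> closure S"
    using assms unfolding closure_sequential
    by (intro exI[of _ "\<lambda>n. f n + g n"]) (auto intro: subspace_add tendsto_add)
next
  fix c x assume "x \<in> closure S"
  then obtain f where "\<forall>n. f n \<in> S" "f \<longlonglongrightarrow> x"
    by (auto simp: closure_sequential)
  then show "c *\<^sub>R x \<in> closure S"
    using assms unfolding closure_sequential
    by (intro exI[of _ "\<lambda>n. c *\<^sub>R f n"]) (auto intro: subspace_scale tendsto_scaleR)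
qed

lemma csubspace_closure:
  assumes "complex_vector.subspace S" shows "complex_vector.subspace (closure S)"
proof -
  have "subspace (closure S)"
    by (intro subspace_closure csubspace_imp_subspace assms)
  moreover have "c *\<^sub>C x \<in> closure S" if x: "x \<in> closure S" for c x
  proof -
    obtain f where "\<forall>n. f n \<in> S" "f \<longlonglongrightarrow> x"
      using x by (auto simp: closure_sequential)
    then show ?thesis
      using assms unfolding closure_sequential
      by (intro exI[of _ "\<lambda>n. c *\<^sub>C f n"])
         (auto intro: complex_vector.subspace_scale bounded_linear.tendsto[OF bounded_linear_scaleC])
  qed
  ultimately show ?thesis
    by (simp add: complex_vector.subspace_def subspace_def)
qed

section \<open>Riesz representation on closed subspaces\<close>

text \<open>
  First variation: a quadratic polynomial in \<open>t\<close> that vanishes at \<open>0\<close> and is nowhere negative has slope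
  \<open>0\<close> there.
\<close>

lemma quadratic_nonneg_imp_zero:
  fixes a w :: real
  assumes "\<And>t. 0 \<le> t\<^sup>2 * w - 2 * t * a" and "0 \<le> w"
  shows "a = 0"
proof -
  \<comment> \<open>At this \<open>t\<close> the polynomial takes the value \<open>- t\<^sup>2 (w + 2)\<close>.\<close>
  define t where "t = a / (w + 1)"
  have a: "a = t * (w + 1)" using \<open>0 \<le> w\<close> by (simp add: t_def)
  have "0 \<le> - (t\<^sup>2 * (w + 2))"
    using assms(1)[of t] by (simp add: a power2_eq_square algebra_simps)
  moreover have "0 \<le> t\<^sup>2 * (w + 2)" using \<open>0 \<le> w\<close> by simp
  ultimately have "t\<^sup>2 * (w + 2) = 0" by linarith
  then show ?thesis using \<open>0 \<le> w\<close> by (auto simp: a)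
qed

text \<open>
  The quadratic functional \<open>q x = \<parallel>x\<parallel>\<^sup>2 - 2 \<phi> x\<close> is bounded below on \<open>S\<close>, and by the parallelogram
  identity its minimising sequences are Cauchy.  The first variation of \<open>q\<close> at the minimiser \<open>z\<close> says that
  \<open>z\<close> represents \<open>\<phi>\<close>.  Linearity is asked of \<open>\<phi>\<close> on \<open>S\<close> only, because an operator on a closed subspace
  has arbitrary values elsewhere.
\<close>

lemma riesz_closed_subspace:
  fixes S :: "'a::{real_inner,banach} set" and \<phi> :: "'a \<Rightarrow> real"
  assumes "closed S" "subspace S"
    and add: "\<And>x y. x \<in> S \<Longrightarrow> y \<in> S \<Longrightarrow> \<phi> (x + y) = \<phi> x + \<phi> y"
    and scale: "\<And>r x. x \<in> S \<Longrightarrow> \<phi> (r *\<^sub>R x) = r * \<phi> x"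
    and bound: "\<And>x. x \<in> S \<Longrightarrow> \<bar>\<phi> x\<bar> \<le> C * norm x"
  shows "\<exists>z\<in>S. \<forall>x\<in>S. \<phi> x = inner x z"
proof -
  define q where "q x = inner x x - 2 * \<phi> x" for x
  define m where "m = Inf (q ` S)"
  have S0: "0 \<in> S" using assms by (simp add: subspace_0)
  have low: "- C\<^sup>2 \<le> q x" if "x \<in> S" for x
  proof -
    have "0 \<le> (norm x - C)\<^sup>2" by simp
    then have "- C\<^sup>2 \<le> (norm x)\<^sup>2 - 2 * (C * norm x)"
      by (simp add: power2_eq_square algebra_simps)
    then show ?thesis using bound[OF that] by (simp add: q_def power2_norm_eq_inner)
  qed
  have bdd: "bdd_below (q ` S)" using low by (auto intro!: bdd_belowI)
  have m_le: "m \<le> q x" if "x \<in> S" for x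
    unfolding m_def using that bdd by (intro cINF_lower) auto
  have "\<exists>x\<in>S. q x < m + 1 / real (Suc n)" for n
    using cINF_less_iff[OF _ bdd, of "m + 1 / real (Suc n)"] S0 by (auto simp: m_def)
  then obtain f where f: "\<And>n. f n \<in> S" "\<And>n. q (f n) < m + 1 / real (Suc n)"
    by metis
  have par: "(norm (x - y))\<^sup>2 \<le> 2 * (q x - m) + 2 * (q y - m)" if "x \<in> S" "y \<in> S" for x y
  proof -
    have xy: "(1/2) *\<^sub>R (x + y) \<in> S"
      using that assms(2) by (simp add: subspace_add subspace_scale)
    have "\<phi> ((1/2) *\<^sub>R (x + y)) = (\<phi> x + \<phi> y) / 2"
      using that assms(2) by (simp add: add scale subspace_add del: scaleR_add_right)
    then have "q ((1/2) *\<^sub>R (x + y)) = inner (x + y) (x + y) / 4 - (\<phi> x + \<phi> y)"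
      unfolding q_def by simp
    moreover have "(norm (x - y))\<^sup>2 = 2 * inner x x + 2 * inner y y - inner (x + y) (x + y)"
      by (simp add: power2_norm_eq_inner inner_simps inner_commute)
    ultimately have "(norm (x - y))\<^sup>2 = 2 * q x + 2 * q y - 4 * q ((1/2) *\<^sub>R (x + y))"
      by (simp only: q_def) argo
    then show ?thesis using m_le[OF xy] by simp
  qed
  have "Cauchy f"
  proof (rule metric_CauchyI)
    fix e :: real assume "0 < e"
    then obtain N where N: "4 / real (Suc N) < e\<^sup>2"
      using reals_Archimedean[of "e\<^sup>2/4"] by (auto simp: field_simps)
    have "dist (f j) (f k) < e" if "j \<ge> N" "k \<ge> N" for j k
    proof -
      have *: "q (f l) - m \<le> 1 / real (Suc N)" if "l \<ge> N" for l
      proof -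
        have "1 / real (Suc l) \<le> 1 / real (Suc N)" using that by (simp add: frac_le)
        then show ?thesis using f(2)[of l] by simp
      qed
      have "(norm (f j - f k))\<^sup>2 < e\<^sup>2"
        using par[of "f j" "f k"] f(1) *[OF that(1)] *[OF that(2)] N by simp
      then show ?thesis
        using \<open>0 < e\<close> by (simp add: dist_norm power2_less_imp_less)
    qed
    then show "\<exists>M. \<forall>j\<ge>M. \<forall>k\<ge>M. dist (f j) (f k) < e" by blast
  qed
  then obtain z where z: "f \<longlonglongrightarrow> z" by (auto simp: Cauchy_convergent_iff convergent_def)
  have zS: "z \<in> S" using assms(1) f(1) z by (auto intro: closed_sequentially)
  have "(\<lambda>n. \<phi> (f n)) \<longlonglongrightarrow> \<phi> z"
  proof (rule Lim_null_comparison[THEN LIM_zero_cancel])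
    show "\<forall>\<^sub>F n in sequentially. norm (\<phi> (f n) - \<phi> z) \<le> C * norm (f n - z)"
    proof (intro always_eventually allI)
      fix n
      have "f n - z \<in> S" using f(1) zS assms(2) by (simp add: subspace_diff)
      moreover have "\<phi> (f n - z) = \<phi> (f n) - \<phi> z"
        using add[of "f n - z" z] calculation zS by simp
      ultimately show "norm (\<phi> (f n) - \<phi> z) \<le> C * norm (f n - z)"
        using bound[of "f n - z"] by simp
    qed
    have "(\<lambda>n. norm (f n - z)) \<longlonglongrightarrow> 0" using z by (simp add: LIM_zero tendsto_norm_zero)
    then show "(\<lambda>n. C * norm (f n - z)) \<longlonglongrightarrow> 0" by (rule tendsto_mult_right_zero)
  qed
  then have "(\<lambda>n. q (f n)) \<longlonglongrightarrow> q z"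
    unfolding q_def by (intro tendsto_intros z)
  moreover have "(\<lambda>n. m + 1 / real (Suc n)) \<longlonglongrightarrow> m + 0"
    by (intro tendsto_intros LIMSEQ_Suc[OF lim_1_over_n])
  ultimately have "q z \<le> m + 0"
    by (rule LIMSEQ_le) (use f(2) less_imp_le in blast)
  then have "q z \<le> m" by simp
  have "\<phi> x = inner x z" if x: "x \<in> S" for x
  proof -
    let ?a = "\<phi> x - inner x z"
    have "0 \<le> t\<^sup>2 * inner x x - 2 * t * ?a" for t
    proof -
      have "z + t *\<^sub>R x \<in> S" using zS x assms(2) by (simp add: subspace_add subspace_scale)
      then have "q z \<le> q (z + t *\<^sub>R x)" using m_le \<open>q z \<le> m\<close> order_trans by blast
      moreover have "q (z + t *\<^sub>R x) = q z + t\<^sup>2 * inner x x - 2 * t * ?a"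
        unfolding q_def using zS x assms(2)
        by (simp add: add scale subspace_scale inner_simps inner_commute power2_eq_square algebra_simps)
      ultimately show ?thesis by simp
    qed
    then have "?a = 0" by (rule quadratic_nonneg_imp_zero) simp
    then show ?thesis by simp
  qed
  then show ?thesis using zS by blast
qed

section \<open>Existence of adjoints\<close>

lemma bounded_op_UNIV_iff:
  "bounded_op UNIV UNIV f \<longleftrightarrow> bounded_linear f \<and> (\<forall>c x. f (c *\<^sub>C x) = c *\<^sub>C f x)"
proof
  assume f: "bounded_op UNIV UNIV f"
  then obtain C where "\<forall>x. norm (f x) \<le> C * norm x"
    by (auto simp: bounded_op_def)
  then have "bounded_linear f"
    using f by (intro bounded_linear_intro[of f C])
       (auto simp: bounded_op_def mult.commute simp flip: scaleC_of_real)
  then show "bounded_linear f \<and> (\<forall>c x. f (c *\<^sub>C x) = c *\<^sub>C f x)"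
    using f by (auto simp: bounded_op_def)
next
  assume f: "bounded_linear f \<and> (\<forall>c x. f (c *\<^sub>C x) = c *\<^sub>C f x)"
  then obtain C where "\<forall>x. norm (f x) \<le> C * norm x"
    using bounded_linear.bounded by (metis mult.commute)
  then show "bounded_op UNIV UNIV f"
    using f by (auto simp: bounded_op_def linear_simps bounded_linear.linear)
qed

text \<open>
  Replacing \<open>x\<close> by \<open>- \<i> x\<close> in the real adjoint relation gives its imaginary part, so the real relation
  already determines the complex adjoint.
\<close>

lemma adj_on_eqI:
  assumes S: "complex_vector.subspace S"
    and hom: "\<And>c x. x \<in> S \<Longrightarrow> f (c *\<^sub>C x) = c *\<^sub>C f x"
    and z: "z \<in> S" "\<And>x. x \<in> S \<Longrightarrow> inner (f x) y = inner x z"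
  shows "adj_on S f y = z"
  unfolding adj_on_def
proof (rule the_equality)
  have "cinner (f x) y = cinner x z" if x: "x \<in> S" for x
  proof -
    have "inner (f x) (\<i> *\<^sub>C y) = inner (f (cnj \<i> *\<^sub>C x)) y"
      by (simp only: hom[OF x] inner_scaleC_left complex_cnj_cnj)
    also have "\<dots> = inner (cnj \<i> *\<^sub>C x) z"
      using S x by (intro z) (rule complex_vector.subspace_scale)
    also have "\<dots> = inner x (\<i> *\<^sub>C z)"
      by (simp add: inner_scaleC_left)
    finally show ?thesis
      using z(2)[OF x] by (simp add: cinner_via_inner)
  qed
  then show "z \<in> S \<and> (\<forall>x\<in>S. cinner (f x) y = cinner x z)"
    using z(1) by blast
next
  fix w assume w: "w \<in> S \<and> (\<forall>x\<in>S. cinner (f x) y = cinner x w)"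
  have "inner x (w - z) = 0" if "x \<in> S" for x
    using w z(2)[OF that] that by (metis Re_cinner inner_diff_right diff_self)
  moreover have "w - z \<in> S"
    using w z(1) S by (simp add: complex_vector.subspace_diff)
  ultimately show "w = z"
    by fastforce
qed

lemma adj_on:
  assumes "closed S" and S: "complex_vector.subspace S" and f: "bounded_op S R f"
  shows adj_on_in: "adj_on S f y \<in> S"
    and inner_adj_on: "x \<in> S \<Longrightarrow> inner (f x) y = inner x (adj_on S f y)"
proof -
  obtain C where C: "\<forall>x\<in>S. norm (f x) \<le> C * norm x"
    using f by (auto simp: bounded_op_def)
  have "\<exists>z\<in>S. \<forall>x\<in>S. inner (f x) y = inner x z"
  proof (rule riesz_closed_subspace[OF \<open>closed S\<close> csubspace_imp_subspace[OF S]])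
    fix x z r assume *: "x \<in> S"
    show "inner (f (r *\<^sub>R x)) y = r * inner (f x) y"
      using f * by (simp add: bounded_op_def flip: scaleC_of_real) (simp add: scaleC_of_real)
    have "\<bar>inner (f x) y\<bar> \<le> norm (f x) * norm y"
      by (rule Cauchy_Schwarz_ineq2)
    also have "\<dots> \<le> (C * norm x) * norm y"
      using C * by (intro mult_right_mono) auto
    finally show "\<bar>inner (f x) y\<bar> \<le> (C * norm y) * norm x"
      by (simp add: mult_ac)
    assume "z \<in> S"
    then show "inner (f (x + z)) y = inner (f x) y + inner (f z) y"
      using f * by (simp add: bounded_op_def inner_add_left)
  qed
  then obtain z where z: "z \<in> S" "\<forall>x\<in>S. inner (f x) y = inner x z"
    by blast
  then have "adj_on S f y = z"
    using f by (intro adj_on_eqI[OF S]) (auto simp: bounded_op_def)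
  then show "adj_on S f y \<in> S" "x \<in> S \<Longrightarrow> inner (f x) y = inner x (adj_on S f y)"
    using z by auto
qed

section \<open>Positive square roots\<close>

text \<open>
  With \<open>\<parallel>X\<parallel> \<le> 1\<close>, the equation \<open>(I - Y)\<^sup>2 = I - X\<close> reads \<open>Y = (X + Y\<^sup>2) / 2\<close>.  This fixed-point equation is
  solved by iteration from \<open>0\<close>; the scalar iteration for \<open>X = 1\<close> dominates the operator iteration in
  norm, so that monotone convergence of real numbers replaces spectral theory.
\<close>

primrec scalar_iter :: "nat \<Rightarrow> real" where
  "scalar_iter 0 = 0"
| "scalar_iter (Suc k) = (1 + (scalar_iter k)\<^sup>2) / 2"

primrec op_iter :: "('a::real_vector \<Rightarrow> 'a) \<Rightarrow> nat \<Rightarrow> 'a \<Rightarrow> 'a" where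
  "op_iter X 0 = (\<lambda>x. 0)"
| "op_iter X (Suc k) = (\<lambda>x. (1/2) *\<^sub>R (X x + op_iter X k (op_iter X k x)))"

lemma scalar_iter_bounds: "0 \<le> scalar_iter k \<and> scalar_iter k \<le> 1"
proof (induction k)
  case (Suc k)
  then have "(scalar_iter k)\<^sup>2 \<le> 1" by (simp add: power_le_one)
  then show ?case by simp
qed simp

lemma scalar_iter_mono: "scalar_iter k \<le> scalar_iter (Suc k)"
proof -
  have "0 \<le> (scalar_iter k - 1)\<^sup>2" by simp
  then show ?thesis by (simp add: power2_diff)
qed

lemma scalar_iter_Cauchy: "Cauchy scalar_iter"
proof -
  have "incseq scalar_iter"
    by (intro incseq_SucI scalar_iter_mono)
  then have "convergent scalar_iter"
    using incseq_convergent[of scalar_iter 1] scalar_iter_bounds unfolding convergent_def by metis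
  then show ?thesis by (simp add: Cauchy_convergent_iff)
qed

locale symmetric_contraction =
  fixes X :: "'a::complex_hilbert \<Rightarrow> 'a"
  assumes X: "bounded_op UNIV UNIV X"
    and sym: "inner (X x) y = inner x (X y)"
    and contr: "norm (X x) \<le> norm x"
begin

lemma op_iter_Suc: "op_iter X (Suc k) x = (1/2) *\<^sub>R (X x + op_iter X k (op_iter X k x))"
  by simp

lemma op_iter_hom: "op_iter X k (c *\<^sub>C x) = c *\<^sub>C op_iter X k x"
proof (induction k arbitrary: x)
  case (Suc k)
  then show ?case
    using X by (simp add: bounded_op_UNIV_iff scaleC_add_right scaleC_scaleR_commute)
qed (simp add: scaleC_zero_right)

lemma op_iter_add: "op_iter X k (x + y) = op_iter X k x + op_iter X k y"
proof (induction k arbitrary: x y)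
  case (Suc k)
  then show ?case
    using X by (simp add: bounded_op_UNIV_iff linear_simps algebra_simps)
qed simp

lemma op_iter_diff: "op_iter X k (x - y) = op_iter X k x - op_iter X k y"
  by (metis op_iter_add diff_add_cancel add_diff_cancel_right')

lemma op_iter_sym: "inner (op_iter X k x) y = inner x (op_iter X k y)"
  by (induction k arbitrary: x y) (simp_all add: inner_add_left inner_add_right sym)

lemma op_iter_bound: "norm (op_iter X k x) \<le> scalar_iter k * norm x"
proof (induction k arbitrary: x)
  case (Suc k)
  have "norm (op_iter X k (op_iter X k x)) \<le> scalar_iter k * (scalar_iter k * norm x)"
    using scalar_iter_bounds[of k] by (intro order_trans[OF Suc] mult_left_mono Suc) auto
  then have "norm (X x + op_iter X k (op_iter X k x)) \<le> norm x + scalar_iter k * (scalar_iter k * norm x)"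
    by (intro norm_triangle_le add_mono contr)
  moreover have "norm (op_iter X (Suc k) x) = norm (X x + op_iter X k (op_iter X k x)) / 2"
    by (simp only: op_iter_Suc norm_scaleR)
  ultimately show ?case
    by (simp add: power2_eq_square field_simps del: op_iter.simps)
qed simp

text \<open>
  With consecutive iterates \<open>Y\<close> and \<open>Z\<close>, write \<open>Z\<^sup>2 x - Y\<^sup>2 x = Z (Z x - Y x) + (Z - Y) (Y x)\<close>.  The same
  splitting of \<open>z\<^sup>2 - y\<^sup>2\<close> in the scalar recursion turns the bounds on the two summands into exactly the
  claimed bound.
\<close>

lemma op_iter_step:
  "norm (op_iter X (Suc k) x - op_iter X k x) \<le> (scalar_iter (Suc k) - scalar_iter k) * norm x"
proof (induction k arbitrary: x)
  case 0
  then show ?case using contr[of x] by simp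
next
  case (Suc k)
  let ?Y = "op_iter X k" and ?Z = "op_iter X (Suc k)"
  let ?y = "scalar_iter k" and ?z = "scalar_iter (Suc k)"
  have "?Z (?Z x - ?Y x) + (?Z (?Y x) - ?Y (?Y x)) = ?Z (?Z x) - ?Y (?Y x)"
    by (simp only: op_iter_diff) simp
  moreover have "norm (?Z (?Z x - ?Y x)) \<le> ?z * ((?z - ?y) * norm x)"
    using scalar_iter_bounds[of "Suc k"]
    by (intro order_trans[OF op_iter_bound] mult_left_mono Suc) auto
  moreover have "norm (?Z (?Y x) - ?Y (?Y x)) \<le> (?z - ?y) * (?y * norm x)"
    using scalar_iter_mono[of k]
    by (intro order_trans[OF Suc] mult_left_mono op_iter_bound) auto
  ultimately have "norm (?Z (?Z x) - ?Y (?Y x)) \<le> ?z * ((?z - ?y) * norm x) + (?z - ?y) * (?y * norm x)"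
    by (metis norm_triangle_le add_mono)
  also have "\<dots> = (?z\<^sup>2 - ?y\<^sup>2) * norm x"
    by (simp only: power2_eq_square) (simp only: algebra_simps)
  finally have *: "norm (?Z (?Z x) - ?Y (?Y x)) \<le> (?z\<^sup>2 - ?y\<^sup>2) * norm x" .
  have "op_iter X (Suc (Suc k)) x = (1/2) *\<^sub>R (X x + ?Z (?Z x))"
    by (rule op_iter_Suc)
  moreover have "?Z x = (1/2) *\<^sub>R (X x + ?Y (?Y x))"
    by (rule op_iter_Suc)
  ultimately have e1: "op_iter X (Suc (Suc k)) x - ?Z x = (1/2) *\<^sub>R (?Z (?Z x) - ?Y (?Y x))"
    by (simp only: scaleR_add_right scaleR_right_diff_distrib) (simp only: algebra_simps)
  have e2: "scalar_iter (Suc (Suc k)) - ?z = (?z\<^sup>2 - ?y\<^sup>2) / 2"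
    by (simp only: scalar_iter.simps(2)[of "Suc k"] scalar_iter.simps(2)[of k]) argo
  have "norm ((1/2) *\<^sub>R w) \<le> (r / 2) * norm x" if "norm w \<le> r * norm x" for w :: 'a and r
    using that by simp
  then show ?case
    unfolding e1 e2 using * by blast
qed

lemma op_iter_diff_bound:
  assumes "k \<le> m"
  shows "norm (op_iter X m x - op_iter X k x) \<le> (scalar_iter m - scalar_iter k) * norm x"
  using assms
proof (induction m rule: dec_induct)
  case (step m)
  have "norm ((op_iter X (Suc m) x - op_iter X m x) + (op_iter X m x - op_iter X k x))
     \<le> (scalar_iter (Suc m) - scalar_iter m) * norm x + (scalar_iter m - scalar_iter k) * norm x"
    by (intro norm_triangle_le add_mono op_iter_step step.IH)
  then show ?case
    by (simp only: algebra_simps) simp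
qed simp

lemma op_iter_Cauchy: "Cauchy (\<lambda>k. op_iter X k x)"
proof (rule metric_CauchyI)
  fix e :: real assume "0 < e"
  then have "0 < e / (norm x + 1)" by (simp add: add_nonneg_pos)
  then obtain N where N: "\<And>m k. m \<ge> N \<Longrightarrow> k \<ge> N \<Longrightarrow> dist (scalar_iter m) (scalar_iter k) < e / (norm x + 1)"
    using scalar_iter_Cauchy by (metis metric_CauchyD)
  have main: "dist (op_iter X m x) (op_iter X k x) < e" if "N \<le> k" "k \<le> m" for k m
  proof -
    have "dist (op_iter X m x) (op_iter X k x) \<le> (scalar_iter m - scalar_iter k) * norm x"
      using op_iter_diff_bound[OF that(2)] by (simp add: dist_norm)
    also have "\<dots> \<le> e / (norm x + 1) * norm x"
      using N[of m k] that by (intro mult_right_mono) (auto simp: dist_real_def)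
    also have "\<dots> < e / (norm x + 1) * (norm x + 1)"
      using \<open>0 < e / (norm x + 1)\<close> by (intro mult_strict_left_mono) auto
    also have "\<dots> = e"
      using norm_ge_zero[of x] by (simp add: add_nonneg_eq_0_iff)
    finally show ?thesis .
  qed
  then have "dist (op_iter X m x) (op_iter X k x) < e" if "N \<le> k" "N \<le> m" for k m
    using that by (metis dist_commute nle_le)
  then show "\<exists>M. \<forall>m\<ge>M. \<forall>n\<ge>M. dist (op_iter X m x) (op_iter X n x) < e"
    by blast
qed

text \<open>
  The operator \<open>Y\<close> with \<open>(I - Y)\<^sup>2 = I - X\<close>.
\<close>

definition root_compl :: "'a \<Rightarrow> 'a" where
  "root_compl x = lim (\<lambda>k. op_iter X k x)"

lemma op_iter_tendsto: "(\<lambda>k. op_iter X k x) \<longlonglongrightarrow> root_compl x"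
  using op_iter_Cauchy[of x] unfolding root_compl_def
  by (simp add: Cauchy_convergent_iff convergent_LIMSEQ_iff)

lemma root_compl_bound: "norm (root_compl x) \<le> norm x"
proof (rule LIMSEQ_le_const2[OF tendsto_norm[OF op_iter_tendsto]])
  have "norm (op_iter X k x) \<le> norm x" for k
    using scalar_iter_bounds[of k] mult_right_mono[of "scalar_iter k" 1 "norm x"] op_iter_bound[of k x]
    by simp
  then show "\<exists>N. \<forall>n\<ge>N. norm (op_iter X n x) \<le> norm x" by blast
qed

lemma root_compl_hom: "root_compl (c *\<^sub>C x) = c *\<^sub>C root_compl x"
  using bounded_linear.tendsto[OF bounded_linear_scaleC op_iter_tendsto, of c x]
    op_iter_tendsto[of "c *\<^sub>C x"] by (auto simp: op_iter_hom intro: LIMSEQ_unique)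

lemma root_compl_add: "root_compl (x + y) = root_compl x + root_compl y"
  using tendsto_add[OF op_iter_tendsto[of x] op_iter_tendsto[of y]] op_iter_tendsto[of "x + y"]
  by (auto simp: op_iter_add intro: LIMSEQ_unique)

lemma root_compl_bounded_op: "bounded_op UNIV UNIV root_compl"
  unfolding bounded_op_def using root_compl_bound
  by (auto simp: root_compl_hom root_compl_add intro!: exI[of _ 1])

lemma root_compl_sym: "inner (root_compl x) y = inner x (root_compl y)"
  using tendsto_inner[OF op_iter_tendsto[of x] tendsto_const[of y]]
    tendsto_inner[OF tendsto_const[of x] op_iter_tendsto[of y]]
  by (auto simp: op_iter_sym intro: LIMSEQ_unique)

text \<open>
  The iterates are uniformly bounded by \<open>1\<close>, hence \<open>op_iter X k (op_iter X k x)\<close> and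
  \<open>op_iter X k (root_compl x)\<close> have the same limit.
\<close>

lemma root_compl_fixpoint: "2 *\<^sub>R root_compl x = X x + root_compl (root_compl x)"
proof -
  have "(\<lambda>k. op_iter X k (op_iter X k x - root_compl x)) \<longlonglongrightarrow> 0"
  proof (rule Lim_null_comparison)
    show "\<forall>\<^sub>F k in sequentially. norm (op_iter X k (op_iter X k x - root_compl x))
        \<le> norm (op_iter X k x - root_compl x)"
      using order_trans[OF op_iter_bound mult_right_mono[of _ 1]] scalar_iter_bounds
      by (intro always_eventually) auto
    show "(\<lambda>k. norm (op_iter X k x - root_compl x)) \<longlonglongrightarrow> 0"
      using op_iter_tendsto[of x] by (simp add: LIM_zero tendsto_norm_zero)
  qed
  from tendsto_add[OF this op_iter_tendsto[of "root_compl x"]]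
  have "(\<lambda>k. op_iter X k (op_iter X k x)) \<longlonglongrightarrow> root_compl (root_compl x)"
    by (simp add: op_iter_diff)
  then have "(\<lambda>k. (1/2) *\<^sub>R (X x + op_iter X k (op_iter X k x)))
      \<longlonglongrightarrow> (1/2) *\<^sub>R (X x + root_compl (root_compl x))"
    by (intro tendsto_intros)
  moreover have "(\<lambda>k. (1/2) *\<^sub>R (X x + op_iter X k (op_iter X k x))) \<longlonglongrightarrow> root_compl x"
    using LIMSEQ_Suc[OF op_iter_tendsto[of x]] by simp
  ultimately have "root_compl x = (1/2) *\<^sub>R (X x + root_compl (root_compl x))"
    by (rule LIMSEQ_unique[rotated])
  then have "2 *\<^sub>R root_compl x = 2 *\<^sub>R ((1/2) *\<^sub>R (X x + root_compl (root_compl x)))"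
    by simp
  then show ?thesis by (simp del: scaleR_add_right)
qed

text \<open>
  The limit commutes with whatever commutes with \<open>X\<close>, as the iterates are polynomials in \<open>X\<close>.  Uniqueness
  of the square root rests on this.
\<close>

lemma root_compl_commute:
  assumes C: "bounded_linear C" and "\<And>x. C (X x) = X (C x)"
  shows "C (root_compl x) = root_compl (C x)"
proof -
  have "C (op_iter X k x) = op_iter X k (C x)" for k x
    using assms by (induction k arbitrary: x) (simp_all add: linear_simps)
  then show ?thesis
    using bounded_linear.tendsto[OF C op_iter_tendsto[of x]] op_iter_tendsto[of "C x"]
    by (auto intro: LIMSEQ_unique)
qed

end

text \<open>
  Positivity entails symmetry because the scalars are complex: \<open>cinner (A x) x\<close> being real for all \<open>x\<close>,
  polarisation with \<open>x\<close> and \<open>\<i> y\<close> makes \<open>A\<close> symmetric.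
\<close>

lemma positive_op_iff:
  "positive_op A \<longleftrightarrow> bounded_op UNIV UNIV A \<and> (\<forall>x y. inner (A x) y = inner x (A y)) \<and> (\<forall>x. 0 \<le> inner (A x) x)"
proof
  assume A: "positive_op A"
  then have hom: "\<And>c x. A (c *\<^sub>C x) = c *\<^sub>C A x" and lin: "bounded_linear A"
    by (auto simp: positive_op_def bounded_op_UNIV_iff)
  have *: "inner (A x) (\<i> *\<^sub>C x) = 0" "0 \<le> inner (A x) x" for x
    using A by (auto simp: positive_op_def cinner_via_inner complex_nonneg_Reals_iff)
  have "inner (A x) (\<i> *\<^sub>C y) = - inner (A y) (\<i> *\<^sub>C x)" for x y
    using *(1)[of "x + y"] by (simp add: linear_simps[OF lin] scaleC_add_right inner_simps *)
  from this[of _ "- \<i> *\<^sub>C _"]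
  have "inner (A x) (\<i> *\<^sub>C ((- \<i>) *\<^sub>C y)) = - inner (A ((- \<i>) *\<^sub>C y)) (\<i> *\<^sub>C x)" for x y
    by blast
  also have "- inner (A ((- \<i>) *\<^sub>C y)) (\<i> *\<^sub>C x) = inner (A y) x" for x y
    by (simp only: hom inner_scaleC_left) (simp add: scaleC_scaleC)
  finally have "inner (A x) y = inner x (A y)" for x y
    by (simp add: scaleC_scaleC inner_commute)
  then show "bounded_op UNIV UNIV A \<and> (\<forall>x y. inner (A x) y = inner x (A y)) \<and> (\<forall>x. 0 \<le> inner (A x) x)"
    using * A by (auto simp: positive_op_def)
next
  assume A: "bounded_op UNIV UNIV A \<and> (\<forall>x y. inner (A x) y = inner x (A y)) \<and> (\<forall>x. 0 \<le> inner (A x) x)"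
  have "inner (A x) (\<i> *\<^sub>C x) = 0" for x
  proof -
    have "inner (A x) (\<i> *\<^sub>C x) = inner x (\<i> *\<^sub>C A x)"
      using A by (simp add: bounded_op_UNIV_iff)
    also have "\<dots> = inner ((- \<i>) *\<^sub>C x) (A x)"
      by (simp add: inner_scaleC_left)
    also have "\<dots> = - inner (A x) (\<i> *\<^sub>C x)"
      by (simp add: inner_commute)
    finally show ?thesis by simp
  qed
  then show "positive_op A"
    using A by (auto simp: positive_op_def cinner_via_inner complex_nonneg_Reals_iff)
qed

text \<open>
  The Cauchy-Schwarz inequality of the form \<open>inner (B x) y\<close>, obtained from its values on the line
  \<open>z - t B z\<close>.
\<close>

lemma positive_op_null:
  assumes "positive_op B" "inner (B z) z = 0"
  shows "B z = 0"
proof -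
  have B: "\<And>x y. inner (B x) y = inner x (B y)" "\<And>x. 0 \<le> inner (B x) x" and lin: "bounded_linear B"
    using assms by (auto simp: positive_op_iff bounded_op_UNIV_iff)
  let ?n = "inner (B z) (B z)" and ?w = "inner (B (B z)) (B z)"
  have "0 \<le> inner (B (z - t *\<^sub>R B z)) (z - t *\<^sub>R B z)" for t by (rule B)
  then have q: "0 \<le> t\<^sup>2 * ?w - 2 * t * ?n" for t
    using assms(2) B(1)[of "B z" z]
    by (simp add: linear_simps[OF lin] inner_simps inner_commute power2_eq_square algebra_simps)
  have "?n = 0" using q B(2) by (rule quadratic_nonneg_imp_zero)
  then show ?thesis by simp
qed

context symmetric_contraction
begin

text \<open>
  Another positive root \<open>C\<close> commutes with \<open>I - X = C\<^sup>2\<close>, hence with \<open>B = I - Y\<close>.  For \<open>z = B x - C x\<close> this gives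
  \<open>B z + C z = B\<^sup>2 x - C\<^sup>2 x = 0\<close>, so by positivity both \<open>B z\<close> and \<open>C z\<close> vanish, and \<open>z\<close> is orthogonal to
  itself.
\<close>

lemma sqrt_op_eq: "sqrt_op (\<lambda>x. x - X x) = (\<lambda>x. x - root_compl x)"
  unfolding sqrt_op_def
proof (rule the_equality)
  let ?B = "\<lambda>x. x - root_compl x"
  have lin: "bounded_linear root_compl" and hom: "\<And>c x. root_compl (c *\<^sub>C x) = c *\<^sub>C root_compl x"
    using root_compl_bounded_op by (auto simp: bounded_op_UNIV_iff)
  have B_lin: "bounded_linear ?B"
    by (intro bounded_linear_sub bounded_linear_ident lin)
  have "0 \<le> inner (?B x) x" for x
  proof -
    have "inner (root_compl x) x \<le> norm (root_compl x) * norm x" by (rule norm_cauchy_schwarz)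
    also have "\<dots> \<le> norm x * norm x" by (intro mult_right_mono root_compl_bound) simp
    finally show ?thesis by (simp add: inner_diff_left flip: power2_norm_eq_inner power2_eq_square)
  qed
  then have pos: "positive_op ?B"
    using B_lin by (simp add: positive_op_iff bounded_op_UNIV_iff inner_simps root_compl_sym hom scaleC_diff_right)
  have sq: "?B (?B x) = x - X x" for x
    using root_compl_fixpoint[of x] by (simp add: linear_simps[OF lin] algebra_simps scaleR_2)
  show "positive_op ?B \<and> (\<forall>x. ?B (?B x) = x - X x)"
    using pos sq by simp
  fix C assume C: "positive_op C \<and> (\<forall>x. C (C x) = x - X x)"
  then have C_lin: "bounded_linear C"
    by (simp add: positive_op_iff bounded_op_UNIV_iff)
  have "C (x - X x) = C x - X (C x)" for x
    using C by metis
  then have "C (X x) = X (C x)" for x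
    by (metis C_lin linear_simps(2) diff_left_imp_eq diff_diff_eq2 add_diff_cancel_left')
  then have comm: "C (?B x) = ?B (C x)" for x
    using root_compl_commute[OF C_lin] by (simp add: linear_simps[OF C_lin])
  show "C = ?B"
  proof
    fix x
    let ?z = "?B x - C x"
    have "?B ?z + C ?z = ?B (?B x) - C (C x)"
      using comm[of x] by (simp add: linear_simps[OF C_lin] linear_simps[OF lin] algebra_simps)
    also have "\<dots> = 0"
      using C by (simp only: sq) simp
    finally have "inner (?B ?z) ?z + inner (C ?z) ?z = 0"
      by (metis inner_add_left inner_zero_left)
    moreover have "0 \<le> inner (?B ?z) ?z" "0 \<le> inner (C ?z) ?z"
      using pos C by (auto simp: positive_op_iff)
    ultimately have z0: "inner (?B ?z) ?z = 0" "inner (C ?z) ?z = 0" by linarith+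
    then have "?B ?z = 0" "C ?z = 0"
      using positive_op_null[OF pos z0(1)] positive_op_null[of C ?z] C z0(2) by auto
    then have "inner (?B x) ?z = inner x (?B ?z)" "inner (C x) ?z = inner x (C ?z)"
      using pos C by (auto simp: positive_op_iff)
    then have "inner ?z ?z = 0"
      by (simp only: inner_diff_left[of "?B x" "C x"] \<open>?B ?z = 0\<close> \<open>C ?z = 0\<close>)
    then show "C x = ?B x" by simp
  qed
qed

lemma sqrt_op_props:
  shows "bounded_op UNIV UNIV (sqrt_op (\<lambda>x. x - X x))"
    and "inner (sqrt_op (\<lambda>x. x - X x) x) y = inner x (sqrt_op (\<lambda>x. x - X x) y)"
    and "sqrt_op (\<lambda>x. x - X x) (sqrt_op (\<lambda>x. x - X x) x) = x - X x"
proof -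
  have lin: "bounded_linear root_compl" and hom: "\<And>c x. root_compl (c *\<^sub>C x) = c *\<^sub>C root_compl x"
    using root_compl_bounded_op by (auto simp: bounded_op_UNIV_iff)
  show "bounded_op UNIV UNIV (sqrt_op (\<lambda>x. x - X x))"
    unfolding sqrt_op_eq using lin
    by (auto simp: bounded_op_UNIV_iff hom scaleC_diff_right intro!: bounded_linear_sub bounded_linear_ident)
  show "inner (sqrt_op (\<lambda>x. x - X x) x) y = inner x (sqrt_op (\<lambda>x. x - X x) y)"
    by (simp add: sqrt_op_eq inner_simps root_compl_sym)
  show "sqrt_op (\<lambda>x. x - X x) (sqrt_op (\<lambda>x. x - X x) x) = x - X x"
    unfolding sqrt_op_eq using root_compl_fixpoint[of x]
    by (simp add: linear_simps[OF lin] algebra_simps scaleR_2)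
qed

end

section \<open>Adjoints and defect operators of contractions\<close>

lemma adj_UNIV:
  assumes "bounded_op UNIV UNIV f"
  shows inner_adj: "inner (f x) y = inner x (adj_on UNIV f y)"
  using assms by (intro inner_adj_on) auto

lemma adj_UNIV_eqI:
  assumes "bounded_op UNIV UNIV f" "\<And>x. inner (f x) y = inner x z"
  shows "adj_on UNIV f y = z"
  using assms by (intro adj_on_eqI) (auto simp: bounded_op_UNIV_iff)

lemma bounded_op_adj:
  assumes f: "bounded_op UNIV UNIV f"
  shows "bounded_op UNIV UNIV (adj_on UNIV f)"
proof -
  have hom: "\<And>c x. f (c *\<^sub>C x) = c *\<^sub>C f x"
    using f by (auto simp: bounded_op_UNIV_iff)
  obtain C where C: "\<And>x. norm (f x) \<le> C * norm x" "0 \<le> C"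
    using f by (auto simp: bounded_op_UNIV_iff) (metis bounded_linear.nonneg_bounded mult.commute)
  have "norm (adj_on UNIV f y) \<le> C * norm y" for y
  proof -
    let ?a = "adj_on UNIV f y"
    have "norm ?a * norm ?a = inner (f ?a) y"
      by (simp add: inner_adj[OF f] flip: power2_norm_eq_inner power2_eq_square)
    also have "\<dots> \<le> (C * norm ?a) * norm y"
      using norm_cauchy_schwarz mult_right_mono[OF C(1)] norm_ge_zero order_trans by blast
    finally have "norm ?a * norm ?a \<le> (C * norm y) * norm ?a"
      by (simp add: mult_ac)
    then show ?thesis
      using C(2) by (cases "norm ?a = 0") (auto simp: mult_le_cancel_right)
  qed
  moreover have "adj_on UNIV f (x + y) = adj_on UNIV f x + adj_on UNIV f y" for x y
    by (intro adj_UNIV_eqI[OF f]) (simp add: inner_add_right inner_adj[OF f])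
  moreover have "adj_on UNIV f (c *\<^sub>C y) = c *\<^sub>C adj_on UNIV f y" for c y
    by (intro adj_UNIV_eqI[OF f])
       (metis hom inner_scaleC_left complex_cnj_cnj inner_adj[OF f])
  ultimately show ?thesis
    by (auto simp: bounded_op_def)
qed

lemma contraction_op_iff:
  "contraction_op T \<longleftrightarrow> bounded_op UNIV UNIV T \<and> (\<forall>x. norm (T x) \<le> norm x)"
proof
  assume T: "contraction_op T"
  then have "bounded_linear T" by (simp add: contraction_op_def bounded_op_UNIV_iff)
  have "norm (T x) \<le> norm x" for x
  proof -
    have "norm (T x) \<le> onorm T * norm x" by (rule onorm) fact
    also have "\<dots> \<le> 1 * norm x" using T by (intro mult_right_mono) (auto simp: contraction_op_def)
    finally show ?thesis by simp
  qed
  then show "bounded_op UNIV UNIV T \<and> (\<forall>x. norm (T x) \<le> norm x)"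
    using T by (simp add: contraction_op_def)
next
  assume "bounded_op UNIV UNIV T \<and> (\<forall>x. norm (T x) \<le> norm x)"
  then show "contraction_op T"
    by (auto simp: contraction_op_def intro!: onorm_bound)
qed

lemma defect_props:
  assumes "contraction_op T"
  shows bounded_op_defect: "bounded_op UNIV UNIV (defect T)"
    and defect_sym: "inner (defect T x) y = inner x (defect T y)"
    and inner_defect: "inner (defect T x) (defect T y) = inner x y - inner (T x) (T y)"
proof -
  have T: "bounded_op UNIV UNIV T" and contr: "\<And>x. norm (T x) \<le> norm x"
    using assms by (auto simp: contraction_op_iff)
  have adj_contr: "norm (adj_on UNIV T x) \<le> norm x" for x
  proof -
    let ?a = "adj_on UNIV T x"
    have "norm ?a * norm ?a = inner (T ?a) x"
      by (simp add: inner_adj[OF T] flip: power2_norm_eq_inner power2_eq_square)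
    also have "\<dots> \<le> norm ?a * norm x"
      using norm_cauchy_schwarz mult_right_mono[OF contr] norm_ge_zero order_trans by blast
    finally show ?thesis
      by (cases "norm ?a = 0") auto
  qed
  have "bounded_op UNIV UNIV (\<lambda>x. adj_on UNIV T (T x))"
    using T bounded_op_adj[OF T] by (auto simp: bounded_op_UNIV_iff intro: bounded_linear_compose)
  moreover have "inner (adj_on UNIV T (T x)) y = inner (T x) (T y)" for x y
    by (metis inner_adj[OF T] inner_commute)
  ultimately interpret symmetric_contraction "\<lambda>x. adj_on UNIV T (T x)"
    by unfold_locales (auto simp: inner_adj[OF T] intro: order_trans[OF adj_contr contr])
  show "bounded_op UNIV UNIV (defect T)"
    unfolding defect_def by (rule sqrt_op_props)
  show s: "inner (defect T x) y = inner x (defect T y)" for x y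
    unfolding defect_def by (rule sqrt_op_props)
  have q: "defect T (defect T x) = x - adj_on UNIV T (T x)" for x
    unfolding defect_def by (rule sqrt_op_props)
  show "inner (defect T x) (defect T y) = inner x y - inner (T x) (T y)"
    by (simp add: s q inner_diff_right inner_adj[OF T])
qed

section \<open>Isometries prescribed on a spanning set\<close>

lemma cspan_subset_span:
  assumes "\<And>c x. x \<in> A \<Longrightarrow> c *\<^sub>C x \<in> A"
  shows "complex_vector.span A \<subseteq> span (A :: 'a::complex_hilbert set)"
proof (rule complex_vector.span_minimal)
  show "A \<subseteq> span A" by (rule span_superset)
  have "c *\<^sub>C x \<in> span A" if "x \<in> span A" for c x
    using that
  proof (induction rule: span_induct)
    case base
    show ?case
      by (auto intro!: subspaceI simp: scaleC_add_right scaleC_scaleR_commute scaleC_zero_right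
          span_zero span_add span_scale)
  next
    case (step x)
    then show ?case using assms by (blast intro: span_base)
  qed
  then show "complex_vector.subspace (span A)"
    by (auto simp: complex_vector.subspace_def span_zero span_add)
qed

text \<open>
  \<open>R\<close> is the graph of a map between generators.  Equality of the Gram matrices passes to the real span of
  \<open>R\<close> in the product space, so that the closure of this span consists of pairs of equal norm: it is the
  graph of an isometry.  Completeness of the target makes the isometry total on the closed span of the
  first components, and closedness of \<open>R\<close> under complex scalars makes it complex-linear.
\<close>

lemma isometric_extension:
  fixes R :: "('a::complex_hilbert \<times> 'b::complex_hilbert) set"
  assumes gram: "\<And>x y x' y'. (x, y) \<in> R \<Longrightarrow> (x', y') \<in> R \<Longrightarrow> inner x x' = inner y y'"
    and scale: "\<And>c x y. (x, y) \<in> R \<Longrightarrow> (c *\<^sub>C x, c *\<^sub>C y) \<in> R"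
  obtains f where "\<And>x y. (x, y) \<in> R \<Longrightarrow> f x = y"
    and "bounded_op (closure (span (fst ` R))) (closure (span (snd ` R))) f"
    and "\<And>x. x \<in> closure (span (fst ` R)) \<Longrightarrow> norm (f x) = norm x"
proof -
  define G where "G = closure (span R)"
  have G: "subspace G" unfolding G_def by (intro subspace_closure subspace_span)
  have R_G: "R \<subseteq> G" unfolding G_def using span_superset closure_subset by blast
  have *: "inner (fst p) (fst q) = inner (snd p) (snd q)" if "p \<in> span R" "q \<in> R" for p q
    using that(1)
  proof (induction rule: span_induct)
    case base
    show ?case by (auto intro!: subspaceI simp: inner_add_left)
  next
    case (step p)
    then show ?case using that(2) gram by (metis prod.collapse)
  qed
  have **: "inner (fst p) (fst q) = inner (snd p) (snd q)" if "p \<in> span R" "q \<in> span R" for p q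
    using that(2)
  proof (induction rule: span_induct)
    case base
    show ?case by (auto intro!: subspaceI simp: inner_add_right)
  next
    case (step q)
    then show ?case using that(1) * by blast
  qed
  have norm_span: "norm x = norm y" if "(x, y) \<in> span R" for x y
    using **[OF that that] by (simp add: norm_eq_sqrt_inner)
  have "G \<subseteq> {p. norm (fst p) = norm (snd p)}"
    unfolding G_def
  proof (rule closure_minimal)
    show "span R \<subseteq> {p. norm (fst p) = norm (snd p)}" using norm_span by auto
    show "closed {p::'a \<times> 'b. norm (fst p) = norm (snd p)}"
      by (intro closed_Collect_eq continuous_intros)
  qed
  then have norm_G: "norm x = norm y" if "(x, y) \<in> G" for x y using that by auto
  have unique: "y = y'" if "(x, y) \<in> G" "(x, y') \<in> G" for x y y'
    using norm_G[of 0 "y - y'"] subspace_diff[OF G that] by simp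
  have G_snd: "y \<in> closure (span (snd ` R))" if "(x, y) \<in> G" for x y
  proof -
    have "G \<subseteq> snd -` closure (span (snd ` R))"
      unfolding G_def
    proof (rule closure_minimal)
      have "snd ` span R = span (snd ` R)"
        by (rule span_linear_image[symmetric]) (rule bounded_linear.linear[OF bounded_linear_snd])
      then show "span R \<subseteq> snd -` closure (span (snd ` R))"
        by (metis image_subset_iff_subset_vimage closure_subset)
      show "closed (snd -` closure (span (snd ` R)) :: ('a \<times> 'b) set)"
        by (intro closed_vimage_snd closed_closure)
    qed
    then show ?thesis using that by auto
  qed
  have G_scale: "(c *\<^sub>C x, c *\<^sub>C y) \<in> G" if "(x, y) \<in> G" for c x y
  proof -
    have "(c *\<^sub>C fst p, c *\<^sub>C snd p) \<in> span R" if "p \<in> span R" for p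
      using that
    proof (induction rule: span_induct)
      case base
      show ?case
      proof (rule subspaceI; clarsimp simp: scaleC_add_right scaleC_scaleR_commute scaleC_zero_right)
        show "(0, 0) \<in> span R" using span_zero[of R] by (simp add: zero_prod_def)
        show "\<And>a b aa ba. (c *\<^sub>C a, c *\<^sub>C b) \<in> span R \<Longrightarrow> (c *\<^sub>C aa, c *\<^sub>C ba) \<in> span R \<Longrightarrow>
           (c *\<^sub>C a + c *\<^sub>C aa, c *\<^sub>C b + c *\<^sub>C ba) \<in> span R"
          by (metis span_add add_Pair)
        show "\<And>ca a b. (c *\<^sub>C a, c *\<^sub>C b) \<in> span R \<Longrightarrow> (ca *\<^sub>R c *\<^sub>C a, ca *\<^sub>R c *\<^sub>C b) \<in> span R"
          by (metis span_scale scaleR_Pair)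
      qed
    next
      case (step p)
      then show ?case using scale by (metis span_base prod.collapse)
    qed
    moreover have "continuous_on UNIV (\<lambda>p::'a \<times> 'b. (c *\<^sub>C fst p, c *\<^sub>C snd p))"
      by (intro continuous_on_Pair bounded_linear.continuous_on[OF bounded_linear_scaleC] continuous_intros)
    ultimately have "(\<lambda>p. (c *\<^sub>C fst p, c *\<^sub>C snd p)) ` G \<subseteq> G"
      unfolding G_def
      by (intro image_closure_subset) (auto intro: continuous_on_subset closure_subset[THEN subsetD])
    then show ?thesis using that by auto
  qed
  have total: "\<exists>y. (x, y) \<in> G" if x: "x \<in> closure (span (fst ` R))" for x
  proof -
    have "fst ` span R = span (fst ` R)"
      by (rule span_linear_image[symmetric]) (rule bounded_linear.linear[OF bounded_linear_fst])
    moreover obtain u where "\<forall>n. u n \<in> span (fst ` R)" and u: "u \<longlonglongrightarrow> x"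
      using x[unfolded closure_sequential] by blast
    ultimately have "\<forall>n. \<exists>y. (u n, y) \<in> span R"
      by (metis imageE prod.collapse)
    then obtain v where uv: "\<And>n. (u n, v n) \<in> span R" by metis
    have "dist (v j) (v k) = dist (u j) (u k)" for j k
      using norm_span[of "u j - u k" "v j - v k"] span_diff[OF uv[of j] uv[of k]] by (simp add: dist_norm)
    then have "Cauchy v"
      using LIMSEQ_imp_Cauchy[OF u] by (simp add: Cauchy_def)
    then obtain y where "v \<longlonglongrightarrow> y" by (auto simp: Cauchy_convergent_iff convergent_def)
    then have "(\<lambda>n. (u n, v n)) \<longlonglongrightarrow> (x, y)" using u by (intro tendsto_Pair)
    then show ?thesis
      using uv unfolding G_def closure_sequential by (intro exI[of _ y] exI[of _ "\<lambda>n. (u n, v n)"]) simp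
  qed
  define f where "f x = (SOME y. (x, y) \<in> G)" for x
  have f_G: "(x, f x) \<in> G" if "x \<in> closure (span (fst ` R))" for x
    unfolding f_def using total[OF that] by (rule someI_ex)
  have f_eq: "f x = y" if "(x, y) \<in> G" for x y
    unfolding f_def using that unique by blast
  show thesis
  proof (rule that)
    show "f x = y" if "(x, y) \<in> R" for x y
      using that R_G by (intro f_eq) blast
    show "norm (f x) = norm x" if "x \<in> closure (span (fst ` R))" for x
      using norm_G[OF f_G[OF that]] by simp
    then show "bounded_op (closure (span (fst ` R))) (closure (span (snd ` R))) f"
      unfolding bounded_op_def
      using G_snd[OF f_G] f_eq G_scale[OF f_G] subspace_add[OF G f_G f_G]
      by (auto intro!: exI[of _ 1])
  qed
qed

section \<open>Calculus of bounded operators\<close>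

lemma bounded_op_compose:
  "bounded_op UNIV UNIV f \<Longrightarrow> bounded_op UNIV UNIV g \<Longrightarrow> bounded_op UNIV UNIV (\<lambda>x. f (g x))"
  by (auto simp: bounded_op_UNIV_iff intro: bounded_linear_compose)

lemma bounded_op_add:
  "bounded_op UNIV UNIV f \<Longrightarrow> bounded_op UNIV UNIV g \<Longrightarrow> bounded_op UNIV UNIV (\<lambda>x. f x + g x)"
  by (auto simp: bounded_op_UNIV_iff scaleC_add_right intro: bounded_linear_add)

lemma bounded_op_lin:
  assumes "bounded_op UNIV UNIV f"
  shows bounded_op_plus: "f (x + y) = f x + f y"
    and bounded_op_minus: "f (x - y) = f x - f y"
    and bounded_op_zero: "f 0 = 0"
    and bounded_op_scaleC: "f (c *\<^sub>C x) = c *\<^sub>C f x"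
    and bounded_op_linear: "bounded_linear f"
  using assms by (auto simp: bounded_op_UNIV_iff linear_simps)

lemma isometry_op_inner:
  assumes "isometry_op V" shows "inner (V x) (V y) = inner x y"
proof -
  have V: "bounded_op UNIV UNIV V" "\<And>x. norm (V x) = norm x"
    using assms by (auto simp: isometry_op_def)
  then show ?thesis
    by (simp add: dot_norm flip: bounded_op_plus)
qed

lemma isometry_op_bounded: "isometry_op V \<Longrightarrow> bounded_op UNIV UNIV V"
  by (simp add: isometry_op_def)

lemma isometry_op_adj_cancel:
  assumes "isometry_op V" shows "adj_on UNIV V (V x) = x"
  using assms by (intro adj_UNIV_eqI isometry_op_bounded) (simp_all add: isometry_op_inner)

lemma isometry_op_compose:
  "isometry_op f \<Longrightarrow> isometry_op g \<Longrightarrow> isometry_op (\<lambda>x. f (g x))"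
  by (simp add: isometry_op_def bounded_op_compose)

lemma inner_adj2: 
  assumes "bounded_op UNIV UNIV f"
  shows "inner (adj_on UNIV f y) x = inner y (f x)"
  by (metis assms inner_adj inner_commute)

lemma proj_onto_range:
  assumes "isometry_op J"
  shows "proj_onto (range J) x = J (adj_on UNIV J x)"
  unfolding proj_onto_def
proof (rule the_equality)
  have J: "bounded_op UNIV UNIV J" using assms by (rule isometry_op_bounded)
  have *: "inner (x - J (adj_on UNIV J x)) (J h) = 0" for h
    by (simp add: inner_diff_left isometry_op_inner[OF assms] inner_adj2[OF J])
  then show "J (adj_on UNIV J x) \<in> range J \<and> (\<forall>z\<in>range J. cinner (x - J (adj_on UNIV J x)) z = 0)"
    by (auto simp: cinner_via_inner complex_eq_iff simp flip: bounded_op_scaleC[OF J])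
  fix y assume y: "y \<in> range J \<and> (\<forall>z\<in>range J. cinner (x - y) z = 0)"
  then obtain g where g: "y = J g" by blast
  have "inner (x - y) (J h) = 0" for h
    using y by (simp flip: Re_cinner)
  from this[of "g - adj_on UNIV J x"] *[of "g - adj_on UNIV J x"]
  have "inner (J g - J (adj_on UNIV J x)) (J (g - adj_on UNIV J x)) = 0"
    by (simp add: g inner_diff_left)
  then show "y = J (adj_on UNIV J x)"
    by (simp add: bounded_op_minus[OF J] g)
qed

lemma bounded_op_eq_on_closure:
  assumes f: "bounded_linear f" and g: "bounded_linear g"
    and "\<And>x. x \<in> A \<Longrightarrow> f x = g x" and "x \<in> closure A"
  shows "f x = g x"
proof -
  have "closed {x. f x = g x}"
    by (intro closed_Collect_eq bounded_linear.continuous_on[OF f] bounded_linear.continuous_on[OF g] continuous_on_id)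
  then have "closure A \<subseteq> {x. f x = g x}"
    using assms(3) by (intro closure_minimal) auto
  then show ?thesis using assms(4) by auto
qed

section \<open>Products of commuting families\<close>

lemma funpow_commute:
  assumes "\<And>x. f (g x) = g (f x)"
  shows "(f ^^ k) ((g ^^ l) x) = (g ^^ l) ((f ^^ k) x)"
proof -
  have *: "f ((g ^^ l) x) = (g ^^ l) (f x)" for x
    by (induction l) (simp_all add: assms)
  show ?thesis
    by (induction k) (simp_all add: *)
qed

lemma funpow_compose_commute:
  assumes "\<And>x. f (g x) = g (f x)"
  shows "(f ^^ m) ((g ^^ m) x) = ((\<lambda>x. f (g x)) ^^ m) x"
proof (induction m)
  case (Suc m)
  have "(f ^^ m) (g y) = g ((f ^^ m) y)" for y
    using funpow_commute[of f g m 1 y] assms by simp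
  then show ?case using Suc by simp
qed simp

lemma foldr_intertwine:
  assumes "\<And>i x. i \<in> set xs \<Longrightarrow> f (A i x) = B i (f x)"
  shows "f (foldr A xs x) = foldr B xs (f x)"
  using assms by (induction xs) auto

lemma foldr_mset_cong:
  assumes "\<And>i j x. i \<in> set xs \<Longrightarrow> j \<in> set xs \<Longrightarrow> A i (A j x) = A j (A i x)"
    and "mset xs = mset ys"
  shows "foldr A xs = foldr A ys"
  unfolding foldr_conv_fold
proof (rule fold_multiset_equiv)
  fix i j assume "i \<in> set (rev xs)" "j \<in> set (rev xs)"
  then show "A i \<circ> A j = A j \<circ> A i"
    by (intro ext) (unfold comp_def, rule assms(1), auto)
qed (simp add: assms(2))

lemma foldr_funpow:
  assumes "\<And>i j x. i \<in> set xs \<Longrightarrow> j \<in> set xs \<Longrightarrow> A i (A j x) = A j (A i x)"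
  shows "foldr (\<lambda>i. A i ^^ m) xs = (foldr A xs) ^^ m"
  using assms
proof (induction xs)
  case (Cons a xs)
  have "A a (foldr A xs x) = foldr A xs (A a x)" for x
    by (rule foldr_intertwine) (use Cons.prems in auto)
  then show ?case
    using Cons by (auto simp: fun_eq_iff funpow_compose_commute comp_def)
qed auto

text \<open>
  With the exponent \<open>m + 1\<close> at \<open>j\<close> and \<open>m\<close> elsewhere a monomial is \<open>A\<^sub>j\<close> times a power of the product.  The joint
  dilation property is exploited through these monomials, which yield \<open>J\<^sup>* V\<^sub>i = T\<^sub>i J\<^sup>*\<close>.
\<close>

lemma foldr_funpow_Suc_at:
  assumes comm: "\<And>i j x. i \<in> set xs \<Longrightarrow> j \<in> set xs \<Longrightarrow> A i (A j x) = A j (A i x)"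
    and "distinct xs" "j \<in> set xs"
  shows "foldr (\<lambda>i. A i ^^ (if i = j then Suc m else m)) xs x = A j ((foldr A xs ^^ m) x)"
proof -
  let ?ys = "remove1 j xs"
  have ys: "mset xs = mset (j # ?ys)" "j \<notin> set ?ys"
    using assms by auto
  have split: "foldr (\<lambda>i. A i ^^ k i) xs = foldr (\<lambda>i. A i ^^ k i) (j # ?ys)" for k
    using ys(1) by (intro foldr_mset_cong funpow_commute comm)
  let ?k = "\<lambda>i. if i = j then Suc m else m"
  have "foldr (\<lambda>i. A i ^^ ?k i) ?ys x = foldr (\<lambda>i. A i ^^ m) ?ys x" for x
    by (rule foldr_cong) (use ys(2) in auto)
  then have "foldr (\<lambda>i. A i ^^ ?k i) xs x = A j (foldr (\<lambda>i. A i ^^ m) xs x)"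
    unfolding split[of ?k] split[of "\<lambda>_. m"] by simp
  also have "foldr (\<lambda>i. A i ^^ m) xs = foldr A xs ^^ m"
    using comm by (rule foldr_funpow)
  finally show ?thesis .
qed

lemma isometry_op_foldr:
  "(\<And>i. i \<in> set xs \<Longrightarrow> isometry_op (A i)) \<Longrightarrow> isometry_op (foldr A xs)"
proof (induction xs)
  case Nil
  show ?case by (auto simp: isometry_op_def bounded_op_UNIV_iff)
next
  case (Cons a xs)
  then show ?case using isometry_op_compose[of "A a" "foldr A xs"] by (simp add: comp_def)
qed

lemma contraction_op_foldr:
  "(\<And>i. i \<in> set xs \<Longrightarrow> contraction_op (A i)) \<Longrightarrow> contraction_op (foldr A xs)"
proof (induction xs)
  case Nil
  show ?case by (auto simp: contraction_op_iff bounded_op_UNIV_iff)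
next
  case (Cons a xs)
  then have a: "contraction_op (A a)" and xs: "contraction_op (foldr A xs)"
    by auto
  have "norm (A a (foldr A xs x)) \<le> norm x" for x
    using a xs unfolding contraction_op_iff by (meson order_trans)
  then show ?case
    using a xs bounded_op_compose[of "A a" "foldr A xs"] by (simp add: contraction_op_iff comp_def)
qed

lemma commuting_on_upt:
  assumes "commuting_on S n A" "i \<in> set [1..<Suc n]" "j \<in> set [1..<Suc n]" "x \<in> S"
  shows "A i (A j x) = A j (A i x)"
proof -
  have "i \<in> {1..n}" "j \<in> {1..n}" using assms by auto
  then show ?thesis using assms unfolding commuting_on_def by blast
qed

lemma op_monomial_const:
  assumes "commuting_on UNIV n A"
  shows "op_monomial n A (\<lambda>_. m) = op_prod n A ^^ m"
  unfolding op_monomial_def op_prod_def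
proof (rule foldr_funpow)
  show "A i (A j x) = A j (A i x)" if "i \<in> set [1..<Suc n]" "j \<in> set [1..<Suc n]" for i j x
    using that by (rule commuting_on_upt[OF assms]) simp
qed

lemma op_monomial_Suc_at:
  assumes "commuting_on UNIV n A" "j \<in> {1..n}"
  shows "op_monomial n A (\<lambda>i. if i = j then Suc m else m) x = A j ((op_prod n A ^^ m) x)"
  unfolding op_monomial_def op_prod_def
proof (rule foldr_funpow_Suc_at)
  show "A i (A j x) = A j (A i x)" if "i \<in> set [1..<Suc n]" "j \<in> set [1..<Suc n]" for i j x
    using that by (rule commuting_on_upt[OF assms(1)]) simp
qed (use assms(2) in auto)

lemma op_monomial_1: "op_monomial 1 (\<lambda>_. A) k = A ^^ k 1"
  by (simp add: op_monomial_def op_prod_def)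

section \<open>Minimal isometric dilations of one contraction\<close>

locale minimal_dilation =
  fixes J :: "'h::complex_hilbert \<Rightarrow> 'k::complex_hilbert" and T V
  assumes contr: "contraction_op T"
    and dil: "minimal_isometric_dilation1 J T V"
begin

abbreviation Js :: "'k \<Rightarrow> 'h" where "Js \<equiv> adj_on UNIV J"

lemma isoJ: "isometry_op J" and isoV: "isometry_op V"
  using dil by (auto simp: minimal_isometric_dilation_def isometric_dilation_def)

lemmas J = isometry_op_bounded[OF isoJ] and V = isometry_op_bounded[OF isoV]
lemmas T = contr[unfolded contraction_op_iff, THEN conjunct1]
lemmas Js = bounded_op_adj[OF J]
lemmas lin = bounded_op_lin[OF J] bounded_op_lin[OF V] bounded_op_lin[OF T] bounded_op_lin[OF Js]

lemma Js_J: "Js (J h) = h"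
  by (rule isometry_op_adj_cancel[OF isoJ])

lemma inner_V: "inner (V x) (V y) = inner x y"
  by (rule isometry_op_inner[OF isoV])

lemma inner_Vpow: "inner ((V ^^ m) x) ((V ^^ m) y) = inner x y"
  by (induction m) (simp_all add: inner_V)

lemma inner_J: "inner (J x) (J y) = inner x y"
  by (rule isometry_op_inner[OF isoJ])

lemma V_inject: "V x = V y \<longleftrightarrow> x = y"
  by (metis isometry_op_adj_cancel[OF isoV])

lemma Js_Vpow_J: "Js ((V ^^ m) (J h)) = (T ^^ m) h"
proof -
  have "\<forall>(k :: nat \<Rightarrow> nat) h. J ((T ^^ k 1) h) = proj_onto (range J) ((V ^^ k 1) (J h))"
    using dil unfolding minimal_isometric_dilation_def isometric_dilation_def op_monomial_1
    by blast
  from this[rule_format, of "\<lambda>_. m" h]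
  have "J ((T ^^ m) h) = proj_onto (range J) ((V ^^ m) (J h))" .
  then show ?thesis
    by (metis proj_onto_range[OF isoJ] Js_J)
qed

lemma dense: "closure (span {(V ^^ m) (J h) | m h. True}) = UNIV"
proof -
  let ?A = "{(V ^^ m) (J h) | m h. True}"
  have "{op_monomial 1 (\<lambda>_. V) k (J h) |k h. True} = ?A"
  proof (intro equalityI subsetI)
    fix x assume "x \<in> {op_monomial 1 (\<lambda>_. V) k (J h) |k h. True}"
    then show "x \<in> ?A" unfolding op_monomial_1 by blast
  next
    fix x assume "x \<in> ?A"
    then obtain m h where "x = (V ^^ m) (J h)" by blast
    then have "x = op_monomial 1 (\<lambda>_. V) (\<lambda>_. m) (J h)" by (simp only: op_monomial_1)
    then show "x \<in> {op_monomial 1 (\<lambda>_. V) k (J h) |k h. True}" by blast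
  qed
  then have "closure (complex_vector.span ?A) = UNIV"
    using dil by (simp add: minimal_isometric_dilation_def)
  moreover have "c *\<^sub>C (V ^^ m) (J h) = (V ^^ m) (J (c *\<^sub>C h))" for c m h
    by (induction m) (simp_all flip: bounded_op_scaleC[OF J] bounded_op_scaleC[OF V])
  then have "complex_vector.span ?A \<subseteq> span ?A"
    by (intro cspan_subset_span) blast
  ultimately show ?thesis
    using closure_mono by blast
qed

lemma dense_induct:
  assumes "closed C" "subspace C" "\<And>m h. (V ^^ m) (J h) \<in> C"
  shows "x \<in> C"
proof -
  have "closure (span {(V ^^ m) (J h) | m h. True}) \<subseteq> C"
    using assms by (intro closure_minimal span_minimal) auto
  then show ?thesis by (simp only: dense) blast
qed

lemma bounded_ops_eqI:
  assumes "bounded_op UNIV UNIV f" "bounded_op UNIV UNIV g"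
    and "\<And>m h. f ((V ^^ m) (J h)) = g ((V ^^ m) (J h))"
  shows "f x = g x"
proof -
  have f: "bounded_linear f" and g: "bounded_linear g"
    using assms by (auto simp: bounded_op_UNIV_iff)
  have "x \<in> {x. f x = g x}"
  proof (rule dense_induct)
    show "closed {x. f x = g x}"
      by (intro closed_Collect_eq bounded_linear.continuous_on[OF f] bounded_linear.continuous_on[OF g] continuous_on_id)
    show "subspace {x. f x = g x}"
      by (auto intro!: subspaceI simp: linear_simps[OF f] linear_simps[OF g])
  qed (simp add: assms)
  then show ?thesis by simp
qed

lemma orthogonal_dense_zero:
  assumes "\<And>m h. inner x ((V ^^ m) (J h)) = 0"
  shows "x = 0"
proof -
  have "x \<in> {y. inner x y = 0}"
  proof (rule dense_induct)
    show "closed {y. inner x y = 0}"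
      by (intro closed_Collect_eq continuous_intros)
    show "subspace {y. inner x y = 0}"
      by (auto intro!: subspaceI simp: inner_add_right)
  qed (simp add: assms)
  then show ?thesis by simp
qed

text \<open>
  As \<open>(V\<^sup>m J h)\<close> is total, compressions of \<open>X V\<^sup>m\<close> to the range of \<open>J\<close> decide whether \<open>J\<^sup>* X = t J\<^sup>*\<close>, that is,
  whether the range of \<open>J\<close> is invariant under \<open>X\<^sup>*\<close>.
\<close>

lemma Js_intertwine:
  assumes "bounded_op UNIV UNIV X" "bounded_op UNIV UNIV t"
    and "\<And>m h. Js (X ((V ^^ m) (J h))) = t ((T ^^ m) h)"
  shows "Js (X x) = t (Js x)"
  by (rule bounded_ops_eqI[OF bounded_op_compose[OF Js assms(1)] bounded_op_compose[OF assms(2) Js]])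
     (simp only: Js_Vpow_J assms(3))

lemma Js_V: "Js (V x) = T (Js x)"
proof (rule Js_intertwine[OF V T])
  show "Js (V ((V ^^ m) (J h))) = T ((T ^^ m) h)" for m h
    using Js_Vpow_J[of "Suc m" h] by simp
qed

lemma Vpow_bounded: "bounded_op UNIV UNIV (V ^^ m)"
proof (induction m)
  case 0
  show ?case by (simp add: bounded_op_UNIV_iff id_def)
next
  case (Suc m)
  then show ?case using bounded_op_compose[OF V] by (simp add: comp_def)
qed

lemma scaleC_Vpow_J: "c *\<^sub>C (V ^^ m) (J h) = (V ^^ m) (J (c *\<^sub>C h))"
  by (simp add: bounded_op_scaleC[OF Vpow_bounded] bounded_op_scaleC[OF J])

text \<open>
  An isometry can be prescribed on the total set of all \<open>V\<^sup>m J h\<close>, provided that inner products are kept.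
  The factors of a dilation and the unitary between two dilations are both obtained in this way.
\<close>

lemma isometry_from_gram:
  fixes Z :: "nat \<Rightarrow> 'h \<Rightarrow> 'b::complex_hilbert"
  assumes Z_scale: "\<And>c m h. c *\<^sub>C Z m h = Z m (c *\<^sub>C h)"
    and gram: "\<And>m h l g. inner (Z m h) (Z l g) = inner ((V ^^ m) (J h)) ((V ^^ l) (J g))"
  shows "\<exists>f. isometry_op f \<and> (\<forall>m h. f ((V ^^ m) (J h)) = Z m h)"
proof -
  let ?R = "{((V ^^ m) (J h), Z m h) | m h. True}"
  have gram_R: "inner x x' = inner y y'" if "(x, y) \<in> ?R" "(x', y') \<in> ?R" for x y x' y'
    using that gram by auto
  have scale_R: "(c *\<^sub>C x, c *\<^sub>C y) \<in> ?R" if "(x, y) \<in> ?R" for c x y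
    using that scaleC_Vpow_J Z_scale by blast
  obtain f where f: "\<And>x y. (x, y) \<in> ?R \<Longrightarrow> f x = y"
      "bounded_op (closure (span (fst ` ?R))) (closure (span (snd ` ?R))) f"
      "\<And>x. x \<in> closure (span (fst ` ?R)) \<Longrightarrow> norm (f x) = norm x"
    using isometric_extension[OF gram_R scale_R] by blast
  have fst: "fst ` ?R = {(V ^^ m) (J h) | m h. True}" by force
  have "isometry_op f"
    using f(2,3) unfolding fst dense isometry_op_def by (simp add: bounded_op_def)
  then show ?thesis using f(1) by blast
qed

lemma inner_Vpow_J:
  "inner ((V ^^ m) (J h)) ((V ^^ l) (J g)) =
    (if l \<le> m then inner ((T ^^ (m - l)) h) g else inner h ((T ^^ (l - m)) g))"
proof -
  have *: "inner ((V ^^ (p + q)) (J a)) ((V ^^ q) (J b)) = inner ((T ^^ p) a) b" for p q a b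
  proof -
    have "(V ^^ (p + q)) (J a) = (V ^^ q) ((V ^^ p) (J a))"
      by (subst add.commute) (simp add: funpow_add)
    then show ?thesis
      by (simp add: inner_Vpow Js_Vpow_J flip: inner_adj2[OF J])
  qed
  show ?thesis
    using *[of "m - l" l h g] *[of "l - m" m g h] by (auto simp: inner_commute)
qed

end

lemma inner_zero_on_closure:
  assumes "\<And>x. x \<in> A \<Longrightarrow> inner w x = 0" "z \<in> closure A"
  shows "inner w z = 0"
proof -
  have "closed {z. inner w z = 0}" by (intro closed_Collect_eq continuous_intros)
  then have "closure A \<subseteq> {z. inner w z = 0}" using assms(1) by (intro closure_minimal) auto
  then show ?thesis using assms(2) by blast
qed

section \<open>The wandering subspace of a minimal dilation\<close>

lemma csubspace_defect_range:
  assumes "contraction_op T"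
  shows "complex_vector.subspace (range (defect T))"
proof (rule complex_vector.subspaceI)
  note D = bounded_op_defect[OF assms]
  show "0 \<in> range (defect T)"
    by (metis rangeI bounded_op_zero[OF D])
  show "x + y \<in> range (defect T)" if "x \<in> range (defect T)" "y \<in> range (defect T)" for x y
    using that by (auto simp flip: bounded_op_plus[OF D])
  show "c *\<^sub>C x \<in> range (defect T)" if "x \<in> range (defect T)" for c x
    using that by (auto simp flip: bounded_op_scaleC[OF D])
qed

lemma defect_space:
  assumes "contraction_op T"
  shows csubspace_defect_space: "complex_vector.subspace (defect_space T)"
    and closed_defect_space: "closed (defect_space T)"
    and defect_in_defect_space: "defect T h \<in> defect_space T"
  unfolding defect_space_def
  by (simp_all add: csubspace_closure csubspace_defect_range assms closure_subset[THEN subsetD])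

lemma orthogonal_projection_exists:
  assumes "closed S" "complex_vector.subspace (S :: 'a::complex_hilbert set)"
  obtains p where "bounded_op UNIV UNIV p" "\<And>x. p x \<in> S" "\<And>x. x \<in> S \<Longrightarrow> p x = x"
    "\<And>x y. x \<in> S \<Longrightarrow> inner x (p y) = inner x y"
proof -
  let ?p = "adj_on S (\<lambda>x. x)"
  have id: "bounded_op S UNIV (\<lambda>x. x)"
    by (auto simp: bounded_op_def intro!: exI[of _ 1])
  have p_in: "?p x \<in> S" for x by (rule adj_on_in[OF assms id])
  have p_inner: "inner x (?p y) = inner x y" if "x \<in> S" for x y
    by (rule inner_adj_on[OF assms id that, symmetric])
  have p_eqI: "?p y = z" if "z \<in> S" "\<And>x. x \<in> S \<Longrightarrow> inner x y = inner x z" for y z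
    using that by (intro adj_on_eqI assms) auto
  have plus: "?p (x + y) = ?p x + ?p y" for x y
    by (intro p_eqI complex_vector.subspace_add assms p_in) (simp add: inner_add_right p_inner)
  have scale: "?p (c *\<^sub>C y) = c *\<^sub>C ?p y" for c y
  proof (intro p_eqI complex_vector.subspace_scale assms p_in)
    fix x assume "x \<in> S"
    then have "cnj c *\<^sub>C x \<in> S" using assms by (intro complex_vector.subspace_scale)
    from p_inner[OF this, of y] show "inner x (c *\<^sub>C y) = inner x (c *\<^sub>C ?p y)"
      by (simp add: inner_scaleC_left)
  qed
  have "norm (?p x) \<le> 1 * norm x" for x
  proof -
    have "norm (?p x) * norm (?p x) = inner (?p x) x"
      using p_inner[OF p_in, of x x] by (simp flip: power2_norm_eq_inner power2_eq_square)
    also have "\<dots> \<le> norm (?p x) * norm x" by (rule norm_cauchy_schwarz)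
    finally show ?thesis by (cases "norm (?p x) = 0") auto
  qed
  then have "bounded_op UNIV UNIV ?p"
    using plus scale by (auto simp: bounded_op_def intro!: exI[of _ 1])
  then show thesis
    using p_in p_inner by (intro that[of ?p]) (auto intro: p_eqI)
qed

text \<open>
  \<open>E\<close> identifies \<open>\<D>\<^sub>T\<close> with the wandering subspace of \<open>V\<close>, the closed range of \<open>V J - J T\<close>.  It is a partial
  isometry on the whole space, with initial space \<open>\<D>\<^sub>T\<close>; this is what the assumption on the range of its
  adjoint says.  Thus \<open>E\<close> and \<open>E\<^sup>*\<close> are bounded operators between types, although \<open>\<D>\<^sub>T\<close> is only a subset.
\<close>

locale dilation_embedding = minimal_dilation J T V
  for J :: "'h::complex_hilbert \<Rightarrow> 'k::complex_hilbert" and T V +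
  fixes E :: "'h \<Rightarrow> 'k"
  assumes E: "bounded_op UNIV UNIV E"
    and E_isometric: "\<And>x y. x \<in> defect_space T \<Longrightarrow> y \<in> defect_space T \<Longrightarrow> inner (E x) (E y) = inner x y"
    and E_defect: "\<And>h. E (defect T h) = V (J h) - J (T h)"
    and Es_in: "\<And>y. adj_on UNIV E y \<in> defect_space T"

text \<open>
  Since \<open>J\<^sup>* V = T J\<^sup>*\<close>, the vectors \<open>V J h - J T h\<close> and \<open>D\<^sub>T h\<close> have the same Gram matrix, so
  \<open>D\<^sub>T h \<mapsto> V J h - J T h\<close> extends to an isometry of \<open>\<D>\<^sub>T\<close>; preceding it by the projection onto \<open>\<D>\<^sub>T\<close> gives \<open>E\<close>.
\<close>

lemma (in minimal_dilation) embedding_exists: "\<exists>E. dilation_embedding J T V E"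
proof -
  let ?D = "defect T" and ?S = "defect_space T"
  define F where "F h = V (J h) - J (T h)" for h
  let ?R = "range (\<lambda>h. (?D h, F h))"
  have VJ: "inner (V (J g)) (J h) = inner (T g) h" for g h
    by (simp add: Js_V Js_J flip: inner_adj2[OF J])
  have F: "inner (F g) (F h) = inner (?D g) (?D h)" for g h
    using VJ[of g "T h"] VJ[of h "T g"]
    by (simp add: F_def inner_diff_left inner_diff_right inner_V inner_J inner_defect[OF contr] inner_commute)
  have hom: "c *\<^sub>C ?D h = ?D (c *\<^sub>C h)" "c *\<^sub>C F h = F (c *\<^sub>C h)" for c h
    by (simp_all add: F_def lin scaleC_diff_right bounded_op_scaleC[OF bounded_op_defect[OF contr]])
  obtain f where f: "\<And>x y. (x, y) \<in> ?R \<Longrightarrow> f x = y"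
    "bounded_op (closure (span (fst ` ?R))) (closure (span (snd ` ?R))) f"
    "\<And>x. x \<in> closure (span (fst ` ?R)) \<Longrightarrow> norm (f x) = norm x"
    by (rule isometric_extension[of ?R]) (auto simp: F hom)
  have "fst ` ?R = range ?D" by (auto simp: image_iff)
  moreover have "span (range ?D) = range ?D"
    by (intro span_eq_iff[THEN iffD2] csubspace_imp_subspace csubspace_defect_range contr)
  ultimately have S: "closure (span (fst ` ?R)) = ?S"
    by (simp only: defect_space_def)
  obtain p where p: "bounded_op UNIV UNIV p" "\<And>x. p x \<in> ?S" "\<And>x. x \<in> ?S \<Longrightarrow> p x = x"
    "\<And>x y. x \<in> ?S \<Longrightarrow> inner x (p y) = inner x y"
    using orthogonal_projection_exists[OF closed_defect_space[OF contr] csubspace_defect_space[OF contr]]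
    by blast
  define E where "E x = f (p x)" for x
  have norm_E: "norm (E x) = norm (p x)" for x
    using f(3)[of "p x"] p(2) by (simp add: E_def S)
  obtain C where C: "\<And>x. norm (p x) \<le> C * norm x"
    using p(1) by (auto simp: bounded_op_def)
  have E: "bounded_op UNIV UNIV E"
    using p(1,2) f(2) C by (auto simp: bounded_op_def S norm_E) (simp_all add: E_def)
  have E_iso: "inner (E x) (E y) = inner x y" if "x \<in> ?S" "y \<in> ?S" for x y
  proof -
    have "x + y \<in> ?S" using that csubspace_defect_space[OF contr] by (intro complex_vector.subspace_add)
    then have "norm (E x + E y) = norm (x + y)" "norm (E x) = norm x" "norm (E y) = norm y"
      using norm_E that p(3) by (simp_all flip: bounded_op_plus[OF E])
    then show ?thesis by (simp add: dot_norm)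
  qed
  have "adj_on UNIV E y \<in> ?S" for y
  proof -
    let ?e = "adj_on UNIV E y"
    let ?w = "?e - p ?e"
    have "p ?w = 0" using p(1-3) by (simp add: bounded_op_minus)
    then have "E ?w = 0" using norm_E[of ?w] by simp
    then have "inner ?w ?e = 0" by (simp flip: inner_adj[OF E])
    moreover have "inner (p ?e) ?w = 0"
      using p(4)[OF p(2)] by (simp add: inner_diff_right)
    ultimately have "inner ?w ?w = 0" by (simp add: inner_diff_right inner_commute)
    then show ?thesis using p(2)[of ?e] by simp
  qed
  moreover have "E (?D h) = F h" for h
    using f(1)[of "?D h" "F h"] p(3) defect_in_defect_space[OF contr] by (simp add: E_def)
  ultimately have "dilation_embedding J T V E"
    using E E_iso by unfold_locales (auto simp: F_def)
  then show ?thesis by blast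
qed

context dilation_embedding
begin

abbreviation "S \<equiv> defect_space T"
abbreviation "D \<equiv> defect T"
abbreviation "Es \<equiv> adj_on UNIV E"

lemmas D = bounded_op_defect[OF contr]
lemmas Es = bounded_op_adj[OF E]
lemmas elin = lin bounded_op_lin[OF D] bounded_op_lin[OF E] bounded_op_lin[OF Es]
lemmas S_sub = csubspace_defect_space[OF contr]
lemmas D_in = defect_in_defect_space[OF contr]

lemma Es_E: "d \<in> S \<Longrightarrow> Es (E d) = d"
proof -
  assume d: "d \<in> S"
  have "inner e (Es (E d)) = inner e d" if "e \<in> S" for e
    using E_isometric[OF that d] by (simp add: inner_adj[OF E])
  moreover have "Es (E d) - d \<in> S"
    using d Es_in S_sub by (intro complex_vector.subspace_diff)
  ultimately have "inner (Es (E d) - d) (Es (E d) - d) = 0"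
    by (simp add: inner_diff_right)
  then show ?thesis by simp
qed

lemma V_J: "V (J h) = J (T h) + E (D h)"
  by (simp add: E_defect)

lemma eq_on_S:
  assumes f: "bounded_op UNIV UNIV f" and g: "bounded_op UNIV UNIV g"
    and eq: "\<And>h. f (D h) = g (D h)" and "d \<in> S"
  shows "f d = g d"
proof (rule bounded_op_eq_on_closure[OF bounded_op_linear[OF f] bounded_op_linear[OF g]])
  show "d \<in> closure (range D)" using \<open>d \<in> S\<close> by (simp add: defect_space_def)
  show "f x = g x" if "x \<in> range D" for x using that eq by blast
qed

lemma bounded_op_const_zero: "bounded_op UNIV UNIV (\<lambda>x. 0)"
  by (simp add: bounded_op_UNIV_iff scaleC_zero_right)

lemma Js_E: "Js (E d) = 0"
proof -
  have *: "Js (E d) = 0" if "d \<in> S" for d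
  proof (rule eq_on_S[OF _ _ _ that])
    show "Js (E (D h)) = 0" for h
      by (simp add: E_defect lin Js_V Js_J)
  qed (rule bounded_op_compose[OF Js E], rule bounded_op_const_zero)
  have "Es (J h) = 0" for h
  proof -
    have "inner (Es (J h)) (Es (J h)) = inner (E (Es (J h))) (J h)"
      by (simp add: inner_adj[OF E])
    also have "\<dots> = inner (Js (E (Es (J h)))) h"
      by (simp add: inner_adj2[OF J])
    also have "\<dots> = 0" by (simp add: * Es_in)
    finally show ?thesis by simp
  qed
  then have "inner (Js (E d)) (Js (E d)) = 0"
    by (simp add: inner_adj2[OF J] inner_adj[OF E])
  then show ?thesis by simp
qed

lemma Es_J: "Es (J h) = 0"
proof -
  have "inner (Es (J h)) (Es (J h)) = inner h (Js (E (Es (J h))))"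
    by (simp add: inner_adj2[OF E] inner_adj[OF J])
  then show ?thesis by (simp add: Js_E)
qed

text \<open>
  \<open>V\<close> maps the orthogonal complement of the range of \<open>J\<close> into itself and away from the wandering subspace.
\<close>

lemma Es_V:
  assumes "Js y = 0"
  shows "Es (V y) = 0"
proof -
  have "inner (Es (V y)) (D h) = 0" for h
  proof -
    have "inner (V y) (J (T h)) = inner (Js (V y)) (T h)"
      by (simp add: inner_adj2[OF J])
    also have "\<dots> = 0"
      by (simp add: Js_V assms lin)
    finally have 1: "inner (V y) (J (T h)) = 0" .
    have "inner y (J h) = inner (Js y) h"
      by (simp add: inner_adj2[OF J])
    then have 2: "inner y (J h) = 0"
      using assms by simp
    show ?thesis
      by (simp add: inner_adj2[OF E] E_defect inner_diff_right inner_V 1 2)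
  qed
  moreover have "Es (V y) \<in> closure (range D)"
    using Es_in by (simp add: defect_space_def)
  ultimately have "inner (Es (V y)) (Es (V y)) = 0"
    using inner_zero_on_closure[of "range D" "Es (V y)" "Es (V y)"] by blast
  then show ?thesis by simp
qed

lemma Es_VE: "Es (V (E d)) = 0"
  by (intro Es_V Js_E)

lemma Js_VE: "Js (V (E d)) = 0"
  by (simp add: Js_V Js_E elin)

text \<open>
  \<open>J \<H>\<close> and the spaces \<open>V\<^sup>m E \<D>\<^sub>T\<close> span the whole space: expanding \<open>V J = J T + E D\<^sub>T\<close> repeatedly writes \<open>V\<^sup>m J h\<close>
  in terms of them.
\<close>

lemma orthogonal_zero:
  assumes "Js x = 0" "\<And>m e. e \<in> S \<Longrightarrow> inner x ((V ^^ m) (E e)) = 0"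
  shows "x = 0"
proof (rule orthogonal_dense_zero)
  show "inner x ((V ^^ m) (J h)) = 0" for m h
  proof (induction m arbitrary: h)
    case 0
    show ?case using assms(1) by (simp flip: inner_adj2[OF J])
  next
    case (Suc m)
    have "(V ^^ Suc m) (J h) = (V ^^ m) (V (J h))"
      by (simp add: funpow_swap1)
    then show ?case
      using Suc assms(2)[OF D_in] by (simp add: V_J bounded_op_plus[OF Vpow_bounded] inner_add_right)
  qed
qed

text \<open>
  The wandering property: applying \<open>E\<^sup>*\<close> reads off the lowest coefficient, and then one factor \<open>V\<close> can be
  cancelled.  Degree two suffices for products of two linear polynomials in \<open>V\<close>.
\<close>

lemma coefficients_unique:
  assumes "a0 \<in> S" "a1 \<in> S" "a2 \<in> S" "b0 \<in> S" "b1 \<in> S" "b2 \<in> S"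
    and eq: "E a0 + V (E a1 + V (E a2)) = E b0 + V (E b1 + V (E b2))"
  shows "a0 = b0 \<and> a1 = b1 \<and> a2 = b2"
proof -
  have *: "Es (E c0 + V (E c1 + V (E c2))) = c0" if "c0 \<in> S" for c0 c1 c2
    using that Es_V[of "E c1 + V (E c2)"] by (simp add: elin Es_E Js_E Js_VE)
  have 0: "a0 = b0" using * assms by metis
  then have e1: "E a1 + V (E a2) = E b1 + V (E b2)"
    using eq V_inject by auto
  moreover have **: "Es (E c1 + V (E c2)) = c1" if "c1 \<in> S" for c1 c2
    using that by (simp add: elin Es_E Es_VE)
  ultimately have 1: "a1 = b1" using assms by metis
  then have "E a2 = E b2" using e1 V_inject by auto
  then have "a2 = b2" using Es_E assms by metis
  then show ?thesis using 0 1 by simp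
qed

lemma coefficients_unique1:
  assumes "a0 \<in> S" "a1 \<in> S" "b0 \<in> S" "b1 \<in> S" "E a0 + V (E a1) = E b0 + V (E b1)"
  shows "a0 = b0 \<and> a1 = b1"
  using coefficients_unique[of a0 a1 0 b0 b1 0] assms S_sub
  by (simp add: elin complex_vector.subspace_0)

end

section \<open>Unitaries and projections on a closed subspace\<close>

lemma unitary_op_on:
  assumes S: "closed S" "complex_vector.subspace S" and U: "unitary_op S S U"
  shows unitary_in: "x \<in> S \<Longrightarrow> U x \<in> S"
    and unitary_adj_in: "adj_on S U x \<in> S"
    and unitary_adj_left: "x \<in> S \<Longrightarrow> adj_on S U (U x) = x"
    and unitary_adj_right: "x \<in> S \<Longrightarrow> U (adj_on S U x) = x"
    and unitary_plus: "x \<in> S \<Longrightarrow> y \<in> S \<Longrightarrow> U (x + y) = U x + U y"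
    and unitary_inner_adj: "x \<in> S \<Longrightarrow> inner (U x) y = inner x (adj_on S U y)"
    and unitary_adj_plus: "x \<in> S \<Longrightarrow> y \<in> S \<Longrightarrow> adj_on S U (x + y) = adj_on S U x + adj_on S U y"
    and unitary_adj_scaleC: "x \<in> S \<Longrightarrow> adj_on S U (c *\<^sub>C x) = c *\<^sub>C adj_on S U x"
proof -
  have b: "bounded_op S S U" and l: "\<And>x. x \<in> S \<Longrightarrow> adj_on S U (U x) = x"
    and r: "\<And>x. x \<in> S \<Longrightarrow> U (adj_on S U x) = x"
    using U by (auto simp: unitary_op_def)
  have i: "adj_on S U x \<in> S" for x by (rule adj_on_in[OF S b])
  have p: "U (x + y) = U x + U y" if "x \<in> S" "y \<in> S" for x y
    using b that by (simp add: bounded_op_def)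
  have c: "U (c *\<^sub>C x) = c *\<^sub>C U x" if "x \<in> S" for c x
    using b that by (simp add: bounded_op_def)
  show "x \<in> S \<Longrightarrow> U x \<in> S" using b by (simp add: bounded_op_def)
  show "adj_on S U x \<in> S" by (rule i)
  show "x \<in> S \<Longrightarrow> adj_on S U (U x) = x" by (rule l)
  show "x \<in> S \<Longrightarrow> U (adj_on S U x) = x" by (rule r)
  show "x \<in> S \<Longrightarrow> y \<in> S \<Longrightarrow> U (x + y) = U x + U y" by (rule p)
  show "x \<in> S \<Longrightarrow> inner (U x) y = inner x (adj_on S U y)" by (rule inner_adj_on[OF S b])
  show "adj_on S U (x + y) = adj_on S U x + adj_on S U y" if "x \<in> S" "y \<in> S"
  proof -
    have "U (adj_on S U x + adj_on S U y) = x + y"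
      by (simp add: p i r that)
    moreover have "adj_on S U x + adj_on S U y \<in> S"
      by (intro complex_vector.subspace_add S i)
    ultimately show ?thesis using l by metis
  qed
  show "adj_on S U (c *\<^sub>C x) = c *\<^sub>C adj_on S U x" if "x \<in> S"
  proof -
    have "U (c *\<^sub>C adj_on S U x) = c *\<^sub>C x"
      by (simp add: c i r that)
    moreover have "c *\<^sub>C adj_on S U x \<in> S"
      by (intro complex_vector.subspace_scale S i)
    ultimately show ?thesis using l by metis
  qed
qed

lemma unitary_opI:
  assumes S: "complex_vector.subspace S" and b: "bounded_op S R U"
    and G: "\<And>y. y \<in> R \<Longrightarrow> G y \<in> S" and GU: "\<And>x. x \<in> S \<Longrightarrow> G (U x) = x" and UG: "\<And>y. y \<in> R \<Longrightarrow> U (G y) = y"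
    and inner: "\<And>x y. x \<in> S \<Longrightarrow> y \<in> R \<Longrightarrow> inner (U x) y = inner x (G y)"
  shows "unitary_op S R U" and "y \<in> R \<Longrightarrow> adj_on S U y = G y"
proof -
  have adj: "adj_on S U y = G y" if "y \<in> R" for y
    by (rule adj_on_eqI[OF S]) (use b G inner that in \<open>auto simp: bounded_op_def\<close>)
  then show "y \<in> R \<Longrightarrow> adj_on S U y = G y" .
  have "U x \<in> R" if "x \<in> S" for x using b that by (simp add: bounded_op_def)
  then show "unitary_op S R U"
    using b adj GU UG by (auto simp: unitary_op_def)
qed

lemma orth_projection_on:
  assumes S: "closed S" "complex_vector.subspace S" and P: "orth_projection S P"
  shows orth_projection_in: "x \<in> S \<Longrightarrow> P x \<in> S"
    and orth_projection_idem: "x \<in> S \<Longrightarrow> P (P x) = P x"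
    and orth_projection_plus: "x \<in> S \<Longrightarrow> y \<in> S \<Longrightarrow> P (x + y) = P x + P y"
    and orth_projection_scaleC: "x \<in> S \<Longrightarrow> P (c *\<^sub>C x) = c *\<^sub>C P x"
    and orth_projection_sym: "x \<in> S \<Longrightarrow> y \<in> S \<Longrightarrow> inner (P x) y = inner x (P y)"
proof -
  have b: "bounded_op S S P" using P by (simp add: orth_projection_def)
  show "x \<in> S \<Longrightarrow> P x \<in> S" "x \<in> S \<Longrightarrow> P (P x) = P x" 
    "x \<in> S \<Longrightarrow> y \<in> S \<Longrightarrow> P (x + y) = P x + P y" "x \<in> S \<Longrightarrow> P (c *\<^sub>C x) = c *\<^sub>C P x"
    using P by (simp_all add: orth_projection_def bounded_op_def)
  show "inner (P x) y = inner x (P y)" if "x \<in> S" "y \<in> S"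
    using inner_adj_on[OF S b that(1), of y] P that by (simp add: orth_projection_def)
qed

lemma bounded_op_restrict:
  "bounded_op UNIV UNIV f \<Longrightarrow> (\<And>x. x \<in> S \<Longrightarrow> f x \<in> S) \<Longrightarrow> bounded_op S S f"
  by (auto simp: bounded_op_def)

section \<open>Operators acting as linear polynomials in the shift\<close>

context dilation_embedding
begin

lemmas S_add = complex_vector.subspace_add[OF S_sub]
lemmas S_diff = complex_vector.subspace_diff[OF S_sub]
lemmas S_zero = complex_vector.subspace_0[OF S_sub]

text \<open>
  On the orthogonal complement \<open>\<Oplus> V\<^sup>m E \<D>\<^sub>T\<close> of the range of \<open>J\<close> the isometry \<open>V\<close> is a unilateral shift, that is,
  multiplication by \<open>z\<close> on \<open>H\<^sup>2(\<D>\<^sub>T)\<close>.  There \<open>symbol X a b\<close> means that \<open>X\<close> is multiplication by \<open>a + z b\<close>.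
\<close>

definition symbol :: "('k \<Rightarrow> 'k) \<Rightarrow> ('h \<Rightarrow> 'h) \<Rightarrow> ('h \<Rightarrow> 'h) \<Rightarrow> bool" where
  "symbol X a b \<longleftrightarrow> bounded_op UNIV UNIV X \<and> (\<forall>x. X (V x) = V (X x)) \<and>
     (\<forall>d\<in>S. a d \<in> S \<and> b d \<in> S \<and> X (E d) = E (a d) + V (E (b d)))"

lemma symbol_unique:
  assumes "symbol X a b" "symbol X a' b'" "d \<in> S"
  shows "a d = a' d \<and> b d = b' d"
proof (rule coefficients_unique1)
  show "E (a d) + V (E (b d)) = E (a' d) + V (E (b' d))"
    using assms unfolding symbol_def by metis
qed (use assms in \<open>auto simp: symbol_def\<close>)

lemma symbol_compose:
  assumes X: "symbol X a b" and Y: "symbol Y a' b'" and d: "d \<in> S"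
  shows "X (Y (E d)) = E (a (a' d)) + V (E (b (a' d) + a (b' d)) + V (E (b (b' d))))"
proof -
  have bX: "bounded_op UNIV UNIV X" using X by (simp add: symbol_def)
  have "Y (E d) = E (a' d) + V (E (b' d))" "a' d \<in> S" "b' d \<in> S"
    using Y d by (auto simp: symbol_def)
  then show ?thesis
    using X by (simp add: symbol_def bounded_op_plus[OF bX] elin add.assoc)
qed

lemma symbol_commute:
  assumes X: "symbol X a b" and Y: "symbol Y a' b'" and d: "d \<in> S"
    and comm: "X (Y (E d)) = Y (X (E d))"
  shows "a (a' d) = a' (a d)" "b (a' d) + a (b' d) = b' (a d) + a' (b d)" "b (b' d) = b' (b d)"
  using coefficients_unique[OF _ _ _ _ _ _
      comm[unfolded symbol_compose[OF X Y d] symbol_compose[OF Y X d]]] X Y d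
  by (auto simp: symbol_def S_add)

text \<open>
  If \<open>X X' = X' X = V\<close>, the symbol of \<open>X\<close> turns out to have the constant coefficient \<open>compr X\<close> and the linear
  coefficient \<open>compr_adj X'\<close>.
\<close>

definition compr :: "('k \<Rightarrow> 'k) \<Rightarrow> 'h \<Rightarrow> 'h" where
  "compr X d = Es (X (E d))"

definition compr_adj :: "('k \<Rightarrow> 'k) \<Rightarrow> 'h \<Rightarrow> 'h" where
  "compr_adj X d = Es (adj_on UNIV X (E d))"

lemma compr_in: "compr X d \<in> S" and compr_adj_in: "compr_adj X d \<in> S"
  by (simp_all add: compr_def compr_adj_def Es_in)

lemma bounded_op_compr: "bounded_op UNIV UNIV X \<Longrightarrow> bounded_op UNIV UNIV (compr X)"
  unfolding compr_def[abs_def] using bounded_op_compose[OF Es bounded_op_compose[OF _ E]] by auto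

lemma bounded_op_compr_adj: "bounded_op UNIV UNIV X \<Longrightarrow> bounded_op UNIV UNIV (compr_adj X)"
  using bounded_op_compr[OF bounded_op_adj] by (simp add: compr_def[abs_def] compr_adj_def[abs_def])

lemma inner_compr:
  assumes "bounded_op UNIV UNIV X"
  shows "inner (compr X d) e = inner d (compr_adj X e)"
  by (simp add: compr_def compr_adj_def inner_adj2[OF E] inner_adj[OF assms] inner_adj[OF E])

lemma Js_VpowE: "Js ((V ^^ m) (E d)) = 0"
  by (induction m) (simp_all add: Js_E Js_V elin)

lemma inner_E_V: "Js y = 0 \<Longrightarrow> inner (E d) (V y) = 0"
  by (simp add: inner_adj[OF E] Es_V)

lemma inner_J_right: "inner (J h) y = inner h (Js y)"
  by (rule inner_adj[OF J])

end

section \<open>Commuting isometries with product \<open>V\<close>\<close>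

text \<open>
  Commuting isometries \<open>X\<close> and \<open>X'\<close> with product \<open>V\<close> satisfy \<open>X\<^sup>* V = X'\<close>; this relation and its mirror image
  replace all computations with adjoints of \<open>X\<close> and \<open>X'\<close>.  The setting is symmetric in the two factors, and
  each statement about \<open>X\<close> is used for \<open>X'\<close> as well.
\<close>

locale factor_pair = dilation_embedding J T V E
  for J :: "'h::complex_hilbert \<Rightarrow> 'k::complex_hilbert" and T V E +
  fixes X X' :: "'k \<Rightarrow> 'k" and t t' :: "'h \<Rightarrow> 'h"
  assumes isoX: "isometry_op X" and isoX': "isometry_op X'"
    and XX': "X (X' x) = V x" and X'X: "X' (X x) = V x"
    and Js_X: "Js (X x) = t (Js x)" and Js_X': "Js (X' x) = t' (Js x)"
begin

lemma swapped: "factor_pair J T V E X' X t' t"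
  using isoX isoX' XX' X'X Js_X Js_X' by unfold_locales

lemmas X = isometry_op_bounded[OF isoX]
lemmas X' = isometry_op_bounded[OF isoX']
lemmas inner_X = isometry_op_inner[OF isoX]

abbreviation "A \<equiv> compr X"
abbreviation "B \<equiv> compr_adj X'"
abbreviation "A' \<equiv> compr X'"
abbreviation "B' \<equiv> compr_adj X"

lemmas A = bounded_op_compr[OF X] and B = bounded_op_compr_adj[OF X']
  and A' = bounded_op_compr[OF X'] and B' = bounded_op_compr_adj[OF X]
lemmas ablin = elin bounded_op_lin[OF X] bounded_op_lin[OF X'] bounded_op_lin[OF A]
  bounded_op_lin[OF B] bounded_op_lin[OF A'] bounded_op_lin[OF B']

lemma t_zero: "t 0 = 0"
  using Js_X[of 0] by (simp add: ablin)

lemma X_V: "X (V x) = V (X x)"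
  by (metis XX' X'X)

lemma inner_X_V: "inner (X x) (V y) = inner x (X' y)"
  by (metis XX' inner_X)

lemma inner_B: "inner (E d) (X' (E e)) = inner (B d) e"
  by (simp add: compr_adj_def inner_adj2[OF E] inner_adj2[OF X'])

lemma Js_X'_zero: "Js w = 0 \<Longrightarrow> Js (X' w) = 0"
  using factor_pair.t_zero[OF swapped] by (simp add: Js_X')

text \<open>
  \<open>X E d\<close> is orthogonal to \<open>J \<H>\<close> and, as \<open>X\<^sup>* V\<^sup>m = X' V\<^sup>m\<^sup>-\<^sup>1\<close> maps \<open>E \<D>\<^sub>T\<close> for \<open>m \<ge> 2\<close> into \<open>V\<close> of the kernel
  of \<open>J\<^sup>*\<close>, which is orthogonal to \<open>E \<D>\<^sub>T\<close>, it has no coefficient of degree above one.  The two remaining coefficients are compressions of \<open>X\<close> and of \<open>X'\<^sup>*\<close>.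
\<close>

lemma X_E: "X (E d) = E (A d) + V (E (B d))"
proof -
  let ?x = "X (E d) - E (A d) - V (E (B d))"
  have "?x = 0"
  proof (rule orthogonal_zero)
    show "Js ?x = 0"
      by (simp add: ablin Js_X Js_E Js_VE t_zero)
    fix m e assume e: "e \<in> S"
    consider "m = 0" | "m = 1" | l where "m = Suc (Suc l)"
      by (metis One_nat_def not0_implies_Suc)
    then show "inner ?x ((V ^^ m) (E e)) = 0"
    proof cases
      case 1
      have "inner (X (E d)) (E e) = inner (E (A d)) (E e)"
        using e by (simp add: E_isometric compr_in) (simp add: compr_def inner_adj2[OF E])
      moreover have "inner (V (E (B d))) (E e) = 0"
        using inner_E_V[OF Js_E] by (metis inner_commute)
      ultimately show ?thesis by (simp add: 1 inner_diff_left)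
    next
      case 2
      have "inner (E (A d)) (V (E e)) = 0" by (intro inner_E_V Js_E)
      then show ?thesis
        using e by (simp add: 2 inner_diff_left inner_V inner_X_V inner_B E_isometric compr_adj_in)
    next
      case (3 l)
      let ?w = "(V ^^ l) (E e)"
      have w: "Js ?w = 0" "Js (V ?w) = 0" by (simp_all add: Js_VpowE Js_V elin)
      have "X' (V ?w) = V (X' ?w)" by (rule factor_pair.X_V[OF swapped])
      then have "inner (X (E d)) (V (V ?w)) = 0"
        by (simp add: inner_X_V inner_E_V Js_X'_zero w)
      then show ?thesis
        by (simp add: 3 inner_diff_left inner_V inner_E_V w)
    qed
  qed
  then show ?thesis by (simp add: algebra_simps)
qed

text \<open>
  Beyond \<open>J t h\<close>, only the wandering subspace contributes to \<open>X J h\<close>: its inner product with \<open>V y\<close> is that of \<open>J h\<close>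
  with \<open>X' y\<close>, which is \<open>0\<close> for \<open>y\<close> orthogonal to the range of \<open>J\<close>.  The contribution is found by shifting with \<open>V\<close> and using \<open>V J = J T + E D\<^sub>T\<close>.
\<close>

lemma X_J: "X (J h) = J (t h) + E (B (D h))"
proof -
  let ?x = "X (J h) - J (t h) - E (B (D h))"
  have "?x = 0"
  proof (rule orthogonal_zero)
    show "Js ?x = 0"
      by (simp add: ablin Js_X Js_E Js_J)
    fix m e assume e: "e \<in> S"
    show "inner ?x ((V ^^ m) (E e)) = 0"
    proof (cases m)
      case 0
      have "inner (X (J h)) (E e) = inner (X (V (J h))) (V (E e))"
        by (simp add: X_V inner_V)
      also have "\<dots> = inner (V (J h)) (X' (E e))"
        by (rule inner_X_V)
      also have "\<dots> = inner (B (D h)) e"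
        by (simp add: V_J inner_add_left inner_J_right Js_X'_zero Js_E inner_B)
      finally show ?thesis
        using e by (simp add: 0 inner_diff_left inner_J_right Js_E E_isometric compr_adj_in)
    next
      case (Suc l)
      let ?w = "(V ^^ l) (E e)"
      have w: "Js ?w = 0" "Js (V ?w) = 0" by (simp_all add: Js_VpowE Js_V elin)
      show ?thesis
        by (simp add: Suc inner_diff_left inner_J_right inner_X_V inner_E_V w Js_X'_zero)
    qed
  qed
  then show ?thesis by (simp add: algebra_simps)
qed

lemma symbol_X: "symbol X A B"
  by (auto simp: symbol_def X X_V compr_in compr_adj_in X_E)

text \<open>
  Comparison of coefficients in \<open>(A' + z B') (A + z B) = z\<close>, which expresses \<open>X' X = V\<close>.  Together with the
  relations for \<open>X X' = V\<close> and the adjoint pairs \<open>A, B'\<close> and \<open>A', B\<close>, this gives the unitary and the projection.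
\<close>

lemma relations:
  assumes "d \<in> S"
  shows "A' (A d) = 0" "B' (A d) + A' (B d) = d" "B' (B d) = 0"
proof -
  have "X' (X (E d)) = E 0 + V (E d + V (E 0))"
    by (simp add: X'X elin)
  then have "E (A' (A d)) + V (E (B' (A d) + A' (B d)) + V (E (B' (B d)))) = E 0 + V (E d + V (E 0))"
    by (simp add: symbol_compose[OF factor_pair.symbol_X[OF swapped] symbol_X assms])
  from coefficients_unique[OF _ _ _ _ _ _ this]
  show "A' (A d) = 0" "B' (A d) + A' (B d) = d" "B' (B d) = 0"
    using assms by (auto simp: compr_in compr_adj_in S_zero S_add)
qed

lemmas relations' = factor_pair.relations[OF swapped]

text \<open>
  The symbol of \<open>X\<close> factors as \<open>A + z B = (P\<^sup>\<bottom> + z P) U\<^sup>*\<close>; its value at \<open>z = 1\<close> is the unitary \<open>U\<^sup>* = A + B\<close>, and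
  \<open>B = P U\<^sup>*\<close> gives \<open>P = B B\<^sup>*\<close> with \<open>B\<^sup>* = A'\<close>.
\<close>

definition U :: "'h \<Rightarrow> 'h" where "U d = A' d + B' d"
definition P :: "'h \<Rightarrow> 'h" where "P d = B (A' d)"

lemma unitary_U: "unitary_op S S U" and adj_U: "d \<in> S \<Longrightarrow> adj_on S U d = A d + B d"
proof -
  have b: "bounded_op S S U"
    unfolding U_def[abs_def]
    by (rule bounded_op_restrict[OF bounded_op_add[OF A' B']]) (intro S_add compr_in compr_adj_in)
  have 1: "A d + B d \<in> S" for d
    by (intro S_add compr_in compr_adj_in)
  have 2: "A (U d) + B (U d) = d" if "d \<in> S" for d
    using relations'[OF that] by (simp add: U_def ablin algebra_simps)
  have 3: "U (A d + B d) = d" if "d \<in> S" for d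
    using relations[OF that] by (simp add: U_def ablin algebra_simps)
  have 4: "inner (U d) e = inner d (A e + B e)" for d e
    using inner_compr[OF X', of d e] inner_compr[OF X, of e d]
    by (simp add: U_def inner_add_left inner_add_right inner_commute)
  show "unitary_op S S U"
    by (rule unitary_opI[OF S_sub b, of "\<lambda>d. A d + B d"]) (simp_all add: 1 2 3 4)
  show "d \<in> S \<Longrightarrow> adj_on S U d = A d + B d"
    by (rule unitary_opI[OF S_sub b, of "\<lambda>d. A d + B d"]) (simp_all add: 1 2 3 4)
qed

lemma orth_projection_P: "orth_projection S P"
proof -
  have b: "bounded_op S S P"
    unfolding P_def[abs_def]
    by (rule bounded_op_restrict[OF bounded_op_compose[OF B A']]) (rule compr_adj_in)
  have "P (P d) = P d" if "d \<in> S" for d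
  proof -
    have "A' (B (A' d)) = A' d - B' (A (A' d))"
      using relations(2)[OF compr_in, of X' d] by (simp add: algebra_simps)
    then show ?thesis
      using relations'[OF that] by (simp add: P_def ablin)
  qed
  moreover have "inner (P d) e = inner d (P e)" for d e
    using inner_compr[OF X', of d "A' e"] inner_compr[OF X', of e "A' d"]
    by (simp add: P_def inner_commute)
  then have "adj_on S P d = P d" if "d \<in> S" for d
    by (intro adj_on_eqI[OF S_sub]) (use b in \<open>auto simp: bounded_op_def that\<close>)
  ultimately show ?thesis
    using b by (simp add: orth_projection_def)
qed

lemma P_adj_U: "d \<in> S \<Longrightarrow> P (adj_on S U d) = B d"
proof -
  assume d: "d \<in> S"
  have "A' (B d) = d - B' (A d)" using relations(2)[OF d] by (simp add: algebra_simps)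
  then show "P (adj_on S U d) = B d"
    using relations[OF d] relations'(3)[OF compr_in, of X d] by (simp add: adj_U[OF d] P_def ablin)
qed

lemma perp_P_adj_U: "d \<in> S \<Longrightarrow> perp P (adj_on S U d) = A d"
  by (simp add: perp_def P_adj_U) (simp add: adj_U)

lemma U_P_adj_U: "d \<in> S \<Longrightarrow> U (P (adj_on S U d)) = A' (B d)"
  by (simp add: P_adj_U U_def relations)

lemma U_P: "d \<in> S \<Longrightarrow> U (P d) = A' d"
proof -
  assume d: "d \<in> S"
  have "A' (B (A' d)) = A' d - B' (A (A' d))"
    using relations(2)[OF compr_in, of X' d] by (simp add: algebra_simps)
  then show "U (P d) = A' d"
    using relations'[OF d] relations(3)[OF compr_in, of X' d] by (simp add: P_def U_def ablin)
qed

text \<open>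
  The components of \<open>X V J h = V X J h\<close> in the wandering subspace.
\<close>

lemma defect_intertwine: "D (t h) = A (D h) + B (D (T h))"
proof -
  have "X (V (J h)) = J (t (T h)) + E (B (D (T h))) + (E (A (D h)) + V (E (B (D h))))"
    by (simp add: V_J ablin X_J X_E)
  moreover have "X (V (J h)) = J (T (t h)) + E (D (t h)) + V (E (B (D h)))"
    by (subst X_V) (simp add: X_J ablin V_J)
  ultimately have "Es (J (t (T h)) + E (B (D (T h))) + (E (A (D h)) + V (E (B (D h)))))
      = Es (J (T (t h)) + E (D (t h)) + V (E (B (D h))))"
    by metis
  then show ?thesis
    by (simp add: elin Es_J Es_E Es_VE compr_in compr_adj_in D_in add.commute)
qed

text \<open>
  \<open>X J h = J t h + E B D h\<close> is an orthogonal decomposition and \<open>X J\<close> is isometric, so \<open>\<parallel>B D h\<parallel>\<^sup>2 = \<parallel>h\<parallel>\<^sup>2 - \<parallel>t h\<parallel>\<^sup>2\<close>;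
  moreover \<open>U P U\<^sup>* = A' B = B\<^sup>* B\<close>.
\<close>

lemma defect_factor:
  assumes t: "contraction_op t"
  shows "D (U (P (adj_on S U (D h)))) = defect t (defect t h)"
proof -
  have "inner (D (U (P (adj_on S U (D h))))) g = inner (defect t (defect t h)) g" for g
  proof -
    have "inner (D (U (P (adj_on S U (D h))))) g = inner (A' (B (D h))) (D g)"
      by (simp add: defect_sym[OF contr] U_P_adj_U D_in)
    also have "\<dots> = inner (B (D h)) (B (D g))"
      by (rule inner_compr[OF X'])
    also have "\<dots> = inner h g - inner (t h) (t g)"
    proof -
      have "inner h g = inner (X (J h)) (X (J g))" by (simp add: inner_X inner_J)
      also have "\<dots> = inner (t h) (t g) + inner (B (D h)) (B (D g))"
        by (simp add: X_J inner_add_left inner_add_right inner_J_right Js_J Js_E E_isometric compr_adj_in)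
           (simp add: inner_commute[of _ "J _"] inner_J_right Js_E)
      finally show ?thesis by simp
    qed
    also have "\<dots> = inner (defect t (defect t h)) g"
      by (simp only: defect_sym[OF t, of "defect t h"] inner_defect[OF t])
    finally show ?thesis .
  qed
  then have "inner (D (U (P (adj_on S U (D h)))) - defect t (defect t h))
      (D (U (P (adj_on S U (D h)))) - defect t (defect t h)) = 0"
    by (simp add: inner_diff_left)
  then show ?thesis by simp
qed

end

section \<open>Products of linear symbols\<close>

lemma inner_ext_on:
  assumes "complex_vector.subspace S" "x \<in> S" "y \<in> S" "\<And>z. z \<in> S \<Longrightarrow> inner x z = inner y z"
  shows "x = y"
proof -
  have "x - y \<in> S" using assms by (intro complex_vector.subspace_diff)
  then have "inner (x - y) (x - y) = 0" using assms(4) by (simp add: inner_diff_left)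
  then show ?thesis by simp
qed

locale unitary_projection_tuple =
  fixes S :: "'h::complex_hilbert set" and n :: nat and U P :: "nat \<Rightarrow> 'h \<Rightarrow> 'h"
  assumes closedS: "closed S" and subS: "complex_vector.subspace S"
    and proj: "\<And>i. i \<in> {1..n} \<Longrightarrow> orth_projection S (P i)"
    and unit: "\<And>i. i \<in> {1..n} \<Longrightarrow> unitary_op S S (U i)"
begin

abbreviation "Ua \<equiv> \<lambda>i. adj_on S (U i)"

lemmas sub_diff = complex_vector.subspace_diff[OF subS]

lemmas U_in = unitary_in[OF closedS subS unit]
  and Ua_in = unitary_adj_in[OF closedS subS unit]
  and Ua_U = unitary_adj_left[OF closedS subS unit]
  and U_Ua = unitary_adj_right[OF closedS subS unit]
  and inner_U = unitary_inner_adj[OF closedS subS unit]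
  and U_plus = unitary_plus[OF closedS subS unit]
  and Ua_plus = unitary_adj_plus[OF closedS subS unit]
  and Ua_scaleC = unitary_adj_scaleC[OF closedS subS unit]
  and P_in = orth_projection_in[OF closedS subS proj]
  and P_idem = orth_projection_idem[OF closedS subS proj]
  and P_plus = orth_projection_plus[OF closedS subS proj]
  and P_scaleC = orth_projection_scaleC[OF closedS subS proj]
  and P_sym = orth_projection_sym[OF closedS subS proj]

lemma perp_P_in: "i \<in> {1..n} \<Longrightarrow> x \<in> S \<Longrightarrow> perp (P i) x \<in> S"
  by (simp add: perp_def sub_diff P_in)

text \<open>
  With \<open>R\<^sub>k = U\<^sub>1\<^sup>* \<cdots> U\<^sub>k\<^sub>-\<^sub>1\<^sup>*\<close>, its inverse \<open>Ri\<close> and the projections \<open>Q\<^sub>k = R\<^sub>k P\<^sub>k R\<^sub>k\<^sup>*\<close>, the product of the linear symbols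
  \<open>(P\<^sub>i\<^sup>\<bottom> + z P\<^sub>i) U\<^sub>i\<^sup>*\<close> over \<open>i < k\<close> is the product of the factors \<open>Q\<^sub>i\<^sup>\<bottom> + z Q\<^sub>i\<close> followed by \<open>R\<^sub>k\<close> on the right.  The
  completeness condition on the projections says that the \<open>Q\<^sub>i\<close> sum to the identity.
\<close>

definition R :: "nat \<Rightarrow> 'h \<Rightarrow> 'h" where "R k = foldr Ua [1..<k]"
definition Ri :: "nat \<Rightarrow> 'h \<Rightarrow> 'h" where "Ri k = fold U [1..<k]"
definition Q :: "nat \<Rightarrow> 'h \<Rightarrow> 'h" where "Q k x = R k (P k (Ri k x))"
definition F :: "nat \<Rightarrow> 'h \<Rightarrow> 'h" where "F k x = (\<Sum>i = 1..<k. Q i x)"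

lemma R_Suc: "1 \<le> k \<Longrightarrow> R (Suc k) x = R k (Ua k x)"
  by (simp add: R_def)

lemma Ri_Suc: "1 \<le> k \<Longrightarrow> Ri (Suc k) x = U k (Ri k x)"
  by (simp add: Ri_def)

lemma F_Suc: "1 \<le> k \<Longrightarrow> F (Suc k) x = F k x + Q k x"
  by (simp add: F_def)

lemma R_1: "R (Suc 0) x = x" and Ri_1: "Ri (Suc 0) x = x" and F_1: "F (Suc 0) x = 0"
  by (simp_all add: R_def Ri_def F_def)

lemma R_Ri_props:
  assumes "1 \<le> k" "k \<le> Suc n"
  shows "\<forall>x\<in>S. R k x \<in> S \<and> Ri k x \<in> S \<and> Ri k (R k x) = x \<and> R k (Ri k x) = x"
    and "\<forall>x\<in>S. \<forall>y\<in>S. R k (x + y) = R k x + R k y \<and> Ri k (x + y) = Ri k x + Ri k y \<and>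
       inner (R k x) y = inner x (Ri k y)"
  unfolding atomize_conj
  using assms
proof (induction k rule: nat_induct_at_least)
  case base
  show ?case by (simp add: R_1 Ri_1)
next
  case (Suc k)
  then have k: "k \<in> {1..n}" "1 \<le> k" by auto
  have IH: "\<forall>x\<in>S. R k x \<in> S \<and> Ri k x \<in> S \<and> Ri k (R k x) = x \<and> R k (Ri k x) = x"
    "\<forall>x\<in>S. \<forall>y\<in>S. R k (x + y) = R k x + R k y \<and> Ri k (x + y) = Ri k x + Ri k y \<and>
       inner (R k x) y = inner x (Ri k y)"
    using Suc by auto
  have "inner (Ua k x) (Ri k y) = inner x (U k (Ri k y))" if "x \<in> S" "y \<in> S" for x y
    using inner_U[OF k(1), of "Ri k y" x] IH(1) that by (simp add: inner_commute)
  then show ?case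
    using IH by (simp add: R_Suc[OF k(2)] Ri_Suc[OF k(2)] U_in[OF k(1)] Ua_in[OF k(1)] Ua_U[OF k(1)]
        U_Ua[OF k(1)] U_plus[OF k(1)] Ua_plus[OF k(1)])
qed

lemma R_in: "1 \<le> k \<Longrightarrow> k \<le> Suc n \<Longrightarrow> x \<in> S \<Longrightarrow> R k x \<in> S"
  and Ri_in: "1 \<le> k \<Longrightarrow> k \<le> Suc n \<Longrightarrow> x \<in> S \<Longrightarrow> Ri k x \<in> S"
  and Ri_R: "1 \<le> k \<Longrightarrow> k \<le> Suc n \<Longrightarrow> x \<in> S \<Longrightarrow> Ri k (R k x) = x"
  and R_Ri: "1 \<le> k \<Longrightarrow> k \<le> Suc n \<Longrightarrow> x \<in> S \<Longrightarrow> R k (Ri k x) = x"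
  and R_plus: "1 \<le> k \<Longrightarrow> k \<le> Suc n \<Longrightarrow> x \<in> S \<Longrightarrow> y \<in> S \<Longrightarrow> R k (x + y) = R k x + R k y"
  and Ri_plus: "1 \<le> k \<Longrightarrow> k \<le> Suc n \<Longrightarrow> x \<in> S \<Longrightarrow> y \<in> S \<Longrightarrow> Ri k (x + y) = Ri k x + Ri k y"
  and inner_R: "1 \<le> k \<Longrightarrow> k \<le> Suc n \<Longrightarrow> x \<in> S \<Longrightarrow> y \<in> S \<Longrightarrow> inner (R k x) y = inner x (Ri k y)"
  using R_Ri_props by blast+

lemma minus_if_plus:
  fixes f :: "'h \<Rightarrow> 'h"
  assumes plus: "\<And>x y. x \<in> S \<Longrightarrow> y \<in> S \<Longrightarrow> f (x + y) = f x + f y" and "x \<in> S" "y \<in> S"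
  shows "f (x - y) = f x - f y"
  using plus[OF sub_diff[OF assms(2,3)] assms(3)] by (simp add: algebra_simps)

lemma Q_in: "i \<in> {1..n} \<Longrightarrow> x \<in> S \<Longrightarrow> Q i x \<in> S"
  by (simp add: Q_def R_in Ri_in P_in)

lemma Q_plus: "i \<in> {1..n} \<Longrightarrow> x \<in> S \<Longrightarrow> y \<in> S \<Longrightarrow> Q i (x + y) = Q i x + Q i y"
  by (simp add: Q_def R_in Ri_in P_in P_plus R_plus Ri_plus)

lemma Q_idem: "i \<in> {1..n} \<Longrightarrow> x \<in> S \<Longrightarrow> Q i (Q i x) = Q i x"
  by (simp add: Q_def Ri_R Ri_in P_in P_idem)

lemma Q_sym: 
  assumes "i \<in> {1..n}" "x \<in> S" "y \<in> S"
  shows "inner (Q i x) y = inner x (Q i y)"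
proof -
  have "inner (Q i x) y = inner (Ri i x) (P i (Ri i y))"
    using assms by (simp add: Q_def inner_R P_in Ri_in P_sym)
  also have "\<dots> = inner x (Q i y)"
    using assms inner_R[of i "P i (Ri i y)" x] by (simp add: Q_def P_in Ri_in inner_commute)
  finally show ?thesis .
qed

lemma F_in: "k \<le> Suc n \<Longrightarrow> x \<in> S \<Longrightarrow> F k x \<in> S"
  unfolding F_def by (intro complex_vector.subspace_sum[OF subS] Q_in) auto

lemma F_plus: "k \<le> Suc n \<Longrightarrow> x \<in> S \<Longrightarrow> y \<in> S \<Longrightarrow> F k (x + y) = F k x + F k y"
  unfolding F_def sum.distrib[symmetric] by (intro sum.cong refl Q_plus) auto

text \<open>
  Projections that sum to the identity are mutually orthogonal: for \<open>y\<close> in the range of \<open>Q\<^sub>k\<close> the squared norms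
  of all \<open>Q\<^sub>i y\<close> add up to \<open>\<parallel>y\<parallel>\<^sup>2 = \<parallel>Q\<^sub>k y\<parallel>\<^sup>2\<close>.
\<close>

lemma F_vanishes:
  assumes total: "\<And>x. x \<in> S \<Longrightarrow> F (Suc n) x = x" and k: "k \<in> {1..n}" and x: "x \<in> S"
  shows "F k (Q k x) = 0"
proof -
  let ?y = "Q k x"
  have y: "?y \<in> S" using k x by (rule Q_in)
  have sq: "inner (Q i ?y) (Q i ?y) = inner (Q i ?y) ?y" if "i \<in> {1..n}" for i
    using Q_sym[OF that Q_in[OF that y] y] Q_idem[OF that y] by simp
  have "inner ?y ?y = inner (F (Suc n) ?y) ?y" by (simp add: total y)
  also have "\<dots> = (\<Sum>i = 1..<Suc n. inner (Q i ?y) (Q i ?y))"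
    unfolding F_def inner_sum_left by (intro sum.cong refl sq[symmetric]) auto
  also have "\<dots> = inner (Q k ?y) (Q k ?y) + (\<Sum>i \<in> {1..<Suc n} - {k}. inner (Q i ?y) (Q i ?y))"
    using k by (intro sum.remove) auto
  finally have "(\<Sum>i \<in> {1..<Suc n} - {k}. inner (Q i ?y) (Q i ?y)) = 0"
    unfolding Q_idem[OF k x] by simp
  then have "\<forall>i \<in> {1..<Suc n} - {k}. inner (Q i ?y) (Q i ?y) = 0"
    by (subst (asm) sum_nonneg_eq_0_iff) auto
  then show ?thesis
    unfolding F_def using k by (intro sum.neutral) auto
qed

lemma op_prod_eq_Ri:
  assumes "commuting_on S n U" "x \<in> S"
  shows "op_prod n U x = Ri (Suc n) x"
proof -
  have "foldr U [1..<k] x = Ri k x \<and> (\<forall>j\<in>{1..n}. foldr U [1..<k] (U j x) = U j (foldr U [1..<k] x))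
      \<and> foldr U [1..<k] x \<in> S"
    if "1 \<le> k" "k \<le> Suc n" "x \<in> S" for k x
    using that
  proof (induction k arbitrary: x rule: nat_induct_at_least)
    case base
    show ?case using base.prems by (simp add: Ri_1)
  next
    case (Suc k)
    then have k: "k \<in> {1..n}" "k \<le> Suc n" by auto
    have Ukx: "U k x \<in> S" using k Suc.prems by (simp add: U_in)
    have 1: "foldr U [1..<Suc k] y = foldr U [1..<k] (U k y)" for y
      using k by simp
    have 2: "foldr U [1..<k] (U k x) = U k (foldr U [1..<k] x)"
      using Suc.IH[OF k(2) Suc.prems(2)] k(1) by blast
    have "foldr U [1..<k] (U k (U j x)) = U j (foldr U [1..<k] (U k x))" if j: "j \<in> {1..n}" for j
    proof -
      have "U k (U j x) = U j (U k x)"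
        using assms(1) j k Suc.prems unfolding commuting_on_def by blast
      then show ?thesis using Suc.IH[OF k(2) Ukx] j by simp
    qed
    moreover have "Ri k (U k x) \<in> S"
      by (rule Ri_in[OF Suc.hyps k(2) Ukx])
    ultimately show ?case
      using Suc.IH[OF k(2) Ukx] Suc.IH[OF k(2) Suc.prems(2)] k(1)
      unfolding 1 by (simp add: Ri_Suc 2 flip: One_nat_def)
  qed
  from this[of "Suc n" x] show ?thesis
    using assms(2) by (simp add: op_prod_def)
qed

end

locale symbol_tuple = dilation_embedding J T V E + unitary_projection_tuple "defect_space T" n U P
  for J :: "'h::complex_hilbert \<Rightarrow> 'k::complex_hilbert" and T V E n U P +
  fixes W :: "nat \<Rightarrow> 'k \<Rightarrow> 'k"
  assumes symbol_W: "\<And>i. i \<in> {1..n} \<Longrightarrow> symbol (W i) (\<lambda>d. perp (P i) (Ua i d)) (\<lambda>d. P i (Ua i d))"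
begin

text \<open>
  The vector \<open>F\<^sub>k R\<^sub>k P\<^sub>k U\<^sub>k\<^sup>* d\<close> is the obstruction to the product having degree one.  It is shown to vanish in two
  different ways: for given isometries because their partial products divide \<open>V\<close>, and for given projections
  because these are orthogonal.
\<close>

lemma product_compose:
  assumes k: "k \<in> {1..n}" and d: "d \<in> S"
    and IH: "symbol (foldr W [1..<k]) (\<lambda>d. R k d - F k (R k d)) (\<lambda>d. F k (R k d))"
  shows "foldr W [1..<Suc k] (E d) = E (R (Suc k) d - F (Suc k) (R (Suc k) d) + F k (R k (P k (Ua k d))))
      + V (E (F (Suc k) (R (Suc k) d) - 2 *\<^sub>R F k (R k (P k (Ua k d)))) + V (E (F k (R k (P k (Ua k d))))))"
proof -
  let ?u = "Ua k d"
  let ?b = "P k ?u" and ?a = "perp (P k) ?u"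
  have k': "1 \<le> k" "k \<le> Suc n" using k by auto
  have in_S: "?u \<in> S" "?b \<in> S" "?a \<in> S" "R k ?u \<in> S" "R k ?b \<in> S"
    using k k' d by (simp_all add: Ua_in P_in perp_P_in R_in)
  have Ra: "R k ?a = R k ?u - R k ?b"
    unfolding perp_def using R_plus[OF k'] in_S by (intro minus_if_plus) auto
  have Fa: "F k (R k ?u - R k ?b) = F k (R k ?u) - F k (R k ?b)"
    using F_plus[OF k'(2)] in_S by (simp add: minus_if_plus)
  have Qb: "Q k (R k ?u) = R k ?b"
    using in_S k' by (simp add: Q_def Ri_R)
  have "foldr W [1..<Suc k] (E d) = foldr W [1..<k] (W k (E d))"
    using k by simp
  also have "\<dots> = E (R k ?a - F k (R k ?a)) + V (E (F k (R k ?a) + (R k ?b - F k (R k ?b))) + V (E (F k (R k ?b))))"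
    by (rule symbol_compose[OF IH symbol_W[OF k] d])
  also have "R k ?a - F k (R k ?a) = R (Suc k) d - F (Suc k) (R (Suc k) d) + F k (R k ?b)"
    by (simp add: R_Suc[OF k'(1)] F_Suc[OF k'(1)] Ra Fa Qb)
  also have "F k (R k ?a) + (R k ?b - F k (R k ?b)) = F (Suc k) (R (Suc k) d) - 2 *\<^sub>R F k (R k ?b)"
    by (simp add: R_Suc[OF k'(1)] F_Suc[OF k'(1)] Ra Fa Qb scaleR_2)
  finally show ?thesis .
qed

lemma symbol_product:
  assumes "1 \<le> k" "k \<le> Suc n"
    and vanish: "\<And>j. j \<in> {1..n} \<Longrightarrow>
      symbol (foldr W [1..<j]) (\<lambda>d. R j d - F j (R j d)) (\<lambda>d. F j (R j d)) \<Longrightarrow>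
      \<forall>d\<in>S. F j (R j (P j (Ua j d))) = 0"
  shows "symbol (foldr W [1..<k]) (\<lambda>d. R k d - F k (R k d)) (\<lambda>d. F k (R k d))"
  using assms(1,2)
proof (induction k rule: nat_induct_at_least)
  case base
  show ?case
    by (auto simp: symbol_def R_1 F_1 S_zero elin bounded_op_UNIV_iff)
next
  case (Suc k)
  then have k: "k \<in> {1..n}" "1 \<le> k" "k \<le> Suc n" "Suc k \<le> Suc n" "1 \<le> Suc k" by auto
  have IH: "symbol (foldr W [1..<k]) (\<lambda>d. R k d - F k (R k d)) (\<lambda>d. F k (R k d))"
    using Suc by simp
  note v = vanish[OF k(1) IH]
  have split: "foldr W [1..<Suc k] = (\<lambda>x. foldr W [1..<k] (W k x))"
    using k by (simp add: fun_eq_iff)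
  have b: "bounded_op UNIV UNIV (foldr W [1..<Suc k])"
    unfolding split using IH symbol_W[OF k(1)] bounded_op_compose[of "foldr W [1..<k]" "W k"]
    by (simp add: symbol_def)
  have c: "foldr W [1..<Suc k] (V x) = V (foldr W [1..<Suc k] x)" for x
    unfolding split using IH symbol_W[OF k(1)] by (simp add: symbol_def)
  show ?case
    unfolding symbol_def
  proof (intro conjI allI ballI)
    fix d assume d: "d \<in> S"
    show "R (Suc k) d - F (Suc k) (R (Suc k) d) \<in> S" "F (Suc k) (R (Suc k) d) \<in> S"
      using d k by (simp_all add: S_diff F_in R_in)
    show "foldr W [1..<Suc k] (E d) = E (R (Suc k) d - F (Suc k) (R (Suc k) d)) + V (E (F (Suc k) (R (Suc k) d)))"
      unfolding product_compose[OF k(1) d IH] using v d by (simp add: elin)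
  qed (rule b, rule c)
qed

end

section \<open>From a dilation to projections and unitaries\<close>

locale dilation_tuple =
  fixes n :: nat and J :: "'h::complex_hilbert \<Rightarrow> 'k::complex_hilbert" and T V
  assumes contrT: "\<forall>i\<in>{1..n}. contraction_op (T i)"
    and commT: "commuting_on UNIV n T"
    and dilV: "isometric_dilation n J T V"
    and minV: "minimal_isometric_dilation1 J (op_prod n T) (op_prod n V)"
begin

lemma contr_prod: "contraction_op (op_prod n T)"
  unfolding op_prod_def using contrT by (intro contraction_op_foldr) auto

sublocale minimal_dilation J "op_prod n T" "op_prod n V"
  using contr_prod minV by unfold_locales

lemma isoV_i: "i \<in> {1..n} \<Longrightarrow> isometry_op (V i)" and commV: "commuting_on UNIV n V"
  using dilV by (auto simp: isometric_dilation_def)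

lemma Js_factor:
  assumes i: "i \<in> {1..n}"
  shows "Js (V i x) = T i (Js x)"
proof (rule Js_intertwine)
  show "bounded_op UNIV UNIV (V i)" using isoV_i[OF i] by (rule isometry_op_bounded)
  show "bounded_op UNIV UNIV (T i)" using contrT i by (simp add: contraction_op_iff)
  fix m h
  let ?k = "\<lambda>j. if j = i then Suc m else m"
  have "J (op_monomial n T ?k h) = proj_onto (range J) (op_monomial n V ?k (J h))"
    using dilV unfolding isometric_dilation_def by blast
  then have "J (T i ((op_prod n T ^^ m) h)) = J (Js (V i ((op_prod n V ^^ m) (J h))))"
    by (simp only: op_monomial_Suc_at[OF commT i] op_monomial_Suc_at[OF commV i] proj_onto_range[OF isoJ])
  then show "Js (V i ((op_prod n V ^^ m) (J h))) = T i ((op_prod n T ^^ m) h)"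
    by (metis Js_J)
qed

text \<open>
  Any partial product of the factors of \<open>V\<close> has the product of the remaining ones as its complementary factor.
  This is used for the single factors, and for the initial segments \<open>V\<^sub>1 \<cdots> V\<^sub>k\<close>.
\<close>

lemma factor_pair_lists:
  assumes lists: "mset (xs @ ys) = mset [1..<Suc n]"
    and emb: "dilation_embedding J (op_prod n T) (op_prod n V) E"
  shows "factor_pair J (op_prod n T) (op_prod n V) E (foldr V xs) (foldr V ys) (foldr T xs) (foldr T ys)"
proof -
  interpret dilation_embedding J "op_prod n T" "op_prod n V" E by (rule emb)
  have set: "set xs \<union> set ys = {1..n}"
    using mset_eq_setD[OF lists] by (simp only: set_append set_upt atLeastLessThanSuc_atLeastAtMost)
  have comm: "V i (V j x) = V j (V i x)" if "i \<in> set [1..<Suc n]" "j \<in> set [1..<Suc n]" for i j x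
    using that by (rule commuting_on_upt[OF commV]) simp
  have *: "foldr V zs = op_prod n V" if "mset zs = mset [1..<Suc n]" for zs
    unfolding op_prod_def using comm that by (rule foldr_mset_cong[symmetric, OF _ sym])
  have "foldr V xs (foldr V ys x) = op_prod n V x" for x
    using fun_cong[OF *[OF lists], of x] by simp
  moreover have "foldr V ys (foldr V xs x) = op_prod n V x" for x
    using fun_cong[OF *[of "ys @ xs"], of x] lists by (simp add: add.commute)
  moreover have "isometry_op (foldr V xs)" "isometry_op (foldr V ys)"
    by (rule isometry_op_foldr, rule isoV_i, use set in blast)+
  moreover have "Js (foldr V xs x) = foldr T xs (Js x)" "Js (foldr V ys x) = foldr T ys (Js x)" for x
    by (rule foldr_intertwine, rule Js_factor, use set in blast)+
  ultimately show ?thesis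
    by unfold_locales
qed

definition others :: "nat \<Rightarrow> nat list" where "others i = remove1 i [1..<Suc n]"

lemma factor_pair_single:
  assumes "dilation_embedding J (op_prod n T) (op_prod n V) E" and i: "i \<in> {1..n}"
  shows "factor_pair J (op_prod n T) (op_prod n V) E (V i) (foldr V (others i)) (T i) (foldr T (others i))"
proof -
  have "mset ([i] @ others i) = mset [1..<Suc n]"
    using i by (simp add: others_def del: upt_Suc)
  from factor_pair_lists[OF this assms(1)] show ?thesis
    by (simp add: comp_def)
qed

text \<open>
  The conditions are comparisons of coefficients: \<open>V\<^sub>i V\<^sub>j = V\<^sub>j V\<^sub>i\<close> yields the commutation relations, the
  action on \<open>J \<H>\<close> yields the two conditions with defect operators, and \<open>V\<^sub>1 \<cdots> V\<^sub>n = V\<close> yields that the unitaries multiply to \<open>I\<close>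
  and the rotated projections sum to \<open>I\<close>.
\<close>

lemma exists_data: "\<exists>P U. dilation_data n T P U"
proof -
  obtain E where emb: "dilation_embedding J (op_prod n T) (op_prod n V) E"
    using embedding_exists by blast
  then interpret emb: dilation_embedding J "op_prod n T" "op_prod n V" E .
  let ?S = "defect_space (op_prod n T)"
  define U where "U i d = emb.compr (foldr V (others i)) d + emb.compr_adj (V i) d" for i d
  define P where "P i d = emb.compr_adj (foldr V (others i)) (emb.compr (foldr V (others i)) d)" for i d
  note fp = factor_pair_single[OF emb]
  have U_eq: "U i = factor_pair.U E (V i) (foldr V (others i))"
    and P_eq: "P i = factor_pair.P E (foldr V (others i))" if "i \<in> {1..n}" for i
    unfolding U_def[abs_def] P_def[abs_def]
    using factor_pair.U_def[OF fp[OF that]] factor_pair.P_def[OF fp[OF that]] by (auto simp: fun_eq_iff)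
  note U_P_eq = U_eq P_eq
  have P: "orth_projection ?S (P i)" and U: "unitary_op ?S ?S (U i)" if "i \<in> {1..n}" for i
    using factor_pair.orth_projection_P[OF fp[OF that]] factor_pair.unitary_U[OF fp[OF that]]
    by (simp_all add: U_P_eq[OF that])
  have A: "perp (P i) (adj_on ?S (U i) d) = emb.compr (V i) d"
    and B: "P i (adj_on ?S (U i) d) = emb.compr_adj (foldr V (others i)) d"
    if "i \<in> {1..n}" "d \<in> ?S" for i d
    using factor_pair.perp_P_adj_U[OF fp[OF that(1)] that(2)] factor_pair.P_adj_U[OF fp[OF that(1)] that(2)]
    by (simp_all add: U_P_eq[OF that(1)])
  have UP: "U i (P i d) = emb.compr (foldr V (others i)) d" if "i \<in> {1..n}" "d \<in> ?S" for i d
    using factor_pair.U_P[OF fp[OF that(1)] that(2)] by (simp add: U_P_eq[OF that(1)])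
  have Ua: "adj_on ?S (U i) d = emb.compr (V i) d + emb.compr_adj (foldr V (others i)) d"
    if "i \<in> {1..n}" "d \<in> ?S" for i d
    using factor_pair.adj_U[OF fp[OF that(1)] that(2)] by (simp add: U_P_eq[OF that(1)])
  have sym: "emb.symbol (V i) (emb.compr (V i)) (emb.compr_adj (foldr V (others i)))" if "i \<in> {1..n}" for i
    using factor_pair.symbol_X[OF fp[OF that]] .
  have comm_sym: "emb.compr (V i) (emb.compr (V j) d) = emb.compr (V j) (emb.compr (V i) d)"
      "adj_on ?S (U i) (adj_on ?S (U j) d) = adj_on ?S (U j) (adj_on ?S (U i) d)"
      "emb.compr_adj (foldr V (others i)) (emb.compr_adj (foldr V (others j)) d)
         = emb.compr_adj (foldr V (others j)) (emb.compr_adj (foldr V (others i)) d)"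
    if i: "i \<in> {1..n}" and j: "j \<in> {1..n}" and d: "d \<in> ?S" for i j d
  proof -
    have "V i (V j (E d)) = V j (V i (E d))"
      using commV i j by (simp add: commuting_on_def)
    note c = emb.symbol_commute[OF sym[OF i] sym[OF j] d this]
    show "emb.compr (V i) (emb.compr (V j) d) = emb.compr (V j) (emb.compr (V i) d)"
      by (rule c(1))
    show "emb.compr_adj (foldr V (others i)) (emb.compr_adj (foldr V (others j)) d)
         = emb.compr_adj (foldr V (others j)) (emb.compr_adj (foldr V (others i)) d)"
      by (rule c(3))
    show "adj_on ?S (U i) (adj_on ?S (U j) d) = adj_on ?S (U j) (adj_on ?S (U i) d)"
    proof -
      have eq: "adj_on ?S (U i) (adj_on ?S (U j) d) =
          emb.compr (V i) (emb.compr (V j) d) + (emb.compr_adj (foldr V (others i)) (emb.compr (V j) d)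
          + emb.compr (V i) (emb.compr_adj (foldr V (others j)) d))
          + emb.compr_adj (foldr V (others i)) (emb.compr_adj (foldr V (others j)) d)"
        if i: "i \<in> {1..n}" and j: "j \<in> {1..n}" for i j
        unfolding Ua[OF j d] Ua[OF i emb.S_add[OF emb.compr_in emb.compr_adj_in]]
        by (simp add: bounded_op_plus[OF factor_pair.A[OF fp[OF i]]] bounded_op_plus[OF factor_pair.B[OF fp[OF i]]]
            algebra_simps)
      show ?thesis
        unfolding eq[OF i j] eq[OF j i] c ..
    qed
  qed
  interpret tup: symbol_tuple J "op_prod n T" "op_prod n V" E n U P V
  proof
    show "closed ?S" "complex_vector.subspace ?S"
      using closed_defect_space[OF contr_prod] csubspace_defect_space[OF contr_prod] by auto
    show "emb.symbol (V i) (\<lambda>d. perp (P i) (adj_on ?S (U i) d)) (\<lambda>d. P i (adj_on ?S (U i) d))"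
      if "i \<in> {1..n}" for i
      using sym[OF that] by (simp add: emb.symbol_def A[OF that] B[OF that])
  qed (fact P, fact U)
  have commU: "commuting_on ?S n U"
    unfolding commuting_on_def
  proof (intro ballI)
    fix i j d assume i: "i \<in> {1..n}" and j: "j \<in> {1..n}" and d: "d \<in> ?S"
    have in_S: "U i d \<in> ?S" "U j (U i d) \<in> ?S" using d by (simp_all add: tup.U_in[OF i] tup.U_in[OF j])
    have "tup.Ua j (tup.Ua i (U i (U j d))) = d"
      using d by (simp add: tup.Ua_U[OF i] tup.Ua_U[OF j] tup.U_in[OF j])
    moreover have "tup.Ua j (tup.Ua i (U j (U i d))) = d"
      using comm_sym(2)[OF j i in_S(2)] d by (simp add: tup.Ua_U[OF i] tup.Ua_U[OF j] tup.U_in[OF i])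
    ultimately show "U i (U j d) = U j (U i d)"
      by (metis tup.U_Ua[OF i] tup.U_Ua[OF j] tup.U_in[OF i] tup.U_in[OF j] tup.Ua_in[OF i] d)
  qed
  \<comment> \<open>Initial products have linear symbols, as they are factors of \<open>V\<close> themselves; this removes the obstruction.\<close>
  have prefix: "\<exists>a b. emb.symbol (foldr V [1..<k]) a b" if "1 \<le> k" "k \<le> Suc n" for k
  proof -
    have "[1..<k] @ [k..<Suc n] = [1..<Suc n]"
      using that upt_add_eq_append[of 1 k "Suc n - k"] by simp
    then show ?thesis
      using factor_pair.symbol_X[OF factor_pair_lists[OF _ emb, of "[1..<k]" "[k..<Suc n]"]] by metis
  qed
  have "emb.symbol (foldr V [1..<Suc n]) (\<lambda>d. tup.R (Suc n) d - tup.F (Suc n) (tup.R (Suc n) d))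
      (\<lambda>d. tup.F (Suc n) (tup.R (Suc n) d))"
  proof (rule tup.symbol_product)
    fix j assume j: "j \<in> {1..n}"
      and IH: "emb.symbol (foldr V [1..<j]) (\<lambda>d. tup.R j d - tup.F j (tup.R j d)) (\<lambda>d. tup.F j (tup.R j d))"
    obtain a b where ab: "emb.symbol (foldr V [1..<Suc j]) a b"
      using prefix[of "Suc j"] j by auto
    show "\<forall>d\<in>?S. tup.F j (tup.R j (P j (tup.Ua j d))) = 0"
    proof
      fix d assume d: "d \<in> ?S"
      let ?z = "tup.F j (tup.R j (P j (tup.Ua j d)))"
      have j': "1 \<le> j" "j \<le> Suc n" "1 \<le> Suc j" "Suc j \<le> Suc n" using j by auto
      have z: "?z \<in> ?S" using d by (intro tup.F_in[OF j'(2)] tup.R_in[OF j'(1,2)] tup.P_in[OF j] tup.Ua_in[OF j])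
      let ?r = "tup.R (Suc j) d"
      have r: "?r \<in> ?S" "tup.F (Suc j) ?r \<in> ?S"
        using tup.R_in[OF j'(3,4) d] tup.F_in[OF j'(4)] by blast+
      have in_S: "?r - tup.F (Suc j) ?r + ?z \<in> ?S"
        by (intro emb.S_add emb.S_diff r z)
      have in_S': "tup.F (Suc j) ?r - 2 *\<^sub>R ?z \<in> ?S"
        by (intro emb.S_diff r z subspace_scale[OF csubspace_imp_subspace[OF emb.S_sub]])
      have ab': "a d \<in> ?S" "b d \<in> ?S" "foldr V [1..<Suc j] (E d) = E (a d) + op_prod n V (E (b d) + op_prod n V (E 0))"
        using ab d by (simp_all add: emb.symbol_def emb.elin)
      show "?z = 0"
        using emb.coefficients_unique[OF in_S in_S' z ab'(1,2) emb.S_zero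
            trans[OF tup.product_compose[OF j d IH, symmetric] ab'(3)]] by blast
    qed
  qed auto
  moreover have "emb.symbol (foldr V [1..<Suc n]) (\<lambda>d. 0) (\<lambda>d. d)"
    unfolding op_prod_def[symmetric] by (simp add: emb.symbol_def V emb.S_zero emb.elin)
  ultimately have RF: "tup.R (Suc n) d - tup.F (Suc n) (tup.R (Suc n) d) = 0"
      "tup.F (Suc n) (tup.R (Suc n) d) = d" if "d \<in> ?S" for d
    using emb.symbol_unique that by blast+
  then have R: "tup.R (Suc n) d = d" and F: "tup.F (Suc n) d = d" if "d \<in> ?S" for d
    using that by auto
  have Ri: "tup.Ri (Suc n) d = d" if "d \<in> ?S" for d
    using tup.Ri_R[of "Suc n" d] R[OF that] that by simp
  have "dilation_data n T P U"
    unfolding dilation_data_def Let_def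
  proof (intro conjI ballI allI)
    show "orth_projection ?S (P i)" "unitary_op ?S ?S (U i)" if "i \<in> {1..n}" for i
      using P U that by auto
    show "commuting_on ?S n U" by (rule commU)
    show "op_prod n U x = x" if "x \<in> ?S" for x
      using tup.op_prod_eq_Ri[OF commU that] Ri[OF that] by simp
    show "defect (op_prod n T) (T i h) = perp (P i) (adj_on ?S (U i) (defect (op_prod n T) h))
        + P i (adj_on ?S (U i) (defect (op_prod n T) (op_prod n T h)))" if i: "i \<in> {1..n}" for i h
      using factor_pair.defect_intertwine[OF fp[OF i]] by (simp add: A[OF i] B[OF i] emb.D_in)
    fix i j x assume i: "i \<in> {1..n}" and j: "j \<in> {1..n}" and x: "x \<in> ?S"
    show "perp (P i) (adj_on ?S (U i) (perp (P j) (adj_on ?S (U j) x))) =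
        perp (P j) (adj_on ?S (U j) (perp (P i) (adj_on ?S (U i) x)))"
      using comm_sym(1)[OF i j x] by (simp add: A[OF i] A[OF j] x emb.compr_in)
    have XX: "bounded_op UNIV UNIV (foldr V (others i))" if "i \<in> {1..n}" for i
      using factor_pair.X'[OF fp[OF that]] .
    show "U i (P i (U j (P j x))) = U j (P j (U i (P i x)))"
    proof -
      have "inner (emb.compr (foldr V (others i)) (emb.compr (foldr V (others j)) x)) y
        = inner (emb.compr (foldr V (others j)) (emb.compr (foldr V (others i)) x)) y" if "y \<in> ?S" for y
        using comm_sym(3)[OF i j that] by (simp add: emb.inner_compr[OF XX[OF i]] emb.inner_compr[OF XX[OF j]])
      then show ?thesis
        using inner_ext_on[OF emb.S_sub emb.compr_in emb.compr_in] by (simp add: UP[OF i] UP[OF j] x emb.compr_in)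
    qed
  next
    show "defect (op_prod n T) (U i (P i (adj_on ?S (U i) (defect (op_prod n T) h)))) = defect (T i) (defect (T i) h)"
      if i: "i \<in> {1..n}" for i h
      using factor_pair.defect_factor[OF fp[OF i], of h] contrT i by (simp add: U_P_eq[OF i])
    show "(\<Sum>k = 1..n. foldr (\<lambda>i. adj_on ?S (U i)) [1..<k] (P k (fold U [1..<k] x))) = x" if "x \<in> ?S" for x
      using F[OF that] by (simp add: tup.F_def tup.Q_def tup.R_def tup.Ri_def atLeastLessThanSuc_atLeastAtMost)
  qed
  then show ?thesis by blast
qed

section \<open>Uniqueness and minimality of the dilation\<close>

text \<open>
  The right-hand side mentions the \<open>T\<^sub>i\<close> only.  For \<open>l > m\<close> one factor \<open>V = V\<^sub>i V\<^sub>i'\<close> of \<open>V\<^sup>l\<close> cancels against \<open>V\<^sub>i\<close>.  Hence the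
  factors of a dilation are determined by their product.
\<close>

lemma inner_factor_power:
  assumes i: "i \<in> {1..n}"
  shows "inner (V i ((op_prod n V ^^ m) (J h))) ((op_prod n V ^^ l) (J g)) =
    (if l \<le> m then inner (T i ((op_prod n T ^^ (m - l)) h)) g
     else inner h (foldr T (others i) ((op_prod n T ^^ (l - Suc m)) g)))"
proof -
  obtain E where emb: "dilation_embedding J (op_prod n T) (op_prod n V) E"
    using embedding_exists by blast
  interpret fp: factor_pair J "op_prod n T" "op_prod n V" E "V i" "foldr V (others i)" "T i" "foldr T (others i)"
    by (rule factor_pair_single[OF emb i])
  have Vm: "V i ((op_prod n V ^^ q) x) = (op_prod n V ^^ q) (V i x)" for q x
    by (induction q) (simp_all add: fp.X_V)
  show ?thesis
  proof (cases "l \<le> m")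
    case True
    then have "(op_prod n V ^^ m) (J h) = (op_prod n V ^^ l) ((op_prod n V ^^ (m - l)) (J h))"
      by (metis comp_apply funpow_add le_add_diff_inverse)
    then have "inner (V i ((op_prod n V ^^ m) (J h))) ((op_prod n V ^^ l) (J g))
        = inner (V i ((op_prod n V ^^ (m - l)) (J h))) (J g)"
      by (simp add: Vm inner_Vpow)
    also have "\<dots> = inner (Js (V i ((op_prod n V ^^ (m - l)) (J h)))) g"
      by (simp add: inner_adj2[OF J])
    also have "\<dots> = inner (T i ((op_prod n T ^^ (m - l)) h)) g"
      by (simp only: Js_factor[OF i] Js_Vpow_J)
    finally show ?thesis using True by simp
  next
    case False
    let ?p = "l - Suc m"
    have "l = m + Suc ?p" using False by simp
    then have "(op_prod n V ^^ l) (J g) = (op_prod n V ^^ m) (op_prod n V ((op_prod n V ^^ ?p) (J g)))"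
      by (metis comp_apply funpow_add funpow.simps(2))
    then have "inner (V i ((op_prod n V ^^ m) (J h))) ((op_prod n V ^^ l) (J g))
        = inner (V i (J h)) (op_prod n V ((op_prod n V ^^ ?p) (J g)))"
      by (simp add: Vm inner_Vpow)
    also have "\<dots> = inner h (Js (foldr V (others i) ((op_prod n V ^^ ?p) (J g))))"
      by (simp add: fp.inner_X_V inner_adj[OF J])
    also have "\<dots> = inner h (foldr T (others i) ((op_prod n T ^^ ?p) g))"
      by (simp only: fp.Js_X' Js_Vpow_J)
    finally show ?thesis using False by simp
  qed
qed

lemma minimal_tuple: "minimal_isometric_dilation n J T V"
proof -
  let ?A = "{(op_prod n V ^^ m) (J h) | m h. True}" and ?B = "{op_monomial n V k (J h) |k h. True}"
  have "?A \<subseteq> ?B"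
    unfolding op_monomial_const[OF commV, symmetric] by blast
  then have "span ?A \<subseteq> span ?B" by (rule span_mono)
  also have "span ?B \<subseteq> complex_vector.span ?B"
    by (intro span_minimal complex_vector.span_superset csubspace_imp_subspace complex_vector.subspace_span)
  finally have "closure (complex_vector.span ?B) = UNIV"
    using dense closure_mono by blast
  then show ?thesis
    using dilV by (simp add: minimal_isometric_dilation_def)
qed

end

lemma dilation_tuple_unique:
  assumes V: "dilation_tuple n J T V" and W: "dilation_tuple n J T W"
    and prod: "op_prod n V = op_prod n W" and i: "i \<in> {1..n}"
  shows "V i x = W i x"
proof -
  interpret V: dilation_tuple n J T V by (rule V)
  interpret W: dilation_tuple n J T W by (rule W)
  have others: "V.others i = W.others i"
    by (simp add: V.others_def W.others_def)
  show ?thesis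
  proof (rule V.bounded_ops_eqI[of "V i" "W i"])
    show "bounded_op UNIV UNIV (V i)" "bounded_op UNIV UNIV (W i)"
      using V.isoV_i[OF i] W.isoV_i[OF i] by (auto intro: isometry_op_bounded)
    fix m h
    have "V i ((op_prod n V ^^ m) (J h)) - W i ((op_prod n V ^^ m) (J h)) = 0"
    proof (rule V.orthogonal_dense_zero)
      fix l g
      show "inner (V i ((op_prod n V ^^ m) (J h)) - W i ((op_prod n V ^^ m) (J h))) ((op_prod n V ^^ l) (J g)) = 0"
        unfolding inner_diff_left V.inner_factor_power[OF i]
        unfolding prod W.inner_factor_power[OF i] by simp
    qed
    then show "V i ((op_prod n V ^^ m) (J h)) = W i ((op_prod n V ^^ m) (J h))" by simp
  qed
qed

text \<open>
  The unitary between the two minimal dilations of the product \<open>T\<close> sends \<open>W\<^sup>m J\<^sub>1 h\<close> to \<open>Y\<^sup>m J\<^sub>2 h\<close>.  It intertwines the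
  factors because \<open>W\<^sub>i\<close> and \<open>Y\<^sub>i\<close> have the same matrix entries between these vectors.
\<close>

lemma dilation_tuples_unitarily_equivalent:
  assumes W: "dilation_tuple n J1 T W" and Y: "dilation_tuple n J2 T Y"
  shows "\<exists>Ut. unitary_op UNIV UNIV Ut \<and> (\<forall>i\<in>{1..n}. \<forall>x. W i x = adj_on UNIV Ut (Y i (Ut x)))"
proof -
  interpret W: dilation_tuple n J1 T W by (rule W)
  interpret Y: dilation_tuple n J2 T Y by (rule Y)
  let ?W = "op_prod n W" and ?Y = "op_prod n Y"
  have gram: "inner ((?W ^^ m) (J1 h)) ((?W ^^ l) (J1 g)) = inner ((?Y ^^ m) (J2 h)) ((?Y ^^ l) (J2 g))" for m h l g
    by (simp only: W.inner_Vpow_J Y.inner_Vpow_J)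
  obtain f where f: "\<And>m h. f ((?W ^^ m) (J1 h)) = (?Y ^^ m) (J2 h)" and fi: "isometry_op f"
    using W.isometry_from_gram[of "\<lambda>m h. (?Y ^^ m) (J2 h)", OF Y.scaleC_Vpow_J gram[symmetric]] by blast
  obtain g where g: "\<And>m h. g ((?Y ^^ m) (J2 h)) = (?W ^^ m) (J1 h)" and gi: "isometry_op g"
    using Y.isometry_from_gram[of "\<lambda>m h. (?W ^^ m) (J1 h)", OF W.scaleC_Vpow_J gram] by blast
  have id: "bounded_op UNIV UNIV (\<lambda>x. x)" by (simp add: bounded_op_UNIV_iff)
  note fb = isometry_op_bounded[OF fi] and gb = isometry_op_bounded[OF gi]
  have gf: "g (f x) = x" for x
    by (rule W.bounded_ops_eqI[OF bounded_op_compose[OF gb fb] id]) (simp add: f g)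
  have fg: "f (g y) = y" for y
    by (rule Y.bounded_ops_eqI[OF bounded_op_compose[OF fb gb] id]) (simp add: f g)
  have inner_fg: "inner (f x) y = inner x (g y)" for x y
    by (metis isometry_op_inner[OF gi] gf)
  have unit: "unitary_op UNIV UNIV f" and adj: "adj_on UNIV f y = g y" for y
    by (rule unitary_opI[OF _ fb, of g]; simp add: gf fg inner_fg)+
  have "W i x = g (Y i (f x))" if i: "i \<in> {1..n}" for i x
  proof (rule W.bounded_ops_eqI[of "W i" "\<lambda>x. g (Y i (f x))"])
    have Wi: "bounded_op UNIV UNIV (W i)" and Yi: "bounded_op UNIV UNIV (Y i)"
      using W.isoV_i[OF i] Y.isoV_i[OF i] by (auto intro: isometry_op_bounded)
    then show "bounded_op UNIV UNIV (W i)" "bounded_op UNIV UNIV (\<lambda>x. g (Y i (f x)))"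
      using bounded_op_compose[OF gb bounded_op_compose[OF Yi fb]] by auto
    fix m h
    have "f (W i ((?W ^^ m) (J1 h))) - Y i ((?Y ^^ m) (J2 h)) = 0"
    proof (rule Y.orthogonal_dense_zero)
      fix l k
      have "inner (f (W i ((?W ^^ m) (J1 h)))) ((?Y ^^ l) (J2 k)) = inner (W i ((?W ^^ m) (J1 h))) ((?W ^^ l) (J1 k))"
        by (simp add: inner_fg g)
      also have "\<dots> = inner (Y i ((?Y ^^ m) (J2 h))) ((?Y ^^ l) (J2 k))"
        unfolding W.inner_factor_power[OF i] Y.inner_factor_power[OF i] W.others_def Y.others_def ..
      finally show "inner (f (W i ((?W ^^ m) (J1 h))) - Y i ((?Y ^^ m) (J2 h))) ((?Y ^^ l) (J2 k)) = 0"
        by (simp add: inner_diff_left)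
    qed
    then show "W i ((?W ^^ m) (J1 h)) = g (Y i (f ((?W ^^ m) (J1 h))))"
      by (simp add: f) (metis gf)
  qed
  then show ?thesis
    using unit adj by auto
qed

section \<open>From projections and unitaries to a dilation\<close>

lemma (in dilation_embedding) Es_V_eq: "Es (V y) = D (Js y)"
proof -
  have "V y = V (J (Js y)) + V (y - J (Js y))"
    by (simp flip: bounded_op_plus[OF V])
  moreover have "Es (V (y - J (Js y))) = 0"
    by (intro Es_V) (simp add: lin Js_J)
  ultimately show ?thesis
    by (simp add: elin V_J Es_J Es_E D_in)
qed

locale dilation_data_tuple = dilation_embedding J "op_prod n T" V E
  for J :: "'h::complex_hilbert \<Rightarrow> 'k::complex_hilbert" and n and T :: "nat \<Rightarrow> 'h \<Rightarrow> 'h" and V E +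
  fixes U P :: "nat \<Rightarrow> 'h \<Rightarrow> 'h"
  assumes contrT: "\<forall>i\<in>{1..n}. contraction_op (T i)"
    and commT: "commuting_on UNIV n T"
    and data: "dilation_data n T P U"
begin

lemma data_P: "i \<in> {1..n} \<Longrightarrow> orth_projection S (P i)"
  and data_U: "i \<in> {1..n} \<Longrightarrow> unitary_op S S (U i)"
  and data_comm: "commuting_on S n U"
  and data_prod: "x \<in> S \<Longrightarrow> op_prod n U x = x"
  using data unfolding dilation_data_def Let_def by blast+

sublocale unitary_projection_tuple "defect_space (op_prod n T)" n U P
  using closed_defect_space[OF contr] S_sub data_P data_U by unfold_locales

definition a :: "nat \<Rightarrow> 'h \<Rightarrow> 'h" where "a i d = perp (P i) (Ua i d)"
definition b :: "nat \<Rightarrow> 'h \<Rightarrow> 'h" where "b i d = P i (Ua i d)"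
text \<open>
  The value that the isometry \<open>W\<^sub>i\<close> below must take at \<open>J h\<close>.
\<close>

definition X :: "nat \<Rightarrow> 'h \<Rightarrow> 'k" where "X i h = J (T i h) + E (b i (D h))"

lemma data_defect: "i \<in> {1..n} \<Longrightarrow> D (T i h) = a i (D h) + b i (D (op_prod n T h))"
  and data_low: "i \<in> {1..n} \<Longrightarrow> j \<in> {1..n} \<Longrightarrow> x \<in> S \<Longrightarrow> a i (a j x) = a j (a i x)"
  and data_high: "i \<in> {1..n} \<Longrightarrow> j \<in> {1..n} \<Longrightarrow> x \<in> S \<Longrightarrow> U i (P i (U j (P j x))) = U j (P j (U i (P i x)))"
  and data_factor: "i \<in> {1..n} \<Longrightarrow> D (U i (b i (D h))) = defect (T i) (defect (T i) h)"
  and data_total: "x \<in> S \<Longrightarrow> (\<Sum>k = 1..n. foldr Ua [1..<k] (P k (fold U [1..<k] x))) = x"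
  using data unfolding dilation_data_def Let_def a_def b_def by blast+

lemma F_total: "x \<in> S \<Longrightarrow> F (Suc n) x = x"
  using data_total by (simp add: F_def Q_def R_def Ri_def atLeastLessThanSuc_atLeastAtMost)

context
  fixes i assumes i: "i \<in> {1..n}"
begin

lemma a_in: "x \<in> S \<Longrightarrow> a i x \<in> S" and b_in: "x \<in> S \<Longrightarrow> b i x \<in> S"
  by (simp_all only: a_def b_def perp_P_in[OF i] P_in[OF i] Ua_in[OF i])

lemma a_plus_b: "a i x + b i x = Ua i x"
  by (simp add: a_def b_def perp_def)

lemma b_plus: "x \<in> S \<Longrightarrow> y \<in> S \<Longrightarrow> b i (x + y) = b i x + b i y"
  by (simp only: b_def Ua_plus[OF i] P_plus[OF i] Ua_in[OF i])

lemma b_scaleC: "x \<in> S \<Longrightarrow> b i (c *\<^sub>C x) = c *\<^sub>C b i x"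
  by (simp only: b_def Ua_scaleC[OF i] P_scaleC[OF i] Ua_in[OF i])

lemma a_plus: "x \<in> S \<Longrightarrow> y \<in> S \<Longrightarrow> a i (x + y) = a i x + a i y"
  by (simp only: a_def perp_def Ua_plus[OF i] P_plus[OF i] Ua_in[OF i]) simp

lemma a_scaleC: "x \<in> S \<Longrightarrow> a i (c *\<^sub>C x) = c *\<^sub>C a i x"
  by (simp only: a_def perp_def Ua_scaleC[OF i] P_scaleC[OF i] Ua_in[OF i] scaleC_diff_right)

lemma inner_a_b: "x \<in> S \<Longrightarrow> y \<in> S \<Longrightarrow> inner (a i x) (b i y) = 0"
  using P_sym[OF i Ua_in[OF i] P_in[OF i Ua_in[OF i]], of x y] P_idem[OF i Ua_in[OF i], of y]
  by (simp add: a_def b_def perp_def inner_diff_left)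

lemma inner_b_b_Ua: "x \<in> S \<Longrightarrow> y \<in> S \<Longrightarrow> inner (b i x) (b i y) = inner (b i x) (Ua i y)"
  unfolding b_def using P_sym[OF i P_in[OF i Ua_in[OF i]] Ua_in[OF i], of x y] P_idem[OF i Ua_in[OF i], of x]
  by simp

lemma inner_b_defect: "inner (b i (D h)) (b i (D g)) = inner h g - inner (T i h) (T i g)"
proof -
  have t: "contraction_op (T i)" using contrT i by blast
  have "inner (b i (D h)) (b i (D g)) = inner (U i (b i (D h))) (D g)"
    using inner_U[OF i b_in[OF D_in], of h "D g"] by (simp add: inner_b_b_Ua D_in)
  also have "\<dots> = inner (D (U i (b i (D h)))) g"
    by (simp only: defect_sym[OF contr])
  also have "\<dots> = inner h g - inner (T i h) (T i g)"
    by (simp only: data_factor[OF i] defect_sym[OF t, of "defect (T i) h"] inner_defect[OF t])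
  finally show ?thesis .
qed

lemma bT: "bounded_op UNIV UNIV (T i)"
  using contrT i by (simp add: contraction_op_iff)

lemma T_power: "T i ((op_prod n T ^^ m) h) = (op_prod n T ^^ m) (T i h)"
proof -
  have "T i (op_prod n T x) = op_prod n T (T i x)" for x
    unfolding op_prod_def by (rule foldr_intertwine) (rule commuting_on_upt[OF commT], use i in auto)
  then show ?thesis by (induction m) simp_all
qed

lemma Js_X: "Js (X i h) = T i h"
  by (simp add: X_def lin Js_J Js_E)

lemma Js_Vpow: "Js ((V ^^ m) y) = (op_prod n T ^^ m) (Js y)"
  by (induction m) (simp_all add: Js_V)

text \<open>
  \<open>V\<^sup>m X h\<close> has the same Gram matrix as \<open>V\<^sup>m J h\<close>.  For \<open>p = 0\<close> this is the relation between the projection \<open>P\<^sub>i\<close> and the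
  defect operator of \<open>T\<^sub>i\<close>.  For \<open>p > 0\<close> the formula for \<open>D\<^sub>T T\<^sub>i\<close> enters as well; its summand with \<open>a\<close> drops out
  since the ranges of \<open>a\<close> and \<open>b\<close> are orthogonal.
\<close>

lemma inner_Vpow_X: "inner ((V ^^ p) (X i h)) (X i g) = inner ((op_prod n T ^^ p) h) g"
proof -
  have split: "inner y (X i g) = inner (Js y) (T i g) + inner (Es y) (b i (D g))" for y
    by (simp add: X_def inner_add_right inner_adj2[OF J] inner_adj2[OF E])
  show ?thesis
  proof (cases p)
    case 0
    have "Es (X i h) = b i (D h)"
      by (simp add: X_def elin Es_J Es_E b_in D_in)
    then show ?thesis
      by (simp add: 0 split Js_X inner_b_defect)
  next
    case (Suc q)
    let ?k = "(op_prod n T ^^ q) h"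
    have 1: "Js ((V ^^ p) (X i h)) = T i (op_prod n T ?k)"
      using T_power[of p h] by (simp add: Js_V Js_Vpow Js_X Suc)
    have "Es ((V ^^ p) (X i h)) = D (T i ?k)"
      by (simp add: Suc Es_V_eq Js_Vpow Js_X T_power)
    then have 2: "Es ((V ^^ p) (X i h)) = a i (D ?k) + b i (D (op_prod n T ?k))"
      by (simp only: data_defect[OF i])
    show ?thesis
      unfolding split 1 2 by (simp add: inner_add_left inner_a_b D_in inner_b_defect Suc)
  qed
qed

lemma inner_Vpow_X_Vpow_X:
  "inner ((V ^^ m) (X i h)) ((V ^^ l) (X i g)) = inner ((V ^^ m) (J h)) ((V ^^ l) (J g))"
proof -
  have le: "inner ((V ^^ (p + q)) (X i x)) ((V ^^ q) (X i y)) = inner ((V ^^ (p + q)) (J x)) ((V ^^ q) (J y))" for p q x y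
  proof -
    have pow: "(V ^^ (p + q)) z = (V ^^ q) ((V ^^ p) z)" for z
      by (subst add.commute) (simp add: funpow_add)
    show ?thesis
      unfolding pow inner_Vpow inner_Vpow_X by (simp add: Js_Vpow_J flip: inner_adj2[OF J])
  qed
  show ?thesis
  proof (cases "l \<le> m")
    case True
    then show ?thesis using le[of "m - l" l h g] by simp
  next
    case False
    then show ?thesis using le[of "l - m" m g h] by (simp add: inner_commute)
  qed
qed

lemma factor_exists: "\<exists>W. isometry_op W \<and> (\<forall>m h. W ((V ^^ m) (J h)) = (V ^^ m) (X i h))"
proof -
  have "c *\<^sub>C X i h = X i (c *\<^sub>C h)" for c h
    by (simp add: X_def elin bounded_op_scaleC[OF bT] b_scaleC D_in scaleC_add_right)
  then have "c *\<^sub>C (V ^^ m) (X i h) = (V ^^ m) (X i (c *\<^sub>C h))" for c m h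
    by (simp flip: bounded_op_scaleC[OF Vpow_bounded])
  then show ?thesis
    by (rule isometry_from_gram) (rule inner_Vpow_X_Vpow_X)
qed

end

definition W :: "nat \<Rightarrow> 'k \<Rightarrow> 'k" where
  "W i = (SOME W. isometry_op W \<and> (\<forall>m h. W ((V ^^ m) (J h)) = (V ^^ m) (X i h)))"

lemma W_isometry: "i \<in> {1..n} \<Longrightarrow> isometry_op (W i)"
  and W_Vpow_J: "i \<in> {1..n} \<Longrightarrow> W i ((V ^^ m) (J h)) = (V ^^ m) (X i h)"
  using someI_ex[OF factor_exists] unfolding W_def by blast+

lemmas W_bounded = isometry_op_bounded[OF W_isometry]

lemma W_J: "i \<in> {1..n} \<Longrightarrow> W i (J h) = X i h"
  using W_Vpow_J[of i 0 h] by simp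

lemma W_V: 
  assumes i: "i \<in> {1..n}"
  shows "W i (V x) = V (W i x)"
proof (rule bounded_ops_eqI[OF bounded_op_compose[OF W_bounded[OF i] V] bounded_op_compose[OF V W_bounded[OF i]]])
  show "W i (V ((V ^^ m) (J h))) = V (W i ((V ^^ m) (J h)))" for m h
    using W_Vpow_J[OF i, of "Suc m" h] W_Vpow_J[OF i, of m h] by simp
qed

lemma W_Vpow: "i \<in> {1..n} \<Longrightarrow> W i ((V ^^ m) x) = (V ^^ m) (W i x)"
  by (induction m) (simp_all add: W_V)

lemma Js_W:
  assumes i: "i \<in> {1..n}"
  shows "Js (W i x) = T i (Js x)"
  by (rule Js_intertwine[OF W_bounded[OF i] bT[OF i]])
     (simp only: W_Vpow_J[OF i] Js_Vpow[OF i] Js_X[OF i] T_power[OF i])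

text \<open>
  On the dense set of vectors \<open>D\<^sub>T h\<close> the claim is the formula for \<open>D\<^sub>T T\<^sub>i\<close>, inserted into
  \<open>W\<^sub>i E D\<^sub>T h = V X h - X T h\<close>.
\<close>

lemma symbol_W_i:
  assumes i: "i \<in> {1..n}"
  shows "symbol (W i) (a i) (b i)"
proof -
  \<comment> \<open>\<open>E\<^sup>* E\<close> is the projection onto \<open>\<D>\<^sub>T\<close>; it extends operators on \<open>\<D>\<^sub>T\<close> to the whole space.\<close>
  let ?p = "\<lambda>x. Es (E x)"
  have p: "bounded_op UNIV UNIV ?p" by (rule bounded_op_compose[OF Es E])
  have on_S: "bounded_op UNIV UNIV (\<lambda>x. f (?p x))"
    if f: "bounded_op S S f" for f :: "'h \<Rightarrow> 'h"
  proof -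
    obtain C where C: "\<forall>x\<in>S. norm (f x) \<le> C * norm x" using f by (auto simp: bounded_op_def)
    obtain C' where C': "\<forall>x. norm (?p x) \<le> C' * norm x" using p by (auto simp: bounded_op_def)
    have "norm (f (?p x)) \<le> (\<bar>C\<bar> * C') * norm x" for x
    proof -
      have "norm (f (?p x)) \<le> C * norm (?p x)" using C Es_in by blast
      also have "\<dots> \<le> \<bar>C\<bar> * norm (?p x)" by (intro mult_right_mono) auto
      also have "\<dots> \<le> \<bar>C\<bar> * (C' * norm x)" using C' by (intro mult_left_mono) auto
      finally show ?thesis by (simp add: mult_ac)
    qed
    then show ?thesis
      using f by (auto simp: bounded_op_def elin Es_in intro!: exI[of _ "\<bar>C\<bar> * C'"])
  qed
  have norm_Ua: "norm (Ua i x) = norm x" if "x \<in> S" for x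
    using inner_U[OF i Ua_in[OF i], of x x] that
    by (simp add: U_Ua[OF i] norm_eq_sqrt_inner)
  have "(norm (a i x))\<^sup>2 + (norm (b i x))\<^sup>2 = (norm x)\<^sup>2" if "x \<in> S" for x
  proof -
    have "(norm (a i x + b i x))\<^sup>2 = (norm (a i x))\<^sup>2 + (norm (b i x))\<^sup>2"
      using inner_a_b[OF i that that] by (simp add: power2_norm_eq_inner inner_simps inner_commute)
    then show ?thesis by (simp add: a_plus_b[OF i] norm_Ua[OF that])
  qed
  then have bound: "norm (a i x) \<le> 1 * norm x" "norm (b i x) \<le> 1 * norm x" if "x \<in> S" for x
    using that by (smt (verit) power2_le_imp_le norm_ge_zero zero_le_power2 mult_1)+
  have ab: "bounded_op S S (a i)" "bounded_op S S (b i)"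
    unfolding bounded_op_def
    by (intro conjI ballI allI exI[of _ 1] a_in[OF i] b_in[OF i] a_plus[OF i] b_plus[OF i]
        a_scaleC[OF i] b_scaleC[OF i] bound; assumption)+
  have "W i (E d) = E (a i d) + V (E (b i d))" if d: "d \<in> S" for d
  proof -
    have "W i (E d) = E (a i (?p d)) + V (E (b i (?p d)))"
    proof (rule eq_on_S[OF _ _ _ d])
      show "bounded_op UNIV UNIV (\<lambda>d. W i (E d))"
        by (rule bounded_op_compose[OF W_bounded[OF i] E])
      show "bounded_op UNIV UNIV (\<lambda>d. E (a i (?p d)) + V (E (b i (?p d))))"
        by (rule bounded_op_add[OF bounded_op_compose[OF E on_S[OF ab(1)]]
              bounded_op_compose[OF V bounded_op_compose[OF E on_S[OF ab(2)]]]])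
      fix h
      have "W i (E (D h)) = V (X i h) - X i (op_prod n T h)"
        by (simp add: E_defect bounded_op_minus[OF W_bounded[OF i]] W_V[OF i] W_J[OF i])
      also have "\<dots> = E (D (T i h)) + V (E (b i (D h))) - E (b i (D (op_prod n T h)))"
        using T_power[OF i, of 1 h] by (simp add: X_def lin V_J)
      also have "\<dots> = E (a i (D h)) + V (E (b i (D h)))"
        by (simp add: data_defect[OF i] elin)
      finally show "W i (E (D h)) = E (a i (?p (D h))) + V (E (b i (?p (D h))))"
        by (simp add: Es_E D_in)
    qed
    then show ?thesis by (simp add: Es_E d)
  qed
  then show ?thesis
    by (simp add: symbol_def W_bounded[OF i] W_V[OF i] a_in[OF i] b_in[OF i])
qed

sublocale symbol_tuple J "op_prod n T" V E n U P W
  using symbol_W_i by unfold_locales (simp add: a_def[abs_def] b_def[abs_def])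

lemma b_commute:
  assumes i: "i \<in> {1..n}" and j: "j \<in> {1..n}" and x: "x \<in> S"
  shows "b i (b j x) = b j (b i x)"
proof -
  have adj: "inner (b k y) z = inner y (U k (P k z))" if "k \<in> {1..n}" "y \<in> S" "z \<in> S" for k y z
  proof -
    have "inner (b k y) z = inner (Ua k y) (P k z)"
      unfolding b_def using that by (intro P_sym Ua_in)
    also have "\<dots> = inner y (U k (P k z))"
      using inner_U[OF that(1) P_in[OF that(1,3)], of y] by (simp add: inner_commute)
    finally show ?thesis .
  qed
  have UP: "U k (P k z) \<in> S" if "k \<in> {1..n}" "z \<in> S" for k z
    using that by (intro U_in P_in)
  show ?thesis
  proof (rule inner_ext_on[OF S_sub])
    show "b i (b j x) \<in> S" "b j (b i x) \<in> S"
      by (simp_all only: b_in[OF i] b_in[OF j] x)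
    fix z assume z: "z \<in> S"
    have "inner (b i (b j x)) z = inner x (U j (P j (U i (P i z))))"
      by (simp only: adj[OF i b_in[OF j x] z] adj[OF j x UP[OF i z]])
    also have "\<dots> = inner x (U i (P i (U j (P j z))))"
      by (simp only: data_high[OF i j z])
    also have "\<dots> = inner (b j (b i x)) z"
      by (simp only: adj[OF j b_in[OF i x] z] adj[OF i x UP[OF j z]])
    finally show "inner (b i (b j x)) z = inner (b j (b i x)) z" .
  qed
qed

lemma Ua_commute:
  assumes i: "i \<in> {1..n}" and j: "j \<in> {1..n}" and x: "x \<in> S"
  shows "Ua i (Ua j x) = Ua j (Ua i x)"
proof -
  have "U i (U j (Ua j (Ua i x))) = x"
    by (simp only: U_Ua[OF j Ua_in[OF i]] U_Ua[OF i x])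
  moreover have "U i (U j (Ua i (Ua j x))) = U j (U i (Ua i (Ua j x)))"
    using data_comm i j Ua_in[OF i] unfolding commuting_on_def by blast
  then have "U i (U j (Ua i (Ua j x))) = x"
    by (simp only: U_Ua[OF i Ua_in[OF j]] U_Ua[OF j x])
  ultimately show ?thesis
    by (metis Ua_U[OF i] Ua_U[OF j] U_in[OF j] Ua_in[OF i] Ua_in[OF j])
qed

text \<open>
  The coefficient of \<open>z\<close> in the commutator of two symbols.  The extreme coefficients commute by assumption, and so
  do the values \<open>U\<^sub>i\<^sup>*\<close> at \<open>z = 1\<close>.
\<close>

lemma mixed_commute:
  assumes i: "i \<in> {1..n}" and j: "j \<in> {1..n}" and x: "x \<in> S"
  shows "a i (b j x) + b i (a j x) = a j (b i x) + b j (a i x)"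
proof -
  have expand: "Ua k (Ua l x) = a k (a l x) + (a k (b l x) + b k (a l x)) + b k (b l x)"
    if k: "k \<in> {1..n}" and l: "l \<in> {1..n}" for k l
  proof -
    have "Ua k (Ua l x) = a k (a l x + b l x) + b k (a l x + b l x)"
      by (simp only: a_plus_b[OF k] a_plus_b[OF l])
    then show ?thesis
      using a_plus[OF k a_in[OF l x] b_in[OF l x]] b_plus[OF k a_in[OF l x] b_in[OF l x]]
      by (simp add: algebra_simps)
  qed
  show ?thesis
    using Ua_commute[OF i j x] data_low[OF i j x] b_commute[OF i j x]
    unfolding expand[OF i j] expand[OF j i] by simp
qed

text \<open>
  Both products agree on \<open>J h\<close>: their components outside \<open>J \<H>\<close> are coefficients of products of symbols, applied to
  \<open>D\<^sub>T h\<close> and \<open>D\<^sub>T T h\<close>.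
\<close>

lemma W_commute:
  assumes i: "i \<in> {1..n}" and j: "j \<in> {1..n}"
  shows "W i (W j x) = W j (W i x)"
proof (rule bounded_ops_eqI[OF bounded_op_compose[OF W_bounded[OF i] W_bounded[OF j]]
      bounded_op_compose[OF W_bounded[OF j] W_bounded[OF i]]])
  fix m h
  have expand: "W k (W l (J h)) = J (T k (T l h)) + E (b k (b l (D (op_prod n T h)))
      + (a k (b l (D h)) + b k (a l (D h)))) + V (E (b k (b l (D h))))"
    if k: "k \<in> {1..n}" and l: "l \<in> {1..n}" for k l
  proof -
    have "W k (W l (J h)) = X k (T l h) + W k (E (b l (D h)))"
      by (simp add: W_J[OF l] X_def[of l] bounded_op_plus[OF W_bounded[OF k]] W_J[OF k])
    also have "W k (E (b l (D h))) = E (a k (b l (D h))) + V (E (b k (b l (D h))))"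
      using symbol_W_i[OF k] b_in[OF l D_in] by (simp add: symbol_def)
    also have "X k (T l h) = J (T k (T l h)) + E (b k (a l (D h)) + b k (b l (D (op_prod n T h))))"
      by (simp add: X_def data_defect[OF l] b_plus[OF k a_in[OF l D_in] b_in[OF l D_in]])
    finally show ?thesis by (simp add: elin algebra_simps)
  qed
  have "T i (T j h) = T j (T i h)"
    using commT i j by (simp add: commuting_on_def)
  then have "W i (W j (J h)) = W j (W i (J h))"
    unfolding expand[OF i j] expand[OF j i] mixed_commute[OF i j D_in] b_commute[OF i j D_in] by simp
  then show "W i (W j ((V ^^ m) (J h))) = W j (W i ((V ^^ m) (J h)))"
    by (simp add: W_Vpow[OF i] W_Vpow[OF j])
qed

lemma prod_W_isometry: "isometry_op (op_prod n W)"
  unfolding op_prod_def by (rule isometry_op_foldr) (rule W_isometry, auto)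

lemma Js_prod_W: "Js (op_prod n W x) = op_prod n T (Js x)"
  unfolding op_prod_def by (rule foldr_intertwine) (rule Js_W, auto)

lemma prod_W_V: "op_prod n W (V x) = V (op_prod n W x)"
  unfolding op_prod_def by (rule foldr_intertwine[symmetric]) (rule W_V[symmetric], auto)

lemma prod_W_E:
  assumes d: "d \<in> S"
  shows "op_prod n W (E d) = V (E d)"
proof -
  have "symbol (foldr W [1..<Suc n]) (\<lambda>d. R (Suc n) d - F (Suc n) (R (Suc n) d)) (\<lambda>d. F (Suc n) (R (Suc n) d))"
  proof (rule symbol_product)
    fix j assume j: "j \<in> {1..n}"
    then have j': "1 \<le> j" "j \<le> Suc n" by auto
    show "\<forall>d\<in>S. F j (R j (P j (Ua j d))) = 0"
    proof
      fix d assume d: "d \<in> S"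
      have u: "Ua j d \<in> S" by (rule Ua_in[OF j])
      have "R j (P j (Ua j d)) = Q j (R j (Ua j d))"
        by (simp only: Q_def Ri_R[OF j' u])
      then show "F j (R j (P j (Ua j d))) = 0"
        using F_vanishes[OF F_total j R_in[OF j' u]] by simp
    qed
  qed auto
  then have "foldr W [1..<Suc n] (E d) = E (R (Suc n) d - F (Suc n) (R (Suc n) d)) + V (E (F (Suc n) (R (Suc n) d)))"
    using d unfolding symbol_def by blast
  moreover have "R (Suc n) d = d"
    using R_Ri[of "Suc n" d] op_prod_eq_Ri[OF data_comm d] data_prod[OF d] d by simp
  ultimately show ?thesis
    unfolding op_prod_def[of n W] by (simp add: F_total[OF d] elin del: upt_Suc)
qed

text \<open>
  On the wandering subspace the product of the \<open>W\<^sub>i\<close> equals \<open>V\<close>.  Being isometries that commute, the product and \<open>V\<close> then have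
  the same inner products with \<open>E D\<^sub>T h\<close>, whence \<open>inner (W J h) (V J h) = \<parallel>h\<parallel>\<^sup>2\<close>, the case of equality in the
  Cauchy-Schwarz inequality.
\<close>

lemma prod_W: "op_prod n W x = V x"
proof (rule bounded_ops_eqI[OF isometry_op_bounded[OF prod_W_isometry] V])
  let ?W = "op_prod n W"
  fix m h
  have "inner (?W (J h)) (E (D h)) = inner (V (?W (J h))) (V (E (D h)))"
    by (simp only: inner_V)
  also have "\<dots> = inner (?W (V (J h))) (?W (E (D h)))"
    by (simp only: prod_W_V prod_W_E[OF D_in])
  also have "\<dots> = inner (V (J h)) (E (D h))"
    by (rule isometry_op_inner[OF prod_W_isometry])
  also have "\<dots> = inner (D h) (D h)"
    by (simp add: V_J inner_add_left inner_J_right Js_E E_isometric D_in)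
  finally have "inner (?W (J h)) (V (J h)) = inner (op_prod n T h) (op_prod n T h) + inner (D h) (D h)"
    by (simp add: V_J inner_add_right inner_adj2[OF J, symmetric] Js_prod_W Js_J)
  then have "inner (?W (J h)) (V (J h)) = inner h h"
    by (simp add: inner_defect[OF contr])
  then have "inner (?W (J h) - V (J h)) (?W (J h) - V (J h)) = 0"
    by (simp add: inner_diff_left inner_diff_right isometry_op_inner[OF prod_W_isometry] inner_V inner_J inner_commute)
  then have "?W (J h) = V (J h)" by simp
  moreover have "?W ((V ^^ m) x) = (V ^^ m) (?W x)" for x
    by (induction m) (simp_all add: prod_W_V)
  ultimately show "?W ((V ^^ m) (J h)) = V ((V ^^ m) (J h))"
    by (simp add: funpow_swap1)
qed

lemma dilation_tuple_W: "dilation_tuple n J T W"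
proof
  have "(\<lambda>x. op_prod n W x) = V" using prod_W by auto
  then show "minimal_isometric_dilation1 J (op_prod n T) (op_prod n W)"
    using dil by simp
  have "J (op_monomial n T k h) = proj_onto (range J) (op_monomial n W k (J h))" for k h
  proof -
    have pow: "Js ((W i ^^ m) x) = (T i ^^ m) (Js x)" if "i \<in> {1..n}" for i m x
      using Js_W[OF that] by (induction m) simp_all
    have "Js (op_monomial n W k (J h)) = op_monomial n T k (Js (J h))"
      unfolding op_monomial_def op_prod_def by (rule foldr_intertwine) (rule pow, auto)
    then show ?thesis by (simp only: proj_onto_range[OF isoJ] Js_J)
  qed
  then show "isometric_dilation n J T W"
    using isoJ W_isometry W_commute by (simp add: isometric_dilation_def commuting_on_def)
qed (fact contrT, fact commT)

end

section \<open>The characterisation of the dilations\<close>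

text \<open>
  Both sets of data produce dilations on the same space with the same product \<open>V\<close>.  These coincide, hence so do
  their symbols, and \<open>U\<^sub>i\<^sup>* = a + b\<close> and \<open>P\<^sub>i U\<^sub>i\<^sup>* = b\<close> recover the data.
\<close>

lemma (in dilation_data_tuple) data_determined:
  assumes "dilation_data n T P' U'" and i: "i \<in> {1..n}" and x: "x \<in> S"
  shows "P' i x = P i x \<and> U' i x = U i x"
proof -
  interpret data': dilation_data_tuple J n T V E U' P'
    by unfold_locales (use contrT commT assms(1) in auto)
  have prod: "op_prod n W = op_prod n data'.W"
    using prod_W data'.prod_W by (simp add: fun_eq_iff)
  have "W i y = data'.W i y" for y
    by (rule dilation_tuple_unique[OF dilation_tuple_W data'.dilation_tuple_W prod i])
  then have "data'.W i = W i" by (simp add: fun_eq_iff)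
  then have ab: "a i d = data'.a i d \<and> b i d = data'.b i d" if "d \<in> S" for d
    using symbol_unique[OF symbol_W_i[OF i] _ that] data'.symbol_W_i[OF i] by simp
  then have Ua: "Ua i d = data'.Ua i d" if "d \<in> S" for d
    using a_plus_b[OF i, of d] data'.a_plus_b[OF i, of d] that by simp
  have U: "U' i y = U i y" if y: "y \<in> S" for y
  proof -
    have "U' i y = U' i (data'.Ua i (U i y))"
      using Ua[OF U_in[OF i y]] by (simp add: Ua_U[OF i y])
    also have "\<dots> = U i y" by (rule data'.U_Ua[OF i U_in[OF i y]])
    finally show ?thesis .
  qed
  have "P' i x = P' i (data'.Ua i (U' i x))" by (simp add: data'.Ua_U[OF i x])
  also have "\<dots> = P i (Ua i (U i x))"
    using ab[OF U_in[OF i x]] by (simp add: U[OF x] b_def data'.b_def)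
  also have "\<dots> = P i x" by (simp add: Ua_U[OF i x])
  finally show ?thesis using U[OF x] by simp
qed

theorem theorem1p1:
  fixes T :: "nat \<Rightarrow> 'h::complex_hilbert \<Rightarrow> 'h" and n :: nat
  assumes "n \<ge> 1"
    and "\<forall>i\<in>{1..n}. contraction_op (T i)"
    and "commuting_on UNIV n T"
  shows
   "(\<forall>J :: 'h \<Rightarrow> 'k::complex_hilbert.
      (\<exists>V0. minimal_isometric_dilation1 J (op_prod n T) V0) \<longrightarrow>
      ((\<exists>V. isometric_dilation n J T V \<and>
            minimal_isometric_dilation1 J (op_prod n T) (op_prod n V))
       \<longleftrightarrow>
       (\<exists>P U. dilation_data n T P U \<and>
          (\<forall>P' U'. dilation_data n T P' U' \<longrightarrow>
             (\<forall>i\<in>{1..n}. \<forall>x\<in>defect_space (op_prod n T). P' i x = P i x \<and> U' i x = U i x)))))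
    \<and>
    (\<forall>(J :: 'h \<Rightarrow> 'k) V.
      isometric_dilation n J T V \<and>
      minimal_isometric_dilation1 J (op_prod n T) (op_prod n V) \<longrightarrow>
      minimal_isometric_dilation n J T V)
    \<and>
    (\<forall>(J1 :: 'h \<Rightarrow> 'k1::complex_hilbert) (J2 :: 'h \<Rightarrow> 'k2::complex_hilbert) W Y.
      isometric_dilation n J1 T W \<and>
      minimal_isometric_dilation1 J1 (op_prod n T) (op_prod n W) \<and>
      isometric_dilation n J2 T Y \<and>
      minimal_isometric_dilation1 J2 (op_prod n T) (op_prod n Y) \<longrightarrow>
      (\<exists>Ut. unitary_op UNIV UNIV Ut \<and>
         (\<forall>i\<in>{1..n}. \<forall>x. W i x = adj_on UNIV Ut (Y i (Ut x)))))"
proof (intro conjI allI impI)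
  fix J :: "'h \<Rightarrow> 'k"
  assume "\<exists>V0. minimal_isometric_dilation1 J (op_prod n T) V0"
  then obtain V0 where V0: "minimal_isometric_dilation1 J (op_prod n T) V0" ..
  have "contraction_op (op_prod n T)"
    unfolding op_prod_def using assms(2) by (intro contraction_op_foldr) auto
  then interpret minimal_dilation J "op_prod n T" V0
    using V0 by unfold_locales
  obtain E where emb: "dilation_embedding J (op_prod n T) V0 E"
    using embedding_exists by blast
  have tuple: "dilation_data_tuple J n T V0 E U P" if "dilation_data n T P U" for P U
    using that assms(2,3) emb
    by (intro dilation_data_tuple.intro dilation_data_tuple_axioms.intro)
  show "(\<exists>V. isometric_dilation n J T V \<and> minimal_isometric_dilation1 J (op_prod n T) (op_prod n V))
     \<longleftrightarrow> (\<exists>P U. dilation_data n T P U \<and>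
          (\<forall>P' U'. dilation_data n T P' U' \<longrightarrow>
             (\<forall>i\<in>{1..n}. \<forall>x\<in>defect_space (op_prod n T). P' i x = P i x \<and> U' i x = U i x)))"
    (is "?dilates \<longleftrightarrow> ?data")
  proof
    assume ?dilates
    then obtain V where "dilation_tuple n J T V"
      using assms(2,3) dilation_tuple.intro by blast
    then obtain P U where "dilation_data n T P U"
      using dilation_tuple.exists_data by blast
    then show ?data
      using dilation_data_tuple.data_determined[OF tuple] by blast
  next
    assume ?data
    then obtain P U where "dilation_data n T P U" by blast
    then show ?dilates
      using dilation_data_tuple.dilation_tuple_W[OF tuple] unfolding dilation_tuple_def by blast
  qed
next
  fix J :: "'h \<Rightarrow> 'k" and V
  assume "isometric_dilation n J T V \<and> minimal_isometric_dilation1 J (op_prod n T) (op_prod n V)"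
  then show "minimal_isometric_dilation n J T V"
    using dilation_tuple.minimal_tuple[OF dilation_tuple.intro] assms(2,3) by blast
next
  fix J1 :: "'h \<Rightarrow> 'k1" and J2 :: "'h \<Rightarrow> 'k2" and W Y
  assume "isometric_dilation n J1 T W \<and> minimal_isometric_dilation1 J1 (op_prod n T) (op_prod n W) \<and>
      isometric_dilation n J2 T Y \<and> minimal_isometric_dilation1 J2 (op_prod n T) (op_prod n Y)"
  then show "\<exists>Ut. unitary_op UNIV UNIV Ut \<and> (\<forall>i\<in>{1..n}. \<forall>x. W i x = adj_on UNIV Ut (Y i (Ut x)))"
    using dilation_tuples_unitarily_equivalent[OF dilation_tuple.intro dilation_tuple.intro] assms(2,3)
    by blast
qed

end
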